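(* Every infinite introenumerable set $A\subseteq\omega$ contains an infinite uniformly introreducible subset. More precisely, for every infinite introenumerable set $A\subseteq\omega$ there exist a nonempty $\Sigma^1_1(A)$ class $\mathcal K\subseteq[A]^\omega$ and two Turing functionals $\Psi,\Theta$ such that $$\forall R\in\mathcal K\ \ \forall D\in[R]^\omega\qquad \Psi^D=A\quad\text{and}\quad\Theta^D=R.$$
   Context: $\omega=\{0,1,2,\dots\}$. For $B\subseteq\omega$, $[B]^\omega$ is the collection of all infinite subsets of $B$. Sets are identified with their characteristic functions. For a Turing functional $\Phi$ and an oracle $D$, $\Phi^D=A$ means that $\Phi^D$ is total and equals the characteristic function of $A$. Functionals are ordinary: they receive only the oracle displayed, so $\Psi^D,\Theta^D$ use only the oracle $D$. An infinite set $A\subseteq\omega$ is introenumerable if $A$ is c.e. relative to $D$ for every $D\in[A]^\omega$ (the c.e. index may depend on $D$). An infinite set $R$ is uniformly introreducible if there is a single Turing functional $\Phi$ such that $\Phi^D=R$ for every $D\in[R]^\omega$. A $\Sigma^1_1(A)$ class is a class of subsets of $\omega$ definable by a lightface $\Sigma^1_1$ formula with set parameter $A$, i.e. of the form $\{R:\exists f\in\omega^\omega\ \varphi(R,f,A)\}$ with $\varphi$ arithmetical. *)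

theory Defs
  imports Main
begin

text \<open>
  Turing functionals are given by Kleene's schemata for the functions that are partial recursive
  relative to an oracle: the basic functions, the characteristic function of the oracle,
  composition, primitive recursion and unbounded search. A program denotes a partial function of
  lists of arguments, uniformly in the oracle; as a functional \<open>\<Phi>\<close> it is used with a single
  argument, \<open>\<Phi>\<^sup>D(n)\<close> being \<open>run D \<Phi> [n]\<close>, and divergence is \<open>None\<close>.
\<close>

datatype functional =
    Zero
  | Succ
  | Proj nat
  | Orc
  | Comp functional "functional list"
  | PrimRec functional functional
  | Mu functional

text \<open>
  Arities are not part of the syntax: \<open>Zero\<close> accepts argument lists of any length, \<open>Proj\<close> any
  list that is long enough, and an unsuitable argument list leads to divergence.
  In the recursion scheme the recursion variable is the first argument, and the step function
  receives it, the previous value, and the parameters, in this order. In \<open>Mu f\<close> the search is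
  over the first argument of \<open>f\<close> and, as usual, converges to \<open>n\<close> only if \<open>f\<close> converges on all
  smaller candidates.
\<close>

fun run :: "nat set \<Rightarrow> functional \<Rightarrow> nat list \<Rightarrow> nat option" where
  "run D Zero xs = Some 0"
| "run D Succ xs = (case xs of [x] \<Rightarrow> Some (Suc x) | _ \<Rightarrow> None)"
| "run D (Proj i) xs = (if i < length xs then Some (xs ! i) else None)"
| "run D Orc xs = (case xs of [x] \<Rightarrow> Some (of_bool (x \<in> D)) | _ \<Rightarrow> None)"
| "run D (Comp f gs) xs =
     (if \<forall>g \<in> set gs. run D g xs \<noteq> None
      then run D f (map (\<lambda>g. the (run D g xs)) gs) else None)"
| "run D (PrimRec f g) xs =
     (case xs of [] \<Rightarrow> None
      | n # ys \<Rightarrow>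
          rec_nat (run D f ys)
            (\<lambda>m r. case r of None \<Rightarrow> None | Some v \<Rightarrow> run D g (m # v # ys)) n)"
| "run D (Mu f) xs =
     (if \<exists>n. run D f (n # xs) = Some 0 \<and> (\<forall>m < n. run D f (m # xs) \<noteq> None)
      then Some (LEAST n. run D f (n # xs) = Some 0) else None)"

definition computes :: "functional \<Rightarrow> nat set \<Rightarrow> nat set \<Rightarrow> bool" where
  "computes \<Phi> D A \<longleftrightarrow> (\<forall>n. run D \<Phi> [n] = Some (of_bool (n \<in> A)))"

definition ce_in :: "nat set \<Rightarrow> nat set \<Rightarrow> bool" where
  "ce_in D A \<longleftrightarrow> (\<exists>\<Phi>. A = {n. run D \<Phi> [n] \<noteq> None})"

definition infinite_subsets :: "nat set \<Rightarrow> nat set set" where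
  "infinite_subsets B = {D. D \<subseteq> B \<and> infinite D}"

definition introenumerable :: "nat set \<Rightarrow> bool" where
  "introenumerable A \<longleftrightarrow> infinite A \<and> (\<forall>D \<in> infinite_subsets A. ce_in D A)"

definition uniformly_introreducible :: "nat set \<Rightarrow> bool" where
  "uniformly_introreducible R \<longleftrightarrow>
     infinite R \<and> (\<exists>\<Phi>. \<forall>D \<in> infinite_subsets R. computes \<Phi> D R)"

text \<open>
  Arithmetical formulas \<open>\<phi>(R, f, A)\<close>: first-order formulas in the language of arithmetic expanded
  by the set variables \<open>R\<close> and \<open>A\<close> and the function variable \<open>f\<close>; all quantifiers are over numbers.
\<close>

datatype aterm =
    TVar nat
  | TZero
  | TSuc aterm
  | TAdd aterm aterm
  | TMul aterm aterm
  | TFun aterm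

datatype aform =
    Eq aterm aterm
  | InR aterm
  | InA aterm
  | Neg aform
  | Conj aform aform
  | Ex nat aform

primrec tval :: "(nat \<Rightarrow> nat) \<Rightarrow> (nat \<Rightarrow> nat) \<Rightarrow> aterm \<Rightarrow> nat" where
  "tval f e (TVar x) = e x"
| "tval f e TZero = 0"
| "tval f e (TSuc t) = Suc (tval f e t)"
| "tval f e (TAdd s t) = tval f e s + tval f e t"
| "tval f e (TMul s t) = tval f e s * tval f e t"
| "tval f e (TFun t) = f (tval f e t)"

primrec sat :: "nat set \<Rightarrow> (nat \<Rightarrow> nat) \<Rightarrow> nat set \<Rightarrow> aform \<Rightarrow> (nat \<Rightarrow> nat) \<Rightarrow> bool" where
  "sat R f A (Eq s t) e \<longleftrightarrow> tval f e s = tval f e t"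
| "sat R f A (InR t) e \<longleftrightarrow> tval f e t \<in> R"
| "sat R f A (InA t) e \<longleftrightarrow> tval f e t \<in> A"
| "sat R f A (Neg \<phi>) e \<longleftrightarrow> \<not> sat R f A \<phi> e"
| "sat R f A (Conj \<phi> \<psi>) e \<longleftrightarrow> sat R f A \<phi> e \<and> sat R f A \<psi> e"
| "sat R f A (Ex x \<phi>) e \<longleftrightarrow> (\<exists>n. sat R f A \<phi> (e(x := n)))"

text \<open>
  Number variables that are not bound in \<open>\<phi>\<close> denote \<open>0\<close>, so they are interchangeable with the
  closed term \<open>TZero\<close> and do not introduce further parameters.
\<close>

definition Sigma11_class :: "nat set \<Rightarrow> nat set set \<Rightarrow> bool" where
  "Sigma11_class A K \<longleftrightarrow> (\<exists>\<phi>. K = {R. \<exists>f. sat R f A \<phi> (\<lambda>_. 0)})"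

end

theory Submission imports Defs "HOL-Library.Nat_Bijection" "HOL-Library.Infinite_Set" begin

text \<open>
  Fix an enumeration of the enumeration operators. The type of an infinite \<open>D \<subseteq> A\<close> is the index of the
  operator that, at the first stage where some index qualifies, has enumerated from \<open>D\<close> only elements
  of \<open>A\<close>, and all those below a certain element of \<open>D\<close>. Whether \<open>m\<close> is enumerated no later than \<open>n\<close>
  under that operator is a continuous colouring of the infinite subsets of \<open>A\<close>; on a suitable \<open>X \<subseteq> A\<close>
  the colours of \<open>E \<union> D\<close> (\<open>E\<close> finite, \<open>D \<subseteq> X\<close> far out) depend on \<open>E\<close> only, and \<open>C\<close> is the set of these
  limit colours. Let \<open>R\<close> consist of elements of \<open>A\<close> chosen greedily such that adjoining them to \<open>E\<close>
  never changes the answers of \<open>C\<close>. Then \<open>C\<close> can be read off from the types of \<open>E \<union> D\<close> for any infinite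
  \<open>D \<subseteq> R\<close>, and \<open>R\<close> is recovered from \<open>A\<close> and \<open>C\<close>.

  It remains to decide \<open>A\<close> from \<open>D\<close>. Choose a finite \<open>F0\<close> that determines the type, and for \<open>n \<in> A\<close> let
  \<open>S n\<close> be the set of those \<open>m\<close> that are enumerated no later than \<open>n\<close> after \<open>F0\<close>; it is a subset of \<open>A\<close>.
  If all \<open>S n\<close> are finite, the elements of \<open>R\<close> can be chosen outside the earlier \<open>S n\<close>, so that the
  enumeration of an element of \<open>R\<close> tells which smaller numbers are in \<open>A\<close>. If some \<open>S n\<close> is infinite,
  it is computable from \<open>D\<close> and enumerates \<open>A\<close>, and \<open>R\<close> is chosen sparse enough to bound the stages.

  The class \<open>\<K>\<close> consists of the infinite greedy sets \<open>R\<close> of all \<open>C\<close> that agree with the types decided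
  by finite sets; the function quantifier ranges over \<open>C\<close>.
\<close>

section \<open>Computability relative to a class of oracles\<close>

text \<open>A single program has to serve every oracle in \<open>\<D>\<close>; this is how the
  uniformity of the final functionals is recorded. Oracles outside \<open>\<D>\<close> are
  unconstrained, so an unbounded search has to terminate on \<open>\<D>\<close> only.\<close>

definition cfun :: "nat set set \<Rightarrow> nat \<Rightarrow> (nat set \<Rightarrow> nat list \<Rightarrow> nat) \<Rightarrow> bool" where
  "cfun \<D> k F \<longleftrightarrow> (\<exists>\<Phi>. \<forall>D\<in>\<D>. \<forall>xs. length xs = k \<longrightarrow> run D \<Phi> xs = Some (F D xs))"

abbreviation cpred :: "nat set set \<Rightarrow> nat \<Rightarrow> (nat set \<Rightarrow> nat list \<Rightarrow> bool) \<Rightarrow> bool" where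
  "cpred \<D> k P \<equiv> cfun \<D> k (\<lambda>D xs. of_bool (P D xs))"

lemma cfunI:
  "(\<And>D xs. D \<in> \<D> \<Longrightarrow> length xs = k \<Longrightarrow> run D \<Phi> xs = Some (F D xs)) \<Longrightarrow> cfun \<D> k F"
  unfolding cfun_def by blast

lemma cfun_cong:
  assumes "cfun \<D> k F" "\<And>D xs. D \<in> \<D> \<Longrightarrow> length xs = k \<Longrightarrow> F D xs = G D xs"
  shows "cfun \<D> k G"
  using assms unfolding cfun_def by metis

lemma cfun_nth: "i < k \<Longrightarrow> cfun \<D> k (\<lambda>D xs. xs ! i)"
  by (rule cfunI[of _ _ "Proj i"]) simp

lemma cfun_subst:
  assumes G: "cfun \<D> j G" and Fs: "\<And>F. F \<in> set Fs \<Longrightarrow> cfun \<D> k F" and len: "length Fs = j"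
  shows "cfun \<D> k (\<lambda>D xs. G D (map (\<lambda>F. F D xs) Fs))"
proof -
  obtain \<gamma> where g: "\<And>D xs. D \<in> \<D> \<Longrightarrow> length xs = j \<Longrightarrow> run D \<gamma> xs = Some (G D xs)"
    using G unfolding cfun_def by blast
  have "\<forall>F\<in>set Fs. \<exists>\<Phi>. \<forall>D\<in>\<D>. \<forall>xs. length xs = k \<longrightarrow> run D \<Phi> xs = Some (F D xs)"
    using Fs unfolding cfun_def by blast
  then obtain pr where pr: "\<And>F D xs. F \<in> set Fs \<Longrightarrow> D \<in> \<D> \<Longrightarrow> length xs = k \<Longrightarrow> run D (pr F) xs = Some (F D xs)"
    by metis
  show ?thesis
  proof (rule cfunI[of _ _ "Comp \<gamma> (map pr Fs)"])
    fix D :: "nat set" and xs :: "nat list" assume a: "D \<in> \<D>" "length xs = k"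
    have "map (\<lambda>g. the (run D g xs)) (map pr Fs) = map (\<lambda>F. F D xs) Fs"
      using pr a by simp
    moreover have "\<forall>g\<in>set (map pr Fs). run D g xs \<noteq> None" using pr a by auto
    moreover have "run D \<gamma> (map (\<lambda>F. F D xs) Fs) = Some (G D (map (\<lambda>F. F D xs) Fs))"
      using g a(1) len by simp
    ultimately show "run D (Comp \<gamma> (map pr Fs)) xs = Some (G D (map (\<lambda>F. F D xs) Fs))"
      by (metis (lifting) run.simps(5))
  qed
qed

lemma cfun_app1:
  assumes "cfun \<D> 1 (\<lambda>D ys. g D (ys ! 0))" "cfun \<D> k F"
  shows "cfun \<D> k (\<lambda>D xs. g D (F D xs))"
  using cfun_subst[OF assms(1), of "[F]"] assms(2) by simp

lemma cfun_app2:
  assumes "cfun \<D> 2 (\<lambda>D ys. g D (ys ! 0) (ys ! 1))" "cfun \<D> k F" "cfun \<D> k G"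
  shows "cfun \<D> k (\<lambda>D xs. g D (F D xs) (G D xs))"
  using cfun_subst[OF assms(1), of "[F, G]"] assms(2,3) by auto

text \<open>Substitutes for the head of the argument list and keeps the tail as parameters. Bound
  variables always sit at the head, so the body of a quantifier or search sees the outer arguments
  as the tail.\<close>

lemma cfun_params:
  assumes "cfun \<D> (Suc k) (\<lambda>D ys. g D (ys ! 0) (tl ys))" "cfun \<D> k F"
  shows "cfun \<D> k (\<lambda>D xs. g D (F D xs) xs)"
proof -
  let ?Fs = "F # map (\<lambda>i D xs. xs ! i) [0..<k]"
  have "cfun \<D> k (\<lambda>D xs. (\<lambda>D ys. g D (ys ! 0) (tl ys)) D (map (\<lambda>F. F D xs) ?Fs))"
    by (rule cfun_subst[OF assms(1)]) (use assms(2) in \<open>auto intro!: cfun_nth\<close>)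
  then show ?thesis
    by (rule cfun_cong) (auto simp: o_def map_nth)
qed

lemma cfun_weak:
  assumes "cfun \<D> k F"
  shows "cfun \<D> (Suc k) (\<lambda>D ys. F D (tl ys))"
proof -
  let ?Fs = "map (\<lambda>i D xs. xs ! Suc i) [0..<k]"
  have "cfun \<D> (Suc k) (\<lambda>D xs. F D (map (\<lambda>F. F D xs) ?Fs))"
    by (rule cfun_subst[OF assms]) (auto intro!: cfun_nth)
  then show ?thesis
  proof (rule cfun_cong)
    fix D :: "nat set" and xs :: "nat list" assume "length xs = Suc k"
    then have "map (\<lambda>F. F D xs) ?Fs = tl xs" by (cases xs) (auto simp: o_def map_nth)
    then show "F D (map (\<lambda>F. F D xs) ?Fs) = F D (tl xs)" by simp
  qed
qed

lemma cfun_0: "cfun \<D> k (\<lambda>D xs. 0)"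
  by (rule cfunI[of _ _ Zero]) simp

lemma cfun_Suc: "cfun \<D> k F \<Longrightarrow> cfun \<D> k (\<lambda>D xs. Suc (F D xs))"
  by (rule cfun_app1[of _ "\<lambda>_. Suc"], rule cfunI[of _ _ Succ])
     (auto simp: length_Suc_conv split: list.splits)

lemma cfun_const: "cfun \<D> k (\<lambda>D xs. c)"
  by (induction c) (auto intro: cfun_0 cfun_Suc)

lemma cfun_oracle: "cfun \<D> k F \<Longrightarrow> cpred \<D> k (\<lambda>D xs. F D xs \<in> D)"
  by (rule cfun_app1[of _ "\<lambda>D y. of_bool (y \<in> D)"], rule cfunI[of _ _ Orc])
     (auto simp: length_Suc_conv split: list.splits)

lemma cfun_rec:
  assumes f: "cfun \<D> k F" and g: "cfun \<D> (Suc (Suc k)) (\<lambda>D ys. G D (ys ! 0) (ys ! 1) (tl (tl ys)))"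
    and h0: "\<And>D xs. D \<in> \<D> \<Longrightarrow> length xs = k \<Longrightarrow> h D 0 xs = F D xs"
    and hS: "\<And>D m xs. D \<in> \<D> \<Longrightarrow> length xs = k \<Longrightarrow> h D (Suc m) xs = G D m (h D m xs) xs"
  shows "cfun \<D> (Suc k) (\<lambda>D ys. h D (ys ! 0) (tl ys))"
proof -
  obtain \<phi> where p: "\<And>D xs. D \<in> \<D> \<Longrightarrow> length xs = k \<Longrightarrow> run D \<phi> xs = Some (F D xs)"
    using f unfolding cfun_def by blast
  obtain \<gamma> where q: "\<And>D ys. D \<in> \<D> \<Longrightarrow> length ys = Suc (Suc k) \<Longrightarrow> run D \<gamma> ys = Some (G D (ys ! 0) (ys ! 1) (tl (tl ys)))"
    using g unfolding cfun_def by blast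
  show ?thesis
  proof (rule cfunI[of _ _ "PrimRec \<phi> \<gamma>"])
    fix D :: "nat set" and xs :: "nat list" assume a: "D \<in> \<D>" "length xs = Suc k"
    then obtain n ys where xs: "xs = n # ys" "length ys = k" by (auto simp: length_Suc_conv)
    have "rec_nat (run D \<phi> ys) (\<lambda>m r. case r of None \<Rightarrow> None | Some v \<Rightarrow> run D \<gamma> (m # v # ys)) n = Some (h D n ys)"
      by (induction n) (use p q h0 hS a xs in auto)
    then show "run D (PrimRec \<phi> \<gamma>) xs = Some (h D (xs ! 0) (tl xs))" using xs by simp
  qed
qed

lemma cfun_rec':
  assumes "cfun \<D> k F" "cfun \<D> (Suc (Suc k)) (\<lambda>D ys. G D (ys ! 0) (ys ! 1) (tl (tl ys)))"
    and "\<And>D xs. D \<in> \<D> \<Longrightarrow> length xs = k \<Longrightarrow> h D 0 xs = F D xs"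
    and "\<And>D m xs. D \<in> \<D> \<Longrightarrow> length xs = k \<Longrightarrow> h D (Suc m) xs = G D m (h D m xs) xs"
    and "cfun \<D> k N"
  shows "cfun \<D> k (\<lambda>D xs. h D (N D xs) xs)"
  by (rule cfun_params[OF cfun_rec[OF assms(1-4)] assms(5)])

section \<open>Arithmetic, decidable predicates, bounded quantifiers and search\<close>

lemma cfun_add: assumes "cfun \<D> k F" "cfun \<D> k G" shows "cfun \<D> k (\<lambda>D xs. F D xs + G D xs)"
  by (rule cfun_rec'[where h="\<lambda>D n xs. n + G D xs" and F=G and G="\<lambda>D m r xs. Suc r"])
     (use assms in \<open>auto intro!: cfun_Suc cfun_nth\<close>)

lemma cfun_mult: assumes "cfun \<D> k F" "cfun \<D> k G" shows "cfun \<D> k (\<lambda>D xs. F D xs * G D xs)"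
  by (rule cfun_rec'[where h="\<lambda>D n xs. n * G D xs" and F="\<lambda>_ _. 0" and G="\<lambda>D m r xs. r + G D xs"])
     (use assms in \<open>auto intro!: cfun_0 cfun_nth cfun_add cfun_weak\<close>)

lemma cfun_pow2: assumes "cfun \<D> k F" shows "cfun \<D> k (\<lambda>D xs. 2 ^ F D xs)"
  by (rule cfun_rec'[where h="\<lambda>D n xs. 2 ^ n" and F="\<lambda>_ _. 1" and G="\<lambda>D m r xs. 2 * r"])
     (use assms in \<open>auto intro!: cfun_const cfun_nth cfun_mult\<close>)

lemma cfun_pred: assumes "cfun \<D> k F" shows "cfun \<D> k (\<lambda>D xs. F D xs - 1)"
  by (rule cfun_rec'[where h="\<lambda>D n xs. n - 1" and F="\<lambda>_ _. 0" and G="\<lambda>D m r xs. m"])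
     (use assms in \<open>auto intro!: cfun_const cfun_nth\<close>)

lemma cfun_diff: assumes "cfun \<D> k F" "cfun \<D> k G" shows "cfun \<D> k (\<lambda>D xs. F D xs - G D xs)"
  by (rule cfun_rec'[where h="\<lambda>D n xs. F D xs - n" and F=F and G="\<lambda>D m r xs. r - 1"])
     (use assms in \<open>auto intro!: cfun_nth cfun_pred[unfolded One_nat_def]\<close>)

lemma cpred_zero: assumes "cfun \<D> k F" shows "cpred \<D> k (\<lambda>D xs. F D xs = 0)"
  by (rule cfun_cong[OF cfun_diff[OF cfun_const[of _ _ 1] assms]]) simp

lemma cpred_not: assumes "cpred \<D> k P" shows "cpred \<D> k (\<lambda>D xs. \<not> P D xs)"
  by (rule cfun_cong[OF cfun_diff[OF cfun_const[of _ _ 1] assms]]) simp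

lemma cpred_conj: assumes "cpred \<D> k P" "cpred \<D> k Q" shows "cpred \<D> k (\<lambda>D xs. P D xs \<and> Q D xs)"
  by (rule cfun_cong[OF cfun_mult[OF assms]]) simp

lemma cpred_disj: assumes "cpred \<D> k P" "cpred \<D> k Q" shows "cpred \<D> k (\<lambda>D xs. P D xs \<or> Q D xs)"
  by (rule cfun_cong[OF cpred_not[OF cpred_conj[OF cpred_not[OF assms(1)] cpred_not[OF assms(2)]]]]) simp

lemma cpred_imp: assumes "cpred \<D> k P" "cpred \<D> k Q" shows "cpred \<D> k (\<lambda>D xs. P D xs \<longrightarrow> Q D xs)"
  by (rule cfun_cong[OF cpred_disj[OF cpred_not[OF assms(1)] assms(2)]]) simp

lemma cpred_iff: assumes "cpred \<D> k P" "cpred \<D> k Q" shows "cpred \<D> k (\<lambda>D xs. P D xs \<longleftrightarrow> Q D xs)"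
  by (rule cfun_cong[OF cpred_conj[OF cpred_imp[OF assms] cpred_imp[OF assms(2,1)]]]) auto

lemma cpred_le: assumes "cfun \<D> k F" "cfun \<D> k G" shows "cpred \<D> k (\<lambda>D xs. F D xs \<le> G D xs)"
  by (rule cfun_cong[OF cpred_zero[OF cfun_diff[OF assms]]]) simp

lemma cpred_less: assumes "cfun \<D> k F" "cfun \<D> k G" shows "cpred \<D> k (\<lambda>D xs. F D xs < G D xs)"
  by (rule cfun_cong[OF cpred_not[OF cpred_le[OF assms(2,1)]]]) (simp add: not_le)

lemma cpred_eq: assumes "cfun \<D> k F" "cfun \<D> k G" shows "cpred \<D> k (\<lambda>D xs. F D xs = G D xs)"
  by (rule cfun_cong[OF cpred_conj[OF cpred_le[OF assms] cpred_le[OF assms(2,1)]]]) auto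

lemma cpred_ex:
  assumes "cfun \<D> k B" "cpred \<D> (Suc k) (\<lambda>D ys. P D (ys ! 0) (tl ys))"
  shows "cpred \<D> k (\<lambda>D xs. \<exists>y<B D xs. P D y xs)"
proof (rule cfun_rec'[where h="\<lambda>D n xs. of_bool (\<exists>y<n. P D y xs)" and F="\<lambda>_ _. 0"
        and G="\<lambda>D m r xs. of_bool (\<not> (r = 0) \<or> P D m xs)"])
  have 1: "cfun \<D> (Suc (Suc k)) (\<lambda>D ys. (\<lambda>D zs. of_bool (P D (zs ! 0) (tl zs))) D
      (map (\<lambda>F. F D ys) ((\<lambda>D ys. ys ! 0) # map (\<lambda>i D ys. ys ! Suc (Suc i)) [0..<k])))"
    by (rule cfun_subst[OF assms(2)]) (auto intro!: cfun_nth)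
  have "cpred \<D> (Suc (Suc k)) (\<lambda>D ys. P D (ys ! 0) (tl (tl ys)))"
  proof (rule cfun_cong[OF 1])
    fix D :: "nat set" and ys :: "nat list" assume "length ys = Suc (Suc k)"
    then have "map (\<lambda>F. F D ys) (map (\<lambda>i D ys. ys ! Suc (Suc i)) [0..<k]) = tl (tl ys)"
      by (auto simp: length_Suc_conv o_def map_nth)
    then show "of_bool (P D (map (\<lambda>F. F D ys) ((\<lambda>D ys. ys ! 0) # map (\<lambda>i D ys. ys ! Suc (Suc i)) [0..<k]) ! 0)
          (tl (map (\<lambda>F. F D ys) ((\<lambda>D ys. ys ! 0) # map (\<lambda>i D ys. ys ! Suc (Suc i)) [0..<k])))) =
         (of_bool (P D (ys ! 0) (tl (tl ys))) :: nat)" by simp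
  qed
  then show "cfun \<D> (Suc (Suc k)) (\<lambda>D ys. of_bool (\<not> (ys ! 1 = 0) \<or> P D (ys ! 0) (tl (tl ys))))"
    by (intro cpred_disj cpred_not cpred_zero cfun_nth) auto
qed (use assms(1) in \<open>auto intro!: cfun_0 simp: less_Suc_eq\<close>)

lemma cpred_all:
  assumes "cfun \<D> k B" "cpred \<D> (Suc k) (\<lambda>D ys. P D (ys ! 0) (tl ys))"
  shows "cpred \<D> k (\<lambda>D xs. \<forall>y<B D xs. P D y xs)"
  by (rule cfun_cong[OF cpred_not[OF cpred_ex[OF assms(1), of "\<lambda>D y xs. \<not> P D y xs"]]])
     (auto intro!: cpred_not assms(2))

lemma cpred_all_le:
  assumes "cfun \<D> k B" "cpred \<D> (Suc k) (\<lambda>D ys. P D (ys ! 0) (tl ys))"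
  shows "cpred \<D> k (\<lambda>D xs. \<forall>y\<le>B D xs. P D y xs)"
  using cpred_all[OF cfun_Suc[OF assms(1)] assms(2)] by (simp add: less_Suc_eq_le)

lemma cfun_mu:
  assumes "cpred \<D> (Suc k) (\<lambda>D ys. P D (ys ! 0) (tl ys))"
    and "\<And>D xs. D \<in> \<D> \<Longrightarrow> length xs = k \<Longrightarrow> \<exists>n. P D n xs"
  shows "cfun \<D> k (\<lambda>D xs. LEAST n. P D n xs)"
proof -
  \<comment> \<open>\<open>Mu\<close> looks for the value 0 while truth is coded by 1; the search
    therefore runs on the negation.\<close>
  obtain \<phi> where p: "\<And>D xs. D \<in> \<D> \<Longrightarrow> length xs = Suc k \<Longrightarrow> run D \<phi> xs = Some (of_bool (\<not> P D (xs ! 0) (tl xs)))"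
    using cpred_not[OF assms(1)] unfolding cfun_def by blast
  show ?thesis
  proof (rule cfunI[of _ _ "Mu \<phi>"])
    fix D :: "nat set" and xs :: "nat list" assume a: "D \<in> \<D>" "length xs = k"
    have r: "run D \<phi> (n # xs) = Some (of_bool (\<not> P D n xs))" for n
      using p[of D "n # xs"] a by simp
    have z: "run D \<phi> (n # xs) = Some 0 \<longleftrightarrow> P D n xs" for n using r[of n] by simp
    obtain n where "P D n xs" using assms(2) a by blast
    then have "\<exists>n. run D \<phi> (n # xs) = Some 0 \<and> (\<forall>m<n. run D \<phi> (m # xs) \<noteq> None)"
      using r z by auto
    then show "run D (Mu \<phi>) xs = Some (LEAST n. P D n xs)" by (simp add: z)
  qed
qed

section \<open>Codes of pairs and of finite sets\<close>

lemma cfun_triangle: assumes "cfun \<D> k F" shows "cfun \<D> k (\<lambda>D xs. triangle (F D xs))"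
  by (rule cfun_rec'[where h="\<lambda>D n xs. triangle n" and F="\<lambda>_ _. 0" and G="\<lambda>D m r xs. r + Suc m"])
     (use assms in \<open>auto intro!: cfun_0 cfun_nth cfun_add cfun_Suc\<close>)

lemma cfun_pair: assumes "cfun \<D> k F" "cfun \<D> k G" shows "cfun \<D> k (\<lambda>D xs. prod_encode (F D xs, G D xs))"
  unfolding prod_encode_def by (auto intro!: cfun_add cfun_triangle assms)

text \<open>The tested element is put in front of the parameters, in the place that bound variables
  occupy, so that set terms can be used under quantifiers and searches.\<close>

definition cset :: "nat set set \<Rightarrow> nat \<Rightarrow> (nat set \<Rightarrow> nat list \<Rightarrow> nat set) \<Rightarrow> bool" where
  "cset \<D> k S \<longleftrightarrow> cpred \<D> (Suc k) (\<lambda>D ys. ys ! 0 \<in> S D (tl ys))"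

lemma cpred_mem: assumes "cset \<D> k S" "cfun \<D> k F" shows "cpred \<D> k (\<lambda>D xs. F D xs \<in> S D xs)"
  using cfun_params[OF assms(1)[unfolded cset_def] assms(2)] .

lemma csetI: "cpred \<D> (Suc k) (\<lambda>D ys. P D (ys ! 0) (tl ys)) \<Longrightarrow> cset \<D> k (\<lambda>D xs. {y. P D y xs})"
  unfolding cset_def by simp

lemma cset_oracle: "cset \<D> k (\<lambda>D xs. D)"
  unfolding cset_def by (intro cfun_oracle cfun_nth) simp

lemma cfun_skip:
  assumes "cfun \<D> (Suc k) (\<lambda>D ys. F D (ys ! 0) (tl ys))"
  shows "cfun \<D> (Suc (Suc k)) (\<lambda>D ys. F D (ys ! 0) (tl (tl ys)))"
proof -
  let ?Fs = "(\<lambda>D ys. ys ! 0) # map (\<lambda>i D xs. xs ! Suc (Suc i)) [0..<k]"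
  have "cfun \<D> (Suc (Suc k)) (\<lambda>D xs. (\<lambda>D ys. F D (ys ! 0) (tl ys)) D (map (\<lambda>F. F D xs) ?Fs))"
    by (rule cfun_subst[OF assms]) (auto intro!: cfun_nth)
  then show ?thesis
  proof (rule cfun_cong)
    fix D :: "nat set" and xs :: "nat list" assume "length xs = Suc (Suc k)"
    then have "map (\<lambda>F. F D xs) (tl ?Fs) = tl (tl xs)" by (auto simp: length_Suc_conv o_def map_nth)
    then show "F D (map (\<lambda>F. F D xs) ?Fs ! 0) (tl (map (\<lambda>F. F D xs) ?Fs)) = F D (xs ! 0) (tl (tl xs))" by simp
  qed
qed

lemma cset_weak: "cset \<D> k S \<Longrightarrow> cset \<D> (Suc k) (\<lambda>D ys. S D (tl ys))"
  unfolding cset_def by (rule cfun_skip)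

lemma cfun_set_encode:
  assumes "cfun \<D> k B" "cpred \<D> (Suc k) (\<lambda>D ys. P D (ys ! 0) (tl ys))"
  shows "cfun \<D> k (\<lambda>D xs. set_encode {y. y < B D xs \<and> P D y xs})"
proof (rule cfun_rec'[where h="\<lambda>D n xs. set_encode {y. y < n \<and> P D y xs}" and F="\<lambda>_ _. 0"
        and G="\<lambda>D m r xs. r + of_bool (P D m xs) * 2 ^ m"])
  show "cfun \<D> (Suc (Suc k)) (\<lambda>D ys. ys ! 1 + of_bool (P D (ys ! 0) (tl (tl ys))) * 2 ^ (ys ! 0))"
    by (intro cfun_add cfun_mult cfun_pow2 cfun_nth cfun_skip[OF assms(2)]) auto
next
  fix D :: "nat set" and m and xs :: "nat list"
  have "{y. y < Suc m \<and> P D y xs} = (if P D m xs then insert m {y. y < m \<and> P D y xs} else {y. y < m \<and> P D y xs})"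
    by (auto simp: less_Suc_eq)
  then show "set_encode {y. y < Suc m \<and> P D y xs} = set_encode {y. y < m \<and> P D y xs} + of_bool (P D m xs) * 2 ^ m"
    by auto
qed (use assms(1) in \<open>auto intro!: cfun_0\<close>)

text \<open>The binary digit at position x is isolated by splitting c into a high part u, the digit
  and a low part w. Division is avoided and all quantifiers are bounded, so that
  \<open>cpred_ex\<close> applies.\<close>

lemma mem_set_decode: "x \<in> set_decode c \<longleftrightarrow> (\<exists>u<Suc c. \<exists>w<2 ^ x. c = u * 2 ^ Suc x + 2 ^ x + w)"
proof
  assume "x \<in> set_decode c"
  then have "odd (c div 2 ^ x)" by (simp add: set_decode_def)
  then obtain u where u: "c div 2 ^ x = 2 * u + 1" by (elim oddE)
  have "c = (2 * u + 1) * 2 ^ x + c mod 2 ^ x" using u by (metis div_mult_mod_eq)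
  then have c: "c = u * 2 ^ Suc x + 2 ^ x + c mod 2 ^ x" by (simp add: algebra_simps)
  moreover have "u \<le> u * 2 ^ Suc x" by simp
  then have "u < Suc c" using c by linarith
  ultimately show "\<exists>u<Suc c. \<exists>w<2 ^ x. c = u * 2 ^ Suc x + 2 ^ x + w"
    by (metis mod_less_divisor zero_less_numeral zero_less_power)
next
  assume "\<exists>u<Suc c. \<exists>w<2 ^ x. c = u * 2 ^ Suc x + 2 ^ x + w"
  then obtain u w where w: "w < 2 ^ x" "c = (2 * u + 1) * 2 ^ x + w" by (auto simp: algebra_simps)
  then have "c div 2 ^ x = 2 * u + 1" by (simp only: div_mult_self3) simp
  then show "x \<in> set_decode c" by (simp add: set_decode_def)
qed

lemma cpred_set_decode: assumes "cfun \<D> k F" "cfun \<D> k G" shows "cpred \<D> k (\<lambda>D xs. F D xs \<in> set_decode (G D xs))"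
  unfolding mem_set_decode
  by (intro cpred_ex cfun_Suc cfun_pow2 cpred_eq cfun_add cfun_mult cfun_weak cfun_nth assms) auto

lemmas cfun_rules = cpred_mem cpred_ex cpred_all cpred_all_le cpred_conj cpred_disj cpred_imp cpred_iff cpred_not
  cpred_eq cpred_less cpred_le cpred_set_decode cfun_pair cfun_add cfun_mult cfun_pow2 cfun_Suc cfun_const

section \<open>A universal family of enumeration operators\<close>

text \<open>Coincides with the step of \<open>list_encode\<close>, so that derivations, which handle
  numbers only, can take argument lists apart.\<close>

definition cons_code :: "nat \<Rightarrow> nat \<Rightarrow> nat" where "cons_code x a = Suc (prod_encode (x, a))"

definition tagged :: "nat \<Rightarrow> nat \<Rightarrow> nat" where "tagged t x = prod_encode (t, x)"

definition item :: "nat \<Rightarrow> nat \<Rightarrow> nat \<Rightarrow> nat" where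
  "item p a v = prod_encode (p, prod_encode (a, v))"

lemma cons_code_eq [simp]: "cons_code x a = cons_code y b \<longleftrightarrow> x = y \<and> a = b"
  and cons_code_0 [simp]: "cons_code x a \<noteq> 0" "0 \<noteq> cons_code x a"
  by (simp_all add: cons_code_def)

lemma tagged_eq [simp]: "tagged t x = tagged u y \<longleftrightarrow> t = u \<and> x = y"
  by (simp add: tagged_def)

lemma item_eq [simp]: "item p a v = item q b w \<longleftrightarrow> p = q \<and> a = b \<and> v = w"
  by (simp add: item_def)

text \<open>
  Tags \<open>7\<close> and \<open>8\<close> evaluate a list of programs to the list of their values. Tag \<open>9\<close> searches from
  the first argument upwards, which splits an unbounded search into single steps.
\<close>

fun enc_list :: "nat list \<Rightarrow> nat" where
  "enc_list [] = tagged 7 0"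
| "enc_list (x # xs) = tagged 8 (prod_encode (x, enc_list xs))"

primrec enc :: "functional \<Rightarrow> nat" where
  "enc Zero = tagged 0 0"
| "enc Succ = tagged 1 0"
| "enc (Proj i) = tagged 2 i"
| "enc Orc = tagged 3 0"
| "enc (Comp f gs) = tagged 4 (prod_encode (enc f, enc_list (map enc gs)))"
| "enc (PrimRec f g) = tagged 5 (prod_encode (enc f, enc g))"
| "enc (Mu f) = tagged 6 (enc f)"

text \<open>One step of a derivation; \<open>s\<close> bounds everything that occurs in it, including oracle queries.\<close>

definition justified :: "nat set \<Rightarrow> nat \<Rightarrow> nat set \<Rightarrow> nat \<Rightarrow> bool" where
  "justified D s M t \<longleftrightarrow>
     (\<exists>a<s. t = item (tagged 0 0) a 0) \<or>
     (\<exists>x<s. t = item (tagged 1 0) (cons_code x 0) (Suc x)) \<or>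
     (\<exists>x<s. \<exists>a<s. t = item (tagged 2 0) (cons_code x a) x) \<or>
     (\<exists>i<s. \<exists>x<s. \<exists>a<s. \<exists>v<s. t = item (tagged 2 (Suc i)) (cons_code x a) v \<and> item (tagged 2 i) a v \<in> M) \<or>
     (\<exists>x<s. t = item (tagged 3 0) (cons_code x 0) (of_bool (x \<in> D))) \<or>
     (\<exists>f<s. \<exists>g<s. \<exists>a<s. \<exists>w<s. \<exists>v<s. t = item (tagged 4 (prod_encode (f, g))) a v \<and> item g a w \<in> M \<and> item f w v \<in> M) \<or>
     (\<exists>f<s. \<exists>g<s. \<exists>a<s. \<exists>v<s. t = item (tagged 5 (prod_encode (f, g))) (cons_code 0 a) v \<and> item f a v \<in> M) \<or>
     (\<exists>f<s. \<exists>g<s. \<exists>m<s. \<exists>a<s. \<exists>u<s. \<exists>v<s. t = item (tagged 5 (prod_encode (f, g))) (cons_code (Suc m) a) v \<and>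
        item (tagged 5 (prod_encode (f, g))) (cons_code m a) u \<in> M \<and> item g (cons_code m (cons_code u a)) v \<in> M) \<or>
     (\<exists>f<s. \<exists>a<s. \<exists>v<s. t = item (tagged 6 f) a v \<and> item (tagged 9 f) (cons_code 0 a) v \<in> M) \<or>
     (\<exists>a<s. t = item (tagged 7 0) a 0) \<or>
     (\<exists>f<s. \<exists>g<s. \<exists>a<s. \<exists>v<s. \<exists>w<s. t = item (tagged 8 (prod_encode (f, g))) a (cons_code v w) \<and> item f a v \<in> M \<and> item g a w \<in> M) \<or>
     (\<exists>f<s. \<exists>n<s. \<exists>a<s. t = item (tagged 9 f) (cons_code n a) n \<and> item f (cons_code n a) 0 \<in> M) \<or>
     (\<exists>f<s. \<exists>n<s. \<exists>a<s. \<exists>u<s. \<exists>v<s. t = item (tagged 9 f) (cons_code n a) v \<and> item f (cons_code n a) (Suc u) \<in> M \<and>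
        item (tagged 9 f) (cons_code (Suc n) a) v \<in> M)"

text \<open>Each round is a finite set bounded by \<open>s\<close> and can be stored as a number;
  this makes the iteration primitive recursive in the oracle.\<close>

primrec derived :: "nat set \<Rightarrow> nat \<Rightarrow> nat \<Rightarrow> nat set" where
  "derived D s 0 = {}"
| "derived D s (Suc k) = {t. t < s \<and> justified D s (derived D s k) t}"

text \<open>One bound \<open>s\<close> governs elements, outputs, number of rounds and oracle
  queries. Stages are therefore decidable, increase with \<open>s\<close>, and depend on the oracle
  below \<open>s\<close> only.\<close>

definition enum_stage :: "nat \<Rightarrow> nat \<Rightarrow> nat set \<Rightarrow> nat set" where
  "enum_stage e s D = {n. n < s \<and> (\<exists>v<s. item e (cons_code n 0) v \<in> derived D s s)}"

section \<open>Monotonicity in the stage and use of the oracle\<close>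

lemma justified_mono:
  assumes "justified D s M t" "s \<le> s'" "M \<subseteq> M'"
  shows "justified D s' M' t"
proof -
  have l: "x < s \<Longrightarrow> x < s'" for x using assms(2) by simp
  have m: "x \<in> M \<Longrightarrow> x \<in> M'" for x using assms(3) by blast
  show ?thesis using assms(1) unfolding justified_def
    by (elim disj_forward) (elim ex_forward conj_forward, (assumption | erule l | erule m)+)+
qed

text \<open>Only the clause for \<open>Orc\<close> mentions the oracle, and it queries numbers below
  \<open>s\<close>.\<close>

lemma justified_agree: assumes "D \<inter> {..<s} = D' \<inter> {..<s}" shows "justified D s M t = justified D' s M t"
proof -
  have "x \<in> D \<longleftrightarrow> x \<in> D'" if "x < s" for x using assms that by blast
  then have "(\<exists>x<s. t = item (tagged 3 0) (cons_code x 0) (of_bool (x \<in> D))) \<longleftrightarrow>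
    (\<exists>x<s. t = item (tagged 3 0) (cons_code x 0) (of_bool (x \<in> D')))"
    by (intro iff_exI conj_cong refl) simp
  then show ?thesis unfolding justified_def by (simp only:)
qed

lemma derived_agree: assumes "D \<inter> {..<s} = D' \<inter> {..<s}" shows "derived D s k = derived D' s k"
  by (induction k) (simp_all add: justified_agree[OF assms])

lemma derived_step: "derived D s k \<subseteq> derived D s (Suc k)"
proof (induction k)
  case (Suc k)
  show ?case
  proof
    fix t assume t: "t \<in> derived D s (Suc k)"
    then have "justified D s (derived D s k) t" by simp
    then have "justified D s (derived D s (Suc k)) t" by (rule justified_mono[OF _ order_refl Suc])
    moreover have "t < s" using t by simp
    ultimately show "t \<in> derived D s (Suc (Suc k))" by (simp only: derived.simps(2)[of D s "Suc k"] mem_Collect_eq simp_thms)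
  qed
qed simp

lemma derived_mono: assumes "s \<le> s'" "k \<le> k'" shows "derived D s k \<subseteq> derived D s' k'"
proof -
  have "derived D s k \<subseteq> derived D s' k"
  proof (induction k)
    case (Suc k)
    show ?case
    proof
      fix t assume t: "t \<in> derived D s (Suc k)"
      then have "justified D s (derived D s k) t" by simp
      then have "justified D s' (derived D s' k) t" by (rule justified_mono[OF _ assms(1) Suc])
      moreover have "t < s'" using t assms(1) by simp
      ultimately show "t \<in> derived D s' (Suc k)" by simp
    qed
  qed simp
  also have "\<dots> \<subseteq> derived D s' k'" by (rule lift_Suc_mono_le[of "derived D s'", OF derived_step assms(2)])
  finally show ?thesis .
qed

lemma enum_stage_mono: assumes "s \<le> s'" shows "enum_stage e s D \<subseteq> enum_stage e s' D"
proof
  fix n assume "n \<in> enum_stage e s D"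
  then obtain v where "n < s" "v < s" "item e (cons_code n 0) v \<in> derived D s s" unfolding enum_stage_def by blast
  moreover have "derived D s s \<subseteq> derived D s' s'" using assms by (intro derived_mono)
  ultimately have "n < s' \<and> v < s' \<and> item e (cons_code n 0) v \<in> derived D s' s'" using assms by (auto simp del: derived.simps)
  then show "n \<in> enum_stage e s' D" unfolding enum_stage_def by blast
qed

lemma enum_stage_agree: "D \<inter> {..<s} = D' \<inter> {..<s} \<Longrightarrow> enum_stage e s D = enum_stage e s D'"
  unfolding enum_stage_def using derived_agree[of D s D' s] by simp

lemma enum_stage_less: "n \<in> enum_stage e s D \<Longrightarrow> n < s" by (simp add: enum_stage_def)

section \<open>Completeness: terminating computations are derived\<close>

definition derivable :: "nat set \<Rightarrow> nat \<Rightarrow> bool" where "derivable D t \<longleftrightarrow> (\<exists>s. t \<in> derived D s s)"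

text \<open>Compactness: the finitely many premises are all present at the sum of their stages, and
  one further round applies the rule.\<close>

lemma derivable_step:
  assumes "justified D s M t" "finite M" "\<And>x. x \<in> M \<Longrightarrow> derivable D x"
  shows "derivable D t"
proof -
  from assms(3) obtain g where g: "\<And>x. x \<in> M \<Longrightarrow> x \<in> derived D (g x) (g x)" unfolding derivable_def by metis
  define S where "S = s + Suc t + sum g M"
  have "M \<subseteq> derived D S S"
  proof
    fix x assume x: "x \<in> M"
    have "g x \<le> S" using member_le_sum[OF x _ assms(2), of g] by (simp add: S_def)
    then show "x \<in> derived D S S" using g[OF x] derived_mono by blast
  qed
  moreover have "derived D S S \<subseteq> derived D (Suc S) S" by (rule derived_mono) auto
  ultimately have "justified D (Suc S) (derived D (Suc S) S) t"
    using justified_mono[OF assms(1), of "Suc S" "derived D (Suc S) S"] by (simp add: S_def)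
  then have "t \<in> derived D (Suc S) (Suc S)" by (simp add: S_def)
  then show ?thesis unfolding derivable_def by blast
qed

lemma derivable_intros:
  "derivable D (item (tagged 0 0) a 0)"
  "derivable D (item (tagged 1 0) (cons_code x 0) (Suc x))"
  "derivable D (item (tagged 2 0) (cons_code x a) x)"
  "derivable D (item (tagged 2 i) a v) \<Longrightarrow> derivable D (item (tagged 2 (Suc i)) (cons_code x a) v)"
  "derivable D (item (tagged 3 0) (cons_code x 0) (of_bool (x \<in> D)))"
  "derivable D (item g a w) \<Longrightarrow> derivable D (item f w v) \<Longrightarrow> derivable D (item (tagged 4 (prod_encode (f, g))) a v)"
  "derivable D (item f a v) \<Longrightarrow> derivable D (item (tagged 5 (prod_encode (f, g))) (cons_code 0 a) v)"
  "derivable D (item (tagged 5 (prod_encode (f, g))) (cons_code m a) u) \<Longrightarrow> derivable D (item g (cons_code m (cons_code u a)) v) \<Longrightarrow>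
     derivable D (item (tagged 5 (prod_encode (f, g))) (cons_code (Suc m) a) v)"
  "derivable D (item (tagged 9 f) (cons_code 0 a) v) \<Longrightarrow> derivable D (item (tagged 6 f) a v)"
  "derivable D (item (tagged 7 0) a 0)"
  "derivable D (item f a v) \<Longrightarrow> derivable D (item g a w) \<Longrightarrow> derivable D (item (tagged 8 (prod_encode (f, g))) a (cons_code v w))"
  "derivable D (item f (cons_code n a) 0) \<Longrightarrow> derivable D (item (tagged 9 f) (cons_code n a) n)"
  "derivable D (item f (cons_code n a) (Suc u)) \<Longrightarrow> derivable D (item (tagged 9 f) (cons_code (Suc n) a) v) \<Longrightarrow> derivable D (item (tagged 9 f) (cons_code n a) v)"
proof -
  show "derivable D (item (tagged 0 0) a 0)"
    by (rule derivable_step[where M="{}" and s="Suc a"]) (auto simp: justified_def)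
  show "derivable D (item (tagged 1 0) (cons_code x 0) (Suc x))"
    by (rule derivable_step[where M="{}" and s="Suc x"]) (auto simp: justified_def)
  show "derivable D (item (tagged 2 0) (cons_code x a) x)"
    by (rule derivable_step[where M="{}" and s="Suc (x + a)"]) (auto simp: justified_def)
  show "derivable D (item (tagged 2 i) a v) \<Longrightarrow> derivable D (item (tagged 2 (Suc i)) (cons_code x a) v)"
    by (rule derivable_step[where M="{item (tagged 2 i) a v}" and s="Suc (i + x + a + v)"]) (auto simp: justified_def)
  show "derivable D (item (tagged 3 0) (cons_code x 0) (of_bool (x \<in> D)))"
    by (rule derivable_step[where M="{}" and s="Suc x"]) (auto simp: justified_def)
  show "derivable D (item g a w) \<Longrightarrow> derivable D (item f w v) \<Longrightarrow> derivable D (item (tagged 4 (prod_encode (f, g))) a v)"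
    by (rule derivable_step[where M="{item g a w, item f w v}" and s="Suc (f + g + a + w + v)"])
       (simp add: justified_def, rule exI[of _ f], rule conjI, simp, rule exI[of _ g], rule conjI, simp,
        rule exI[of _ a], rule conjI, simp, rule exI[of _ w], auto)
  show "derivable D (item f a v) \<Longrightarrow> derivable D (item (tagged 5 (prod_encode (f, g))) (cons_code 0 a) v)"
    by (rule derivable_step[where M="{item f a v}" and s="Suc (f + g + a + v)"]) (auto simp: justified_def)
  show "derivable D (item (tagged 5 (prod_encode (f, g))) (cons_code m a) u) \<Longrightarrow> derivable D (item g (cons_code m (cons_code u a)) v) \<Longrightarrow>
     derivable D (item (tagged 5 (prod_encode (f, g))) (cons_code (Suc m) a) v)"
    by (rule derivable_step[where M="{item (tagged 5 (prod_encode (f, g))) (cons_code m a) u, item g (cons_code m (cons_code u a)) v}"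
          and s="Suc (f + g + m + a + u + v)"])
       (simp add: justified_def, rule exI[of _ f], rule conjI, simp, rule exI[of _ g], rule conjI, simp,
        rule exI[of _ m], rule conjI, simp, rule exI[of _ a], rule conjI, simp, rule exI[of _ u], auto)
  show "derivable D (item (tagged 9 f) (cons_code 0 a) v) \<Longrightarrow> derivable D (item (tagged 6 f) a v)"
    by (rule derivable_step[where M="{item (tagged 9 f) (cons_code 0 a) v}" and s="Suc (f + a + v)"]) (auto simp: justified_def)
  show "derivable D (item (tagged 7 0) a 0)"
    by (rule derivable_step[where M="{}" and s="Suc a"]) (auto simp: justified_def)
  show "derivable D (item f a v) \<Longrightarrow> derivable D (item g a w) \<Longrightarrow> derivable D (item (tagged 8 (prod_encode (f, g))) a (cons_code v w))"
    by (rule derivable_step[where M="{item f a v, item g a w}" and s="Suc (f + g + a + w + v)"]) (auto simp: justified_def)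
  show "derivable D (item f (cons_code n a) 0) \<Longrightarrow> derivable D (item (tagged 9 f) (cons_code n a) n)"
    by (rule derivable_step[where M="{item f (cons_code n a) 0}" and s="Suc (f + n + a)"]) (auto simp: justified_def)
  show "derivable D (item f (cons_code n a) (Suc u)) \<Longrightarrow> derivable D (item (tagged 9 f) (cons_code (Suc n) a) v) \<Longrightarrow> derivable D (item (tagged 9 f) (cons_code n a) v)"
    by (rule derivable_step[where M="{item f (cons_code n a) (Suc u), item (tagged 9 f) (cons_code (Suc n) a) v}" and s="Suc (f + n + a + u + v)"])
       (simp add: justified_def, rule exI[of _ f], rule conjI, simp, rule exI[of _ n], rule conjI, simp,
        rule exI[of _ a], rule conjI, simp, rule exI[of _ u], auto)
qed

lemma list_encode_cons_code: "list_encode (x # xs) = cons_code x (list_encode xs)"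
  by (simp add: cons_code_def)

text \<open>The search is unwound from its end: the base case is the successful candidate, and the
  induction puts failed candidates in front of it.\<close>

lemma derivable_search:
  assumes "\<And>m. m < j \<Longrightarrow> \<exists>u. derivable D (item f (cons_code (n + m) a) (Suc u))" "derivable D (item f (cons_code (n + j) a) 0)"
  shows "derivable D (item (tagged 9 f) (cons_code n a) (n + j))"
  using assms
proof (induction j arbitrary: n)
  case 0
  then show ?case by (auto intro: derivable_intros)
next
  case (Suc j)
  obtain u where u: "derivable D (item f (cons_code n a) (Suc u))" using Suc.prems(1)[of 0] by auto
  have "derivable D (item (tagged 9 f) (cons_code (Suc n) a) (Suc n + j))"
  proof (rule Suc.IH)
    show "\<exists>u. derivable D (item f (cons_code (Suc n + m) a) (Suc u))" if "m < j" for m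
      using Suc.prems(1)[of "Suc m"] that by simp
    show "derivable D (item f (cons_code (Suc n + j) a) 0)" using Suc.prems(2) by simp
  qed
  then show ?case using derivable_intros(13)[OF u] by simp
qed

lemma derivable_run: "run D \<Phi> xs = Some v \<Longrightarrow> derivable D (item (enc \<Phi>) (list_encode xs) v)"
proof (induction \<Phi> arbitrary: xs v)
  case Zero
  then show ?case by (auto intro: derivable_intros)
next
  case Succ
  then show ?case
    using derivable_intros(2) by (auto simp: cons_code_def[of _ 0] simp flip: One_nat_def split: list.splits)
next
  case (Proj i)
  then have "i < length xs" "v = xs ! i" by (auto split: if_splits)
  then show ?case
  proof (induction i arbitrary: xs)
    case 0
    then show ?case by (cases xs) (auto simp: list_encode_cons_code simp del: list_encode.simps intro: derivable_intros)
  next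
    case (Suc i)
    then show ?case by (cases xs) (auto simp: list_encode_cons_code simp del: list_encode.simps intro: derivable_intros)
  qed
next
  case Orc
  then show ?case using derivable_intros(5)[of D "hd xs"] by (auto simp: cons_code_def split: list.splits)
next
  case (Comp f gs)
  then have d: "\<And>g. g \<in> set gs \<Longrightarrow> run D g xs \<noteq> None" and r: "run D f (map (\<lambda>g. the (run D g xs)) gs) = Some v"
    by (auto split: if_splits)
  have "derivable D (item (enc_list (map enc gs)) (list_encode xs) (list_encode (map (\<lambda>g. the (run D g xs)) gs)))"
    using d Comp.IH(2)
  proof (induction gs)
    case Nil
    then show ?case by (auto intro: derivable_intros)
  next
    case (Cons g gs)
    have "derivable D (item (enc g) (list_encode xs) (the (run D g xs)))"
      using Cons.prems by (metis list.set_intros(1) option.exhaust_sel)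
    moreover have "derivable D (item (enc_list (map enc gs)) (list_encode xs) (list_encode (map (\<lambda>g. the (run D g xs)) gs)))"
      by (rule Cons.IH) (use Cons.prems in auto)
    ultimately show ?case by (simp only: list.map enc_list.simps list_encode_cons_code derivable_intros)
  qed
  then show ?case using Comp.IH(1)[OF r] by (simp add: derivable_intros)
next
  case (PrimRec f g)
  then obtain n ys where xs: "xs = n # ys" by (auto split: list.splits)
  then have "rec_nat (run D f ys) (\<lambda>m r. case r of None \<Rightarrow> None | Some v \<Rightarrow> run D g (m # v # ys)) n = Some v"
    using PrimRec.prems by simp
  then have "derivable D (item (tagged 5 (prod_encode (enc f, enc g))) (cons_code n (list_encode ys)) v)"
  proof (induction n arbitrary: v)
    case 0
    then show ?case using PrimRec.IH(1) by (auto intro: derivable_intros)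
  next
    case (Suc n)
    then obtain u where u: "rec_nat (run D f ys) (\<lambda>m r. case r of None \<Rightarrow> None | Some v \<Rightarrow> run D g (m # v # ys)) n = Some u"
      "run D g (n # u # ys) = Some v" by (auto split: option.splits)
    show ?case by (rule derivable_intros(8)[OF Suc.IH[OF u(1)]])
      (use PrimRec.IH(2)[OF u(2)] in \<open>simp add: list_encode_cons_code del: list_encode.simps\<close>)
  qed
  then show ?case using xs by (simp add: cons_code_def)
next
  case (Mu f)
  from Mu.prems obtain n where n: "run D f (n # xs) = Some 0" "\<forall>m<n. run D f (m # xs) \<noteq> None"
    "v = (LEAST n. run D f (n # xs) = Some 0)" by (auto split: if_splits)
  have v: "run D f (v # xs) = Some 0" unfolding n(3) using n(1) by (rule LeastI)
  have vn: "v \<le> n" unfolding n(3) using n(1) by (rule Least_le)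
  have "derivable D (item (tagged 9 (enc f)) (cons_code 0 (list_encode xs)) (0 + v))"
  proof (rule derivable_search)
    fix m assume m: "m < v"
    then have "run D f (m # xs) \<noteq> Some 0" unfolding n(3) by (rule not_less_Least)
    moreover have "run D f (m # xs) \<noteq> None" using n(2) m vn by simp
    ultimately obtain u where "run D f (m # xs) = Some (Suc u)" by (metis not0_implies_Suc option.exhaust)
    from Mu.IH[OF this] show "\<exists>u. derivable D (item (enc f) (cons_code (0 + m) (list_encode xs)) (Suc u))"
      by (auto simp: list_encode_cons_code simp del: list_encode.simps)
  next
    show "derivable D (item (enc f) (cons_code (0 + v) (list_encode xs)) 0)"
      using Mu.IH[OF v] by (simp add: list_encode_cons_code del: list_encode.simps)
  qed
  then show ?case by (simp add: derivable_intros)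
qed

section \<open>Soundness of derivations\<close>

definition sound_item :: "nat set \<Rightarrow> nat \<Rightarrow> nat \<Rightarrow> nat \<Rightarrow> bool" where
  "sound_item D p a v \<longleftrightarrow>
     (\<forall>\<Phi>. p = enc \<Phi> \<longrightarrow> run D \<Phi> (list_decode a) = Some v) \<and>
     (\<forall>gs. p = enc_list (map enc gs) \<longrightarrow> (\<forall>g\<in>set gs. run D g (list_decode a) \<noteq> None) \<and>
        list_decode v = map (\<lambda>g. the (run D g (list_decode a))) gs) \<and>
     (\<forall>\<Phi> n b. p = tagged 9 (enc \<Phi>) \<longrightarrow> a = cons_code n b \<longrightarrow> n \<le> v \<and> run D \<Phi> (v # list_decode b) = Some 0 \<and>
        (\<forall>m. n \<le> m \<longrightarrow> m < v \<longrightarrow> (\<exists>u. run D \<Phi> (m # list_decode b) = Some (Suc u))))"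

lemma list_decode_cons_code [simp]: "list_decode (cons_code x a) = x # list_decode a"
proof -
  have "cons_code x a = list_encode (x # list_decode a)" by (simp add: cons_code_def)
  then show ?thesis by (metis list_encode_inverse)
qed

text \<open>Programs, lists of programs and search states have separate invariants. Each quantifies
  over all programs with the given code, so injectivity of \<open>enc\<close> is never an issue, and
  numbers that code no program are left free. The value of a search state is the first zero at or
  above its starting point, with convergence before it.\<close>

lemma justified_sound_item:
  assumes j: "justified D s M (item p a v)" and M: "\<And>p a v. item p a v \<in> M \<Longrightarrow> sound_item D p a v"
  shows "sound_item D p a v"
proof -
  have m1: "\<And>\<Phi> a v. item (enc \<Phi>) a v \<in> M \<Longrightarrow> run D \<Phi> (list_decode a) = Some v"
    using M unfolding sound_item_def by blast
  have m2: "\<And>gs a v. item (enc_list (map enc gs)) a v \<in> M \<Longrightarrow> (\<forall>g\<in>set gs. run D g (list_decode a) \<noteq> None) \<and>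
        list_decode v = map (\<lambda>g. the (run D g (list_decode a))) gs"
    using M unfolding sound_item_def by blast
  have m3: "\<And>\<Phi> n b v. item (tagged 9 (enc \<Phi>)) (cons_code n b) v \<in> M \<Longrightarrow> n \<le> v \<and> run D \<Phi> (v # list_decode b) = Some 0 \<and>
        (\<forall>m. n \<le> m \<longrightarrow> m < v \<longrightarrow> (\<exists>u. run D \<Phi> (m # list_decode b) = Some (Suc u)))"
    using M unfolding sound_item_def by blast
  have "\<forall>\<Phi>. p = enc \<Phi> \<longrightarrow> run D \<Phi> (list_decode a) = Some v"
  proof (intro allI impI)
    fix \<Phi> assume "p = enc \<Phi>"
    with j have j: "justified D s M (item (enc \<Phi>) a v)" by simp
    show "run D \<Phi> (list_decode a) = Some v"
    proof (cases \<Phi>)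
      case (Mu f)
      then have "item (tagged 9 (enc f)) (cons_code 0 a) v \<in> M" using j by (auto simp: justified_def)
      from m3[OF this] have z: "run D f (v # list_decode a) = Some 0"
        "\<And>m. m < v \<Longrightarrow> \<exists>u. run D f (m # list_decode a) = Some (Suc u)" by auto
      have "(LEAST n. run D f (n # list_decode a) = Some 0) = v"
      proof (rule Least_equality)
        show "run D f (v # list_decode a) = Some 0" by (rule z(1))
        fix y assume "run D f (y # list_decode a) = Some 0"
        then show "v \<le> y" using z(2)[of y] by (cases "y < v") auto
      qed
      moreover have "\<exists>n. run D f (n # list_decode a) = Some 0 \<and> (\<forall>m<n. run D f (m # list_decode a) \<noteq> None)"
        using z by (intro exI[of _ v]) auto
      ultimately show ?thesis using Mu by simp
    next
      case (PrimRec f g)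
      then consider (z) b where "a = cons_code 0 b" "item (enc f) b v \<in> M"
        | (s) m b u where "a = cons_code (Suc m) b" "item (enc (PrimRec f g)) (cons_code m b) u \<in> M" "item (enc g) (cons_code m (cons_code u b)) v \<in> M"
        using j by (auto simp: justified_def)
      then show ?thesis
      proof cases
        case z
        then show ?thesis using PrimRec m1 by simp
      next
        case s
        then show ?thesis using PrimRec m1[OF s(2)] m1[OF s(3)] by simp
      qed
    next
      case (Comp f gs)
      then obtain w where "item (enc_list (map enc gs)) a w \<in> M" "item (enc f) w v \<in> M"
        using j by (auto simp: justified_def)
      with m1 m2 have "run D f (list_decode w) = Some v" "\<forall>g\<in>set gs. run D g (list_decode a) \<noteq> None"
        "list_decode w = map (\<lambda>g. the (run D g (list_decode a))) gs" by blast+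
      then show ?thesis using Comp by simp
    next
      case (Proj i)
      then consider (z) x b where "a = cons_code x b" "i = 0" "v = x" | (s) i' x b where "i = Suc i'" "a = cons_code x b" "item (enc (Proj i')) b v \<in> M"
        using j by (auto simp: justified_def)
      then show ?thesis
      proof cases
        case z
        then show ?thesis using Proj by simp
      next
        case s
        then show ?thesis using Proj m1[OF s(3)] by (simp split: if_splits)
      qed
    qed (use j in \<open>auto simp: justified_def\<close>)
  qed
  moreover have "\<forall>gs. p = enc_list (map enc gs) \<longrightarrow> (\<forall>g\<in>set gs. run D g (list_decode a) \<noteq> None) \<and>
        list_decode v = map (\<lambda>g. the (run D g (list_decode a))) gs"
  proof (intro allI impI)
    fix gs assume "p = enc_list (map enc gs)"
    with j have j: "justified D s M (item (enc_list (map enc gs)) a v)" by simp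
    show "(\<forall>g\<in>set gs. run D g (list_decode a) \<noteq> None) \<and> list_decode v = map (\<lambda>g. the (run D g (list_decode a))) gs"
    proof (cases gs)
      case Nil
      then show ?thesis using j by (auto simp: justified_def)
    next
      case (Cons g gs')
      then obtain x w where "v = cons_code x w" "item (enc g) a x \<in> M" "item (enc_list (map enc gs')) a w \<in> M"
        using j by (auto simp: justified_def)
      then show ?thesis using Cons m1 m2 by auto
    qed
  qed
  moreover have "\<forall>\<Phi> n b. p = tagged 9 (enc \<Phi>) \<longrightarrow> a = cons_code n b \<longrightarrow> n \<le> v \<and> run D \<Phi> (v # list_decode b) = Some 0 \<and>
        (\<forall>m. n \<le> m \<longrightarrow> m < v \<longrightarrow> (\<exists>u. run D \<Phi> (m # list_decode b) = Some (Suc u)))"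
  proof (intro allI impI)
    fix \<Phi> n b assume "p = tagged 9 (enc \<Phi>)" "a = cons_code n b"
    with j have "justified D s M (item (tagged 9 (enc \<Phi>)) (cons_code n b) v)" by simp
    then consider (z) "v = n" "item (enc \<Phi>) (cons_code n b) 0 \<in> M"
      | (s) u where "item (enc \<Phi>) (cons_code n b) (Suc u) \<in> M" "item (tagged 9 (enc \<Phi>)) (cons_code (Suc n) b) v \<in> M"
      by (auto simp: justified_def)
    then show "n \<le> v \<and> run D \<Phi> (v # list_decode b) = Some 0 \<and>
        (\<forall>m. n \<le> m \<longrightarrow> m < v \<longrightarrow> (\<exists>u. run D \<Phi> (m # list_decode b) = Some (Suc u)))"
    proof cases
      case z
      then show ?thesis using m1[OF z(2)] by auto
    next
      case s
      then have "run D \<Phi> (n # list_decode b) = Some (Suc u)" using m1[OF s(1)] by simp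
      with m3[OF s(2)] show ?thesis by (metis Suc_leD Suc_leI le_neq_implies_less)
    qed
  qed
  ultimately show ?thesis unfolding sound_item_def by (intro conjI)
qed

lemma derived_sound_item: "item p a v \<in> derived D s k \<Longrightarrow> sound_item D p a v"
proof (induction k arbitrary: p a v)
  case (Suc k)
  then have "justified D s (derived D s k) (item p a v)" by simp
  then show ?case by (rule justified_sound_item) (rule Suc.IH)
qed simp

lemma enum_stage_run: "(\<exists>s. n \<in> enum_stage (enc \<Phi>) s D) \<longleftrightarrow> run D \<Phi> [n] \<noteq> None"
proof
  assume "\<exists>s. n \<in> enum_stage (enc \<Phi>) s D"
  then obtain s v where "item (enc \<Phi>) (cons_code n 0) v \<in> derived D s s" unfolding enum_stage_def by blast
  then have "sound_item D (enc \<Phi>) (cons_code n 0) v" by (rule derived_sound_item)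
  then show "run D \<Phi> [n] \<noteq> None" unfolding sound_item_def by auto
next
  assume "run D \<Phi> [n] \<noteq> None"
  then obtain v where "run D \<Phi> [n] = Some v" by blast
  from derivable_run[OF this] obtain s where s: "item (enc \<Phi>) (cons_code n 0) v \<in> derived D s s"
    by (auto simp: derivable_def list_encode_cons_code simp del: list_encode.simps(2))
  define S where "S = s + Suc n + Suc v"
  have "derived D s s \<subseteq> derived D S S" by (intro derived_mono) (simp_all add: S_def)
  then have "item (enc \<Phi>) (cons_code n 0) v \<in> derived D S S" "n < S" "v < S" using s by (auto simp: S_def simp del: derived.simps)
  then have "n \<in> enum_stage (enc \<Phi>) S D" unfolding enum_stage_def by blast
  then show "\<exists>s. n \<in> enum_stage (enc \<Phi>) s D" ..
qed

lemma ce_in_enum_stage: "ce_in D A \<longleftrightarrow> (\<exists>e\<in>range enc. A = (\<Union>s. enum_stage e s D))"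
  unfolding ce_in_def using enum_stage_run by (auto simp: set_eq_iff)

lemma enum_stage_imp: "ce_in D A \<Longrightarrow> \<exists>e. A = (\<Union>s. enum_stage e s D)"
  unfolding ce_in_enum_stage by blast

section \<open>Computability of the universal family\<close>

lemma cset_set_decode: "cfun \<D> k G \<Longrightarrow> cset \<D> k (\<lambda>D xs. set_decode (G D xs))"
  unfolding cset_def by (intro cpred_set_decode cfun_weak cfun_nth) auto

lemma cpred_justified:
  assumes "cset \<D> k S" "cset \<D> k M" "cfun \<D> k F" "cfun \<D> k T"
  shows "cpred \<D> k (\<lambda>D xs. justified (S D xs) (F D xs) (M D xs) (T D xs))"
  unfolding justified_def item_def tagged_def cons_code_def
  by (intro cfun_rules cset_weak cfun_weak cfun_nth assms; simp)

lemma finite_derived: "finite (derived D s k)"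
  by (rule finite_subset[of _ "{..<s}"]) (cases k; auto)+

text \<open>Recursion on the number of rounds, carried out on codes: the previous round enters
  \<open>justified\<close> as \<open>set_decode r\<close>.\<close>

lemma cset_derived:
  assumes "cset \<D> k S" "cfun \<D> k F" "cfun \<D> k N"
  shows "cset \<D> k (\<lambda>D xs. derived (S D xs) (F D xs) (N D xs))"
proof -
  have "cfun \<D> k (\<lambda>D xs. set_encode (derived (S D xs) (F D xs) (N D xs)))"
  proof (rule cfun_rec'[where h="\<lambda>D n xs. set_encode (derived (S D xs) (F D xs) n)" and F="\<lambda>_ _. 0"
        and G="\<lambda>D m r xs. set_encode {t. t < F D xs \<and> justified (S D xs) (F D xs) (set_decode r) t}"])
    show "cfun \<D> (Suc (Suc k)) (\<lambda>D ys. set_encode {t. t < F D (tl (tl ys)) \<and>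
        justified (S D (tl (tl ys))) (F D (tl (tl ys))) (set_decode (ys ! 1)) t})"
      by (intro cfun_set_encode cpred_justified cset_set_decode cset_weak cfun_weak assms cfun_nth; simp)
  qed (use assms(3) in \<open>simp_all add: finite_derived cfun_0\<close>)
  from cset_set_decode[OF this] show ?thesis by (simp add: finite_derived)
qed

lemma cset_enum_stage:
  assumes "cset \<D> k S" "cfun \<D> k E" "cfun \<D> k F"
  shows "cset \<D> k (\<lambda>D xs. enum_stage (E D xs) (F D xs) (S D xs))"
  unfolding enum_stage_def item_def cons_code_def
  by (intro csetI cfun_rules cset_derived cset_weak cfun_weak cfun_nth assms; simp)

section \<open>Arithmetical definability of computations\<close>

text \<open>
  The function variable \<open>f\<close> carries a set at its even arguments and a coding of finite sequences
  at its odd arguments; the latter turns primitive recursion into a first-order condition.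
\<close>

definition pair_poly :: "nat \<Rightarrow> nat \<Rightarrow> nat" where "pair_poly x y = (x + y) * (x + y) + x"

definition entry :: "(nat \<Rightarrow> nat) \<Rightarrow> nat \<Rightarrow> nat \<Rightarrow> nat" where "entry f c m = f (Suc (2 * pair_poly c m))"

text \<open>Prescribing one entry while keeping the earlier ones suffices, by induction, for coding
  every finite sequence; unlike a quantifier over sequences this is first-order.\<close>

definition coder :: "(nat \<Rightarrow> nat) \<Rightarrow> bool" where
  "coder f \<longleftrightarrow> (\<forall>c i v. \<exists>c'. entry f c' i = v \<and> (\<forall>j<i. entry f c' j = entry f c j))"

definition fset :: "(nat \<Rightarrow> nat) \<Rightarrow> nat set" where "fset f = {x. f (2 * x) = 1}"

definition join :: "nat set \<Rightarrow> nat set \<Rightarrow> nat set" where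
  "join A C = {x. (\<exists>w\<in>A. x = 2 * w) \<or> (\<exists>w\<in>C. x = Suc (2 * w))}"

text \<open>A polynomial replaces \<open>prod_encode\<close> because it is a term of the language.
  The sum x + y can be read off, as the value lies between its square and the next square.\<close>

lemma pair_poly_inj: assumes "pair_poly x y = pair_poly u v" shows "x = u \<and> y = v"
proof -
  have *: False if "pair_poly x y = pair_poly u v" "x + y < u + v" for x y u v
  proof -
    have "pair_poly x y < Suc (x + y) * Suc (x + y)" by (simp add: pair_poly_def)
    also have "\<dots> \<le> (u + v) * (u + v)" using that(2) by (intro mult_le_mono) auto
    also have "\<dots> \<le> pair_poly u v" by (simp add: pair_poly_def)
    finally show False using that(1) by simp
  qed
  have "x + y = u + v" using *[OF assms] *[OF assms[symmetric]] by (meson linorder_neqE_nat)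
  then show ?thesis using assms by (simp add: pair_poly_def)
qed

text \<open>Even arguments carry C, odd ones the entries of decoded lists; injectivity of
  \<open>pair_poly\<close> makes the definite description meaningful. Hence quantifying over coders
  f amounts to quantifying over all sets C.\<close>

lemma coder_exists: "\<exists>f. coder f \<and> fset f = C"
proof -
  define dec where "dec c m = (let l = list_decode c in if m < length l then l ! m else 0)" for c m
  define f where "f y = (if even y then of_bool (y div 2 \<in> C)
     else (THE v. \<exists>c m. y div 2 = pair_poly c m \<and> v = dec c m))" for y
  have "entry f c m = dec c m" for c m
  proof -
    have "(THE v. \<exists>c' m'. pair_poly c m = pair_poly c' m' \<and> v = dec c' m') = dec c m"
      by (rule the_equality) (use pair_poly_inj in blast)+
    then show ?thesis by (simp add: entry_def f_def)
  qed
  moreover have "\<exists>c'. dec c' i = v \<and> (\<forall>j<i. dec c' j = dec c j)" for c i v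
    by (intro exI[of _ "list_encode (map (dec c) [0..<i] @ [v])"]) (simp add: dec_def Let_def nth_append)
  ultimately have "coder f" by (simp add: coder_def)
  moreover have "fset f = C" by (auto simp: fset_def f_def)
  ultimately show ?thesis by blast
qed

lemma coder_list: assumes "coder f" shows "\<exists>c. \<forall>j<n. entry f c j = g j"
proof (induction n)
  case (Suc n)
  then obtain c where c: "\<forall>j<n. entry f c j = g j" by blast
  obtain c' where "entry f c' n = g n" "\<forall>j<n. entry f c' j = entry f c j" using assms unfolding coder_def by blast
  then have "\<forall>j<Suc n. entry f c' j = g j" using c by (simp add: less_Suc_eq)
  then show ?case ..
qed simp

section \<open>Formulas for the graphs of functionals\<close>

definition FOr :: "aform \<Rightarrow> aform \<Rightarrow> aform" where "FOr \<phi> \<psi> = Neg (Conj (Neg \<phi>) (Neg \<psi>))"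
definition FImp :: "aform \<Rightarrow> aform \<Rightarrow> aform" where "FImp \<phi> \<psi> = Neg (Conj \<phi> (Neg \<psi>))"
definition FAll :: "nat \<Rightarrow> aform \<Rightarrow> aform" where "FAll x \<phi> = Neg (Ex x (Neg \<phi>))"
definition FFalse :: aform where "FFalse = Neg (Eq TZero TZero)"
definition double_term :: "aterm \<Rightarrow> aterm" where "double_term t = TAdd t t"
definition entry_term :: "aterm \<Rightarrow> aterm \<Rightarrow> aterm" where
  "entry_term c m = TFun (TSuc (double_term (TAdd (TMul (TAdd c m) (TAdd c m)) c)))"
definition FLt :: "aterm \<Rightarrow> aterm \<Rightarrow> nat \<Rightarrow> aform" where
  "FLt s t d = Ex d (Eq t (TAdd s (TSuc (TVar d))))"
definition FJoin :: "aterm \<Rightarrow> nat \<Rightarrow> aform" where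
  "FJoin t d = Ex d (FOr (Conj (InA (TVar d)) (Eq t (double_term (TVar d))))
     (Conj (Eq (TFun (double_term (TVar d))) (TSuc TZero)) (Eq t (TSuc (double_term (TVar d))))))"

primrec FExs :: "nat \<Rightarrow> nat \<Rightarrow> aform \<Rightarrow> aform" where
  "FExs d 0 \<phi> = \<phi>"
| "FExs d (Suc j) \<phi> = Ex d (FExs (Suc d) j \<phi>)"

fun FConjs :: "aform list \<Rightarrow> aform" where
  "FConjs [] = Neg FFalse"
| "FConjs (\<phi> # \<phi>s) = Conj \<phi> (FConjs \<phi>s)"

primrec tfree :: "aterm \<Rightarrow> nat set" where
  "tfree (TVar x) = {x}"
| "tfree TZero = {}"
| "tfree (TSuc t) = tfree t"
| "tfree (TAdd s t) = tfree s \<union> tfree t"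
| "tfree (TMul s t) = tfree s \<union> tfree t"
| "tfree (TFun t) = tfree t"

text \<open>Bound variables are taken from \<open>d\<close> on, so terms with this property are
  never captured.\<close>

definition below :: "nat \<Rightarrow> aterm \<Rightarrow> bool" where "below d t \<longleftrightarrow> tfree t \<subseteq> {..<d}"

lemma below_simps [simp]:
  "below d (TVar x) \<longleftrightarrow> x < d" "below d TZero" "below d (TSuc t) \<longleftrightarrow> below d t"
  "below d (TAdd s t) \<longleftrightarrow> below d s \<and> below d t" "below d (TMul s t) \<longleftrightarrow> below d s \<and> below d t"
  "below d (TFun t) \<longleftrightarrow> below d t" "below d (entry_term s t) \<longleftrightarrow> below d s \<and> below d t"
  by (auto simp: below_def entry_term_def double_term_def)

lemma below_mono: "below d t \<Longrightarrow> d \<le> d' \<Longrightarrow> below d' t"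
  by (auto simp: below_def)

lemma tval_cong: "below d t \<Longrightarrow> (\<And>x. x < d \<Longrightarrow> e x = e' x) \<Longrightarrow> tval f e t = tval f e' t"
  by (induction t) auto

lemma tval_upd [simp]: "below d t \<Longrightarrow> d \<le> x \<Longrightarrow> tval f (e(x := n)) t = tval f e t"
  by (rule tval_cong) auto

lemma tval_double_term [simp]: "tval f e (double_term t) = 2 * tval f e t"
  by (simp add: double_term_def)

lemma tval_entry_term [simp]: "tval f e (entry_term c m) = entry f (tval f e c) (tval f e m)"
  by (simp add: entry_term_def entry_def pair_poly_def)

lemma sat_macros [simp]:
  "sat R f A (FOr \<phi> \<psi>) e \<longleftrightarrow> sat R f A \<phi> e \<or> sat R f A \<psi> e"
  "sat R f A (FImp \<phi> \<psi>) e \<longleftrightarrow> (sat R f A \<phi> e \<longrightarrow> sat R f A \<psi> e)"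
  "sat R f A (FAll x \<phi>) e \<longleftrightarrow> (\<forall>n. sat R f A \<phi> (e(x := n)))"
  "\<not> sat R f A FFalse e"
  "sat R f A (FConjs \<phi>s) e \<longleftrightarrow> (\<forall>\<phi>\<in>set \<phi>s. sat R f A \<phi> e)"
  by (simp_all add: FOr_def FImp_def FAll_def FFalse_def) (induction \<phi>s; simp add: FFalse_def)

lemma sat_FLt [simp]: "below d s \<Longrightarrow> below d t \<Longrightarrow> sat R f A (FLt s t d) e \<longleftrightarrow> tval f e s < tval f e t"
  by (simp add: FLt_def less_iff_Suc_add)

lemma sat_FJoin [simp]: "below d t \<Longrightarrow> sat R f A (FJoin t d) e \<longleftrightarrow> tval f e t \<in> join A (fset f)"
  by (auto simp: FJoin_def join_def fset_def)

definition shift :: "(nat \<Rightarrow> nat) \<Rightarrow> nat \<Rightarrow> nat list \<Rightarrow> nat \<Rightarrow> nat" where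
  "shift e d vs x = (if d \<le> x \<and> x < d + length vs then vs ! (x - d) else e x)"

lemma sat_FExs: "sat R f A (FExs d j \<phi>) e \<longleftrightarrow> (\<exists>vs. length vs = j \<and> sat R f A \<phi> (shift e d vs))"
proof (induction j arbitrary: d e)
  case 0
  have "shift e d [] = e" by (auto simp: shift_def)
  then show ?case by simp
next
  case (Suc j)
  have "shift (e(d := n)) (Suc d) vs = shift e d (n # vs)" for n vs
    by (rule ext) (auto simp: shift_def nth_Cons')
  then have "sat R f A (FExs d (Suc j) \<phi>) e \<longleftrightarrow> (\<exists>n vs. length vs = j \<and> sat R f A \<phi> (shift e d (n # vs)))"
    by (simp add: Suc del: fun_upd_apply)
  also have "\<dots> \<longleftrightarrow> (\<exists>vs. length vs = Suc j \<and> sat R f A \<phi> (shift e d vs))"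
    by (metis length_Suc_conv)
  finally show ?case .
qed

text \<open>Expresses that the program maps the values of \<open>ts\<close> to the value of
  \<open>r\<close>; variables from \<open>d\<close> on are fresh. Composition binds one variable per
  inner value, and recursion binds a code of the sequence of intermediate values, read through
  \<open>entry\<close>.\<close>

primrec graph_form :: "functional \<Rightarrow> aterm list \<Rightarrow> aterm \<Rightarrow> nat \<Rightarrow> aform" where
  "graph_form Zero ts r d = Eq r TZero"
| "graph_form Succ ts r d = (case ts of [t] \<Rightarrow> Eq r (TSuc t) | _ \<Rightarrow> FFalse)"
| "graph_form (Proj i) ts r d = (if i < length ts then Eq r (ts ! i) else FFalse)"
| "graph_form Orc ts r d = (case ts of [t] \<Rightarrow> FOr (Conj (FJoin t d) (Eq r (TSuc TZero))) (Conj (Neg (FJoin t d)) (Eq r TZero))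
      | _ \<Rightarrow> FFalse)"
| "graph_form (Comp f gs) ts r d = FExs d (length gs)
     (Conj (FConjs (map (\<lambda>(h, i). h ts (TVar (d + i)) (d + length gs)) (zip (map graph_form gs) [0..<length gs])))
        (graph_form f (map (\<lambda>i. TVar (d + i)) [0..<length gs]) r (d + length gs)))"
| "graph_form (PrimRec f g) ts r d = (case ts of [] \<Rightarrow> FFalse | t # us \<Rightarrow>
     Ex d (Conj (graph_form f us (entry_term (TVar d) TZero) (d + 1))
       (Conj (FAll (d + 1) (FImp (FLt (TVar (d + 1)) t (d + 2))
           (graph_form g (TVar (d + 1) # entry_term (TVar d) (TVar (d + 1)) # us) (entry_term (TVar d) (TSuc (TVar (d + 1)))) (d + 2))))
         (Eq r (entry_term (TVar d) t)))))"
| "graph_form (Mu f) ts r d = Conj (graph_form f (r # ts) TZero d)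
     (FAll d (FImp (FLt (TVar d) r (d + 1)) (Ex (d + 1) (graph_form f (TVar d # ts) (TSuc (TVar (d + 1))) (d + 2)))))"

lemma run_Mu_iff:
  "run D (Mu \<phi>) xs = Some v \<longleftrightarrow> run D \<phi> (v # xs) = Some 0 \<and> (\<forall>m<v. \<exists>u. run D \<phi> (m # xs) = Some (Suc u))"
proof
  assume "run D (Mu \<phi>) xs = Some v"
  then obtain n where n: "run D \<phi> (n # xs) = Some 0" "\<forall>m<n. run D \<phi> (m # xs) \<noteq> None"
    "v = (LEAST n. run D \<phi> (n # xs) = Some 0)" by (auto split: if_splits)
  have "run D \<phi> (v # xs) = Some 0" unfolding n(3) using n(1) by (rule LeastI)
  moreover have vn: "v \<le> n" unfolding n(3) using n(1) by (rule Least_le)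
  moreover have "\<exists>u. run D \<phi> (m # xs) = Some (Suc u)" if "m < v" for m
  proof -
    have "run D \<phi> (m # xs) \<noteq> Some 0" using that unfolding n(3) by (rule not_less_Least)
    moreover have "run D \<phi> (m # xs) \<noteq> None" using n(2) that vn by simp
    ultimately show ?thesis by (metis not0_implies_Suc option.exhaust)
  qed
  ultimately show "run D \<phi> (v # xs) = Some 0 \<and> (\<forall>m<v. \<exists>u. run D \<phi> (m # xs) = Some (Suc u))" by blast
next
  assume z: "run D \<phi> (v # xs) = Some 0 \<and> (\<forall>m<v. \<exists>u. run D \<phi> (m # xs) = Some (Suc u))"
  have "(LEAST n. run D \<phi> (n # xs) = Some 0) = v"
  proof (rule Least_equality)
    show "run D \<phi> (v # xs) = Some 0" using z by blast
    fix y assume "run D \<phi> (y # xs) = Some 0"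
    then show "v \<le> y" using z by (cases "y < v") auto
  qed
  moreover have "\<exists>n. run D \<phi> (n # xs) = Some 0 \<and> (\<forall>m<n. run D \<phi> (m # xs) \<noteq> None)"
    using z by (intro exI[of _ v]) auto
  ultimately show "run D (Mu \<phi>) xs = Some v" by simp
qed

text \<open>Recursion becomes the existence of the sequence of intermediate values, of which
  \<open>entry\<close> can code a sufficiently long finite part.\<close>

lemma run_PrimRec_iff:
  "run D (PrimRec \<phi> \<gamma>) (n # ys) = Some v \<longleftrightarrow> (\<exists>h. run D \<phi> ys = Some (h 0) \<and>
     (\<forall>m<n. run D \<gamma> (m # h m # ys) = Some (h (Suc m))) \<and> v = h n)"
proof -
  let ?r = "\<lambda>n. rec_nat (run D \<phi> ys) (\<lambda>m r. case r of None \<Rightarrow> None | Some v \<Rightarrow> run D \<gamma> (m # v # ys)) n"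
  have "?r k = Some (h k)" if "run D \<phi> ys = Some (h 0)" "\<forall>m<n. run D \<gamma> (m # h m # ys) = Some (h (Suc m))" "k \<le> n" for h k
    using that(3) by (induction k) (use that in auto)
  moreover have "\<exists>h. run D \<phi> ys = Some (h 0) \<and> (\<forall>m<n. run D \<gamma> (m # h m # ys) = Some (h (Suc m))) \<and> v = h n"
    if "?r n = Some v"
  proof -
    \<comment> \<open>Divergence persists along the recursion, so downward induction from n gives
      convergence of all earlier values.\<close>
    have d: "?r k \<noteq> None" if "k \<le> n" for k
      using that \<open>?r n = Some v\<close>
    proof (induction "n - k" arbitrary: k)
      case (Suc j)
      then have "?r (Suc k) \<noteq> None" using Suc.hyps(1)[of "Suc k"] by simp
      then show ?case by (auto split: option.splits)
    qed simp
    have "run D \<gamma> (m # the (?r m) # ys) = Some (the (?r (Suc m)))" if "m < n" for m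
      using d[of m] d[of "Suc m"] that by auto
    moreover have "run D \<phi> ys = Some (the (?r 0))" using d[of 0] by auto
    ultimately show ?thesis using that by (intro exI[of _ "\<lambda>k. the (?r k)"]) auto
  qed
  ultimately show ?thesis by auto
qed

lemma sat_graph_form:
  assumes "coder f" "\<forall>t\<in>set ts. below d t" "below d r"
  shows "sat R f A (graph_form \<Phi> ts r d) e \<longleftrightarrow> run (join A (fset f)) \<Phi> (map (tval f e) ts) = Some (tval f e r)"
  using assms(2,3)
proof (induction \<Phi> arbitrary: ts r d e)
  case Zero
  then show ?case by auto
next
  case Succ
  then show ?case by (auto split: list.splits)
next
  case (Proj i)
  then show ?case by auto
next
  case Orc
  then show ?case by (auto split: list.splits)
next
  case (Comp \<phi> gs)
  let ?J = "join A (fset f)" and ?j = "length gs" and ?xs = "map (tval f e) ts"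
  have t: "below (d + ?j) t" if "below d t" for t using that below_mono by simp
  have v: "tval f (shift e d vs) t = tval f e t" if "below d t" for t vs
    by (rule tval_cong[OF that]) (simp add: shift_def)
  have xs: "map (tval f (shift e d vs)) ts = ?xs" for vs using Comp.prems v by simp
  have 1: "sat R f A (graph_form g ts (TVar (d + i)) (d + ?j)) (shift e d vs) \<longleftrightarrow> run ?J g ?xs = Some (vs ! i)"
    if "length vs = ?j" "i < ?j" "g \<in> set gs" for i vs g
  proof -
    have "shift e d vs (d + i) = vs ! i" using that by (simp add: shift_def)
    then show ?thesis
      using Comp.IH(2)[OF that(3), of ts "d + ?j" "TVar (d + i)" "shift e d vs"] that Comp.prems t xs by simp
  qed
  have vs: "map (tval f (shift e d vs)) (map (\<lambda>i. TVar (d + i)) [0..<?j]) = vs" if "length vs = ?j" for vs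
    using that by (intro nth_equalityI) (auto simp: shift_def)
  have 2: "sat R f A (graph_form \<phi> (map (\<lambda>i. TVar (d + i)) [0..<?j]) r (d + ?j)) (shift e d vs) \<longleftrightarrow> run ?J \<phi> vs = Some (tval f e r)"
    if "length vs = ?j" for vs
    using Comp.IH(1)[of "map (\<lambda>i. TVar (d + i)) [0..<?j]" "d + ?j" r "shift e d vs"] Comp.prems t vs[OF that] v[of r] by auto
  have "sat R f A (graph_form (Comp \<phi> gs) ts r d) e \<longleftrightarrow>
    (\<exists>vs. length vs = ?j \<and> (\<forall>i<?j. run ?J (gs ! i) ?xs = Some (vs ! i)) \<and> run ?J \<phi> vs = Some (tval f e r))"
  proof -
    have "(\<forall>\<psi>\<in>set (map (\<lambda>(h, i). h ts (TVar (d + i)) (d + ?j)) (zip (map graph_form gs) [0..<?j])). sat R f A \<psi> e') \<longleftrightarrow>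
      (\<forall>i<?j. sat R f A (graph_form (gs ! i) ts (TVar (d + i)) (d + ?j)) e')" for e'
      unfolding all_set_conv_all_nth by simp
    then have "sat R f A (graph_form (Comp \<phi> gs) ts r d) e \<longleftrightarrow> (\<exists>vs. length vs = ?j \<and>
      (\<forall>i<?j. sat R f A (graph_form (gs ! i) ts (TVar (d + i)) (d + ?j)) (shift e d vs)) \<and>
      sat R f A (graph_form \<phi> (map (\<lambda>i. TVar (d + i)) [0..<?j]) r (d + ?j)) (shift e d vs))"
      by (simp only: graph_form.simps sat_FExs sat.simps sat_macros(5))
    then show ?thesis using 1 2 by (simp cong: conj_cong)
  qed
  also have "\<dots> \<longleftrightarrow> run ?J (Comp \<phi> gs) ?xs = Some (tval f e r)"
  proof
    assume "\<exists>vs. length vs = ?j \<and> (\<forall>i<?j. run ?J (gs ! i) ?xs = Some (vs ! i)) \<and> run ?J \<phi> vs = Some (tval f e r)"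
    then obtain vs where w: "length vs = ?j" "\<forall>i<?j. run ?J (gs ! i) ?xs = Some (vs ! i)" "run ?J \<phi> vs = Some (tval f e r)" by blast
    have "map (\<lambda>g. the (run ?J g ?xs)) gs = vs" using w by (intro nth_equalityI) auto
    moreover have "\<forall>g\<in>set gs. run ?J g ?xs \<noteq> None" using w(2) by (auto simp: in_set_conv_nth)
    ultimately show "run ?J (Comp \<phi> gs) ?xs = Some (tval f e r)" using w(3) by (simp del: map_map)
  next
    assume "run ?J (Comp \<phi> gs) ?xs = Some (tval f e r)"
    then have "\<forall>g\<in>set gs. run ?J g ?xs \<noteq> None" "run ?J \<phi> (map (\<lambda>g. the (run ?J g ?xs)) gs) = Some (tval f e r)"
      by (auto split: if_splits)
    then show "\<exists>vs. length vs = ?j \<and> (\<forall>i<?j. run ?J (gs ! i) ?xs = Some (vs ! i)) \<and> run ?J \<phi> vs = Some (tval f e r)"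
      by (intro exI[of _ "map (\<lambda>g. the (run ?J g ?xs)) gs"]) (auto simp del: map_map)
  qed
  finally show ?case .
next
  case (PrimRec \<phi> \<gamma>)
  let ?J = "join A (fset f)"
  show ?case
  proof (cases ts)
    case Nil
    then show ?thesis by simp
  next
    case (Cons t us)
    have b: "below d t" "\<forall>t\<in>set us. below d t" "below d r" using PrimRec.prems Cons by auto
    have b1: "below (Suc d) t" "\<forall>t\<in>set us. below (Suc d) t" "below (Suc d) r"
      "below (Suc (Suc d)) t" "\<forall>t\<in>set us. below (Suc (Suc d)) t"
      using b below_mono[of d _ "Suc d"] below_mono[of d _ "Suc (Suc d)"] by auto
    have u: "map (tval f (e(d := c, Suc d := m))) us = map (tval f e) us" "map (tval f (e(d := c))) us = map (tval f e) us" for c m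
      using b b1 by auto
    let ?n = "tval f e t" and ?ys = "map (tval f e) us"
    have "sat R f A (graph_form (PrimRec \<phi> \<gamma>) ts r d) e \<longleftrightarrow> (\<exists>c. run ?J \<phi> ?ys = Some (entry f c 0) \<and>
       (\<forall>m<?n. run ?J \<gamma> (m # entry f c m # ?ys) = Some (entry f c (Suc m))) \<and> tval f e r = entry f c ?n)"
      using Cons b b1 by (simp add: PrimRec.IH u fun_upd_same fun_upd_other del: fun_upd_apply)
    also have "\<dots> \<longleftrightarrow> (\<exists>h. run ?J \<phi> ?ys = Some (h 0) \<and>
       (\<forall>m<?n. run ?J \<gamma> (m # h m # ?ys) = Some (h (Suc m))) \<and> tval f e r = h ?n)"
    proof
      assume "\<exists>h. run ?J \<phi> ?ys = Some (h 0) \<and>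
       (\<forall>m<?n. run ?J \<gamma> (m # h m # ?ys) = Some (h (Suc m))) \<and> tval f e r = h ?n"
      then obtain h where h: "run ?J \<phi> ?ys = Some (h 0)"
       "\<forall>m<?n. run ?J \<gamma> (m # h m # ?ys) = Some (h (Suc m))" "tval f e r = h ?n" by blast
      obtain c where "\<forall>j<Suc ?n. entry f c j = h j" using coder_list[OF assms(1)] by blast
      then show "\<exists>c. run ?J \<phi> ?ys = Some (entry f c 0) \<and>
       (\<forall>m<?n. run ?J \<gamma> (m # entry f c m # ?ys) = Some (entry f c (Suc m))) \<and> tval f e r = entry f c ?n"
        using h by (intro exI[of _ c]) auto
    qed blast
    also have "\<dots> \<longleftrightarrow> run ?J (PrimRec \<phi> \<gamma>) (map (tval f e) ts) = Some (tval f e r)"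
      unfolding Cons list.map run_PrimRec_iff ..
    finally show ?thesis .
  qed
next
  case (Mu \<phi>)
  have b1: "\<forall>t\<in>set ts. below (Suc d) t" "below (Suc d) r" "\<forall>t\<in>set ts. below (Suc (Suc d)) t"
    using Mu.prems below_mono[of d _ "Suc d"] below_mono[of d _ "Suc (Suc d)"] by auto
  have u: "map (tval f (e(d := m, Suc d := v))) ts = map (tval f e) ts" for m v
    using Mu.prems b1 by auto
  show ?case unfolding run_Mu_iff using Mu.prems b1 by (simp add: Mu.IH u fun_upd_same fun_upd_other del: fun_upd_apply)
qed

section \<open>Homogeneous sets\<close>

lemma infinite_subsets_iff: "D \<in> infinite_subsets B \<longleftrightarrow> D \<subseteq> B \<and> infinite D"
  by (simp add: infinite_subsets_def)

text \<open>Zorn's lemma for families whose finite intersections meet A in infinite sets. A maximal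
  family contains each set or its complement, since otherwise finitely many members would leave only
  a finite part of A. As all members meet A infinitely, it is nonprincipal.\<close>

lemma ultrafilter_on:
  fixes A :: "nat set"
  assumes "infinite A"
  obtains U where "\<And>X Y. X \<in> U \<Longrightarrow> Y \<in> U \<Longrightarrow> X \<inter> Y \<in> U" "\<And>X Y. X \<in> U \<Longrightarrow> X \<subseteq> Y \<Longrightarrow> Y \<in> U"
    "\<And>X. X \<notin> U \<Longrightarrow> - X \<in> U" "\<And>X. X \<in> U \<Longrightarrow> infinite (A \<inter> X)"
proof -
  define C where "C = {\<F>. \<forall>S. S \<subseteq> \<F> \<longrightarrow> finite S \<longrightarrow> infinite (A \<inter> \<Inter>S)}"
  have "\<exists>M\<in>C. \<forall>X\<in>C. M \<subseteq> X \<longrightarrow> X = M"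
  proof (rule subset_Zorn_nonempty)
    have "{} \<in> C" using assms by (simp add: C_def)
    then show "C \<noteq> {}" by blast
    fix \<C> assume \<C>: "\<C> \<noteq> {}" "subset.chain C \<C>"
    have "infinite (A \<inter> \<Inter>S)" if S: "S \<subseteq> \<Union>\<C>" "finite S" for S
    proof -
      obtain \<F> where F: "\<F> \<in> \<C>" "S \<subseteq> \<F>"
        using finite_subset_Union_chain[OF S(2,1) \<C>] by blast
      have "\<F> \<in> C" using \<C>(2) F(1) unfolding subset.chain_def by blast
      then show ?thesis using F(2) S(2) by (simp add: C_def)
    qed
    then show "\<Union>\<C> \<in> C" by (simp add: C_def)
  qed
  then obtain U where UC: "U \<in> C" and max: "\<And>\<F>. \<F> \<in> C \<Longrightarrow> U \<subseteq> \<F> \<Longrightarrow> \<F> = U" by blast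
  have fip: "infinite (A \<inter> \<Inter>S)" if "S \<subseteq> U" "finite S" for S
    using UC that by (simp add: C_def)
  have wit: "\<exists>S\<subseteq>U. finite S \<and> finite (A \<inter> X \<inter> \<Inter>S)" if "X \<notin> U" for X
  proof -
    have "insert X U \<notin> C" using max[of "insert X U"] that by blast
    then obtain S where S: "S \<subseteq> insert X U" "finite S" "finite (A \<inter> \<Inter>S)" by (auto simp: C_def)
    have "A \<inter> X \<inter> \<Inter>(S - {X}) \<subseteq> A \<inter> \<Inter>S" by blast
    then have "finite (A \<inter> X \<inter> \<Inter>(S - {X}))" using S(3) by (rule finite_subset)
    moreover have "S - {X} \<subseteq> U" using S(1) by blast
    ultimately show ?thesis using S(2) by blast
  qed
  have ultra: "- X \<in> U" if X: "X \<notin> U" for X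
  proof (rule ccontr)
    assume "- X \<notin> U"
    then obtain S where S: "S \<subseteq> U" "finite S" "finite (A \<inter> - X \<inter> \<Inter>S)" using wit by blast
    obtain T where T: "T \<subseteq> U" "finite T" "finite (A \<inter> X \<inter> \<Inter>T)" using wit[OF X] by blast
    have "A \<inter> \<Inter>(S \<union> T) \<subseteq> (A \<inter> - X \<inter> \<Inter>S) \<union> (A \<inter> X \<inter> \<Inter>T)" by blast
    then have "finite (A \<inter> \<Inter>(S \<union> T))" using S(3) T(3) by (meson finite_UnI finite_subset)
    moreover have "infinite (A \<inter> \<Inter>(S \<union> T))" using S T by (intro fip) auto
    ultimately show False by blast
  qed
  have mem: "Z \<in> U" if "S \<subseteq> U" "finite S" "\<Inter>S \<subseteq> Z" for S Z
  proof (rule ccontr)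
    assume "Z \<notin> U"
    then have "- Z \<in> U" by (rule ultra)
    then have "infinite (A \<inter> \<Inter>(insert (- Z) S))" using that by (intro fip) auto
    moreover have "A \<inter> \<Inter>(insert (- Z) S) = {}" using that(3) by blast
    ultimately show False by simp
  qed
  show ?thesis
  proof
    show "X \<inter> Y \<in> U" if "X \<in> U" "Y \<in> U" for X Y using mem[of "{X, Y}"] that by auto
    show "Y \<in> U" if "X \<in> U" "X \<subseteq> Y" for X Y using mem[of "{X}"] that by auto
    show "- X \<in> U" if "X \<notin> U" for X by (rule ultra[OF that])
    show "infinite (A \<inter> X)" if "X \<in> U" for X using fip[of "{X}"] that by auto
  qed
qed

section \<open>Forcing along the ultrafilter\<close>

definition initial_part :: "nat set \<Rightarrow> nat set \<Rightarrow> bool" where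
  "initial_part s D \<longleftrightarrow> s \<subseteq> D \<and> (\<forall>x\<in>D - s. \<forall>y\<in>s. y < x)"

lemma initial_part_insert: "initial_part (insert x s) D \<Longrightarrow> \<forall>y\<in>s. y < x \<Longrightarrow> initial_part s D"
  by (auto simp: initial_part_def)

text \<open>\<open>forces A c U s\<close>: for \<open>U\<close>-generic extensions \<open>D\<close> of \<open>s\<close> the colour \<open>c D\<close> is eventually forced to be true.\<close>

inductive forces :: "nat set \<Rightarrow> (nat set \<Rightarrow> bool) \<Rightarrow> nat set set \<Rightarrow> nat set \<Rightarrow> bool" for A c U where
  base: "(\<And>D. D \<in> infinite_subsets A \<Longrightarrow> initial_part s D \<Longrightarrow> c D) \<Longrightarrow> forces A c U s"
| step: "X \<in> U \<Longrightarrow> (\<And>x. x \<in> X \<Longrightarrow> forces A c U (insert x s)) \<Longrightarrow> forces A c U s"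

lemma ex_greater: assumes "infinite (A :: nat set)" "finite s" shows "\<exists>x\<in>A. \<forall>y\<in>s. y < x"
proof -
  obtain m where "\<forall>y\<in>s. y < m" using assms(2) finite_nat_set_iff_bounded by blast
  moreover obtain x where "x \<in> A" "m < x" using assms(1) infinite_nat_iff_unbounded by blast
  ultimately show ?thesis by (meson less_trans)
qed

text \<open>A derivation of \<open>forces\<close> is followed upwards from s, choosing each time an
  element of A in the large set and beyond the elements chosen so far, until the base clause settles
  the colour.\<close>

lemma forces_witness:
  assumes A: "infinite A" and U: "\<And>X. X \<in> U \<Longrightarrow> infinite (A \<inter> X)"
  shows "forces A c U s \<Longrightarrow> finite s \<Longrightarrow> s \<subseteq> A \<Longrightarrow> \<exists>D\<in>infinite_subsets A. initial_part s D \<and> c D"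
proof (induction rule: forces.induct)
  case (base s)
  let ?D = "s \<union> {x\<in>A. \<forall>y\<in>s. y < x}"
  obtain m where m: "\<forall>y\<in>s. y < m" using base.prems(1) finite_nat_set_iff_bounded by blast
  have "A \<subseteq> {..m} \<union> ?D" using m by force
  then have "infinite ?D" using A finite_subset by blast
  then have "?D \<in> infinite_subsets A" using base.prems by (auto simp: infinite_subsets_iff)
  moreover have "initial_part s ?D" by (auto simp: initial_part_def)
  ultimately show ?case using base.hyps by blast
next
  case (step X s)
  obtain x where x: "x \<in> A \<inter> X" "\<forall>y\<in>s. y < x" using ex_greater[OF U[OF step.hyps(1)] step.prems(1)] by blast
  then obtain D where D: "D \<in> infinite_subsets A" "initial_part (insert x s) D" "c D" using step.IH[of x] step.prems by auto
  have "initial_part s D" using D(2) x(2) by (rule initial_part_insert)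
  then show ?case using D by blast
qed

text \<open>A diagonal form of the clopen Ramsey theorem for countably many colourings. Whether s
  forces colour p is unchanged by adding U-most points, and the sequence x is chosen to preserve
  these truth values for all sets of earlier points and colours up to the current index. Forcing at
  the empty set thus settles the colours of far-out subsets.\<close>

theorem homogeneous:
  fixes c :: "nat \<Rightarrow> nat set \<Rightarrow> bool"
  assumes A: "infinite A"
    and cont: "\<And>p D. D \<in> infinite_subsets A \<Longrightarrow>
       \<exists>b. \<forall>D'\<in>infinite_subsets A. D' \<inter> {..<b} = D \<inter> {..<b} \<longrightarrow> c p D' = c p D"
  obtains X col where "X \<in> infinite_subsets A"
    "\<And>p. \<exists>b. \<forall>D\<in>infinite_subsets X. (\<forall>x\<in>D. b \<le> x) \<longrightarrow> c p D = col p"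
proof (rule ultrafilter_on[OF A])
  fix U :: "nat set set"
  assume U: "\<And>X Y. X \<in> U \<Longrightarrow> Y \<in> U \<Longrightarrow> X \<inter> Y \<in> U" "\<And>X Y. X \<in> U \<Longrightarrow> X \<subseteq> Y \<Longrightarrow> Y \<in> U"
    "\<And>X. X \<notin> U \<Longrightarrow> - X \<in> U" "\<And>X. X \<in> U \<Longrightarrow> infinite (A \<inter> X)"
  define g where "g p s = forces A (c p) U s" for p s
  have big: "{x. m < x} \<in> U" for m
  proof (rule ccontr)
    assume "{x. m < x} \<notin> U"
    then have "infinite (A \<inter> - {x. m < x})" by (intro U(4) U(3))
    moreover have "A \<inter> - {x. m < x} \<subseteq> {..m}" by auto
    ultimately show False using finite_subset by blast
  qed
  \<comment> \<open>If s forces, so do its extensions by U-many points, by inversion of the last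
    rule; if extensions by U-many points force, then so does s by \<open>step\<close>.\<close>
  have agree: "{x. g p (insert x s) = g p s} \<in> U" if s: "finite s" for p s
  proof (cases "g p s")
    case True
    have "{x. g p (insert x s)} \<in> U"
      using True[unfolded g_def]
    proof (cases rule: forces.cases)
      case base
      obtain m where m: "\<forall>y\<in>s. y < m" using s finite_nat_set_iff_bounded by blast
      have "g p (insert x s)" if "m < x" for x
        unfolding g_def
      proof (rule forces.base)
        fix D assume D: "D \<in> infinite_subsets A" "initial_part (insert x s) D"
        have "\<forall>y\<in>s. y < x" using m that by (meson less_trans)
        with D(2) have "initial_part s D" by (rule initial_part_insert)
        with D(1) show "c p D" by (rule base)
      qed
      then show ?thesis by (intro U(2)[OF big[of m]]) auto
    next
      case (step X)
      show ?thesis unfolding g_def by (rule U(2)[OF step(1)]) (use step(2) in auto)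
    qed
    then show ?thesis using True by simp
  next
    case False
    have "{x. g p (insert x s)} \<notin> U"
    proof
      assume "{x. g p (insert x s)} \<in> U"
      then have "g p s" unfolding g_def by (rule forces.step) simp
      then show False using False by simp
    qed
    then have "- {x. g p (insert x s)} \<in> U" by (rule U(3))
    then show ?thesis using False by (simp add: Collect_neg_eq)
  qed
  have fin: "(\<Inter>i\<in>I. Z i) \<in> U" if "finite I" "\<And>i. i \<in> I \<Longrightarrow> Z i \<in> U" for I :: "(nat \<times> nat set) set" and Z
    using that
  proof (induction rule: finite_induct)
    case empty
    then show ?case using U(2)[OF big[of 0], of UNIV] by simp
  next
    case (insert i I)
    have "Z i \<inter> (\<Inter>i\<in>I. Z i) \<in> U" by (rule U(1)) (use insert in auto)
    then show ?case by simp
  qed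
  \<comment> \<open>Only finitely many pairs \<open>(p, s)\<close> are concerned, so the
    corresponding members of U have an intersection in U, which meets A beyond F.\<close>
  have next_least_above: "\<exists>x. x \<in> A \<and> (\<forall>y\<in>F. y < x) \<and> (\<forall>s\<subseteq>F. \<forall>p\<le>k. g p (insert x s) = g p s)"
    if F: "finite F" for F k
  proof -
    let ?Z = "\<lambda>(p, s). {x. g p (insert x s) = g p s}"
    have "(\<Inter>i\<in>{..k} \<times> Pow F. ?Z i) \<in> U"
    proof (rule fin)
      show "?Z i \<in> U" if "i \<in> {..k} \<times> Pow F" for i
        using that agree[OF finite_subset[OF _ F]] by (cases i) simp
    qed (use F in simp)
    from ex_greater[OF U(4)[OF this] F] obtain x where
      x: "x \<in> A" "x \<in> (\<Inter>i\<in>{..k} \<times> Pow F. ?Z i)" "\<forall>y\<in>F. y < x" by blast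
    have "g p (insert x s) = g p s" if "s \<subseteq> F" "p \<le> k" for s p
      using INT_D[OF x(2), of "(p, s)"] that by simp
    with x(1,3) show ?thesis by (intro exI[of _ x] conjI allI impI)
  qed
  have "\<exists>F. \<forall>k. (finite (F k) \<and> F k \<subseteq> A) \<and> (\<exists>x. x \<in> A \<and> (\<forall>y\<in>F k. y < x) \<and>
      (\<forall>s\<subseteq>F k. \<forall>p\<le>k. g p (insert x s) = g p s) \<and> F (Suc k) = insert x (F k))"
  proof (rule dependent_nat_choice)
    fix F :: "nat set" and k :: nat assume F: "finite F \<and> F \<subseteq> A"
    obtain x where "x \<in> A \<and> (\<forall>y\<in>F. y < x) \<and> (\<forall>s\<subseteq>F. \<forall>p\<le>k. g p (insert x s) = g p s)"
      using next_least_above[OF conjunct1[OF F], of k] by (elim exE) (rule that)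
    then show "\<exists>F'. (finite F' \<and> F' \<subseteq> A) \<and> (\<exists>x. x \<in> A \<and> (\<forall>y\<in>F. y < x) \<and>
      (\<forall>s\<subseteq>F. \<forall>p\<le>k. g p (insert x s) = g p s) \<and> F' = insert x F)"
      using F by (intro exI[of _ "insert x F"]) auto
  qed (intro exI[of _ "{}"], simp)
  then obtain F where F: "\<forall>k. (finite (F k) \<and> F k \<subseteq> A) \<and> (\<exists>x. x \<in> A \<and> (\<forall>y\<in>F k. y < x) \<and>
      (\<forall>s\<subseteq>F k. \<forall>p\<le>k. g p (insert x s) = g p s) \<and> F (Suc k) = insert x (F k))"
    by (elim exE) (rule that)
  have ex: "\<forall>k. \<exists>x. x \<in> A \<and> (\<forall>y\<in>F k. y < x) \<and>
      (\<forall>s\<subseteq>F k. \<forall>p\<le>k. g p (insert x s) = g p s) \<and> F (Suc k) = insert x (F k)"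
    by (intro allI) (rule conjunct2[OF spec[OF F]])
  obtain x where "\<forall>k. x k \<in> A \<and> (\<forall>y\<in>F k. y < x k) \<and>
      (\<forall>s\<subseteq>F k. \<forall>p\<le>k. g p (insert (x k) s) = g p s) \<and> F (Suc k) = insert (x k) (F k)"
    using choice[OF ex] by (elim exE) (rule that)
  then have x: "\<And>k. x k \<in> A" "\<And>k y. y \<in> F k \<Longrightarrow> y < x k"
    "\<And>k s p. s \<subseteq> F k \<Longrightarrow> p \<le> k \<Longrightarrow> g p (insert (x k) s) = g p s" "\<And>k. F (Suc k) = insert (x k) (F k)" by simp_all
  have xF: "x i \<in> F k" if "i < k" for i k
    using that by (induction k) (auto simp: x(4) less_Suc_eq)
  have xm: "strict_mono x" by (rule strict_monoI) (use xF x(2) in blast)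
  have hom: "c p D = g p {}" if D: "D \<in> infinite_subsets (range x)" "\<forall>y\<in>D. x p \<le> y" for D p
  proof -
    have pre: "g p (D \<inter> {..<b}) = g p {}" for b
    proof (induction b)
      case (Suc b)
      show ?case
      proof (cases "b \<in> D")
        case True
        then obtain i where i: "b = x i" using D(1) by (auto simp: infinite_subsets_iff)
        have "p \<le> i" using D(2) True i xm by (auto simp: strict_mono_less_eq)
        moreover have "D \<inter> {..<b} \<subseteq> F i"
        proof
          fix y assume y: "y \<in> D \<inter> {..<b}"
          then obtain j where "y = x j" using D(1) by (auto simp: infinite_subsets_iff)
          then show "y \<in> F i" using y i xm xF by (auto simp: strict_mono_less)
        qed
        moreover have "D \<inter> {..<Suc b} = insert b (D \<inter> {..<b})" using True by (auto simp: less_Suc_eq)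
        ultimately show ?thesis using x(3)[of "D \<inter> {..<b}" i p] i Suc by simp
      next
        case False
        then have "D \<inter> {..<Suc b} = D \<inter> {..<b}" by (auto simp: less_Suc_eq)
        then show ?thesis using Suc by simp
      qed
    qed simp
    have DA: "D \<in> infinite_subsets A" using D(1) x(1) by (auto simp: infinite_subsets_iff)
    obtain b where b: "\<forall>D'\<in>infinite_subsets A. D' \<inter> {..<b} = D \<inter> {..<b} \<longrightarrow> c p D' = c p D"
      using cont[OF DA, of p] by (elim exE) (rule that)
    have "infinite D" using DA by (simp add: infinite_subsets_iff)
    then obtain z where z: "z \<in> D" "b < z" unfolding infinite_nat_iff_unbounded by blast
    \<comment> \<open>Ending the segment at an element z > b of D ensures that every D' with this
      initial part has no other elements up to z and hence agrees with D below b.\<close>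
    let ?s = "D \<inter> {..<Suc z}"
    have det: "c p D' = c p D" if D': "D' \<in> infinite_subsets A" "initial_part ?s D'" for D'
    proof (rule b[rule_format, OF D'(1)])
      have i: "?s \<subseteq> D'" "\<And>x. x \<in> D' \<Longrightarrow> x \<notin> ?s \<Longrightarrow> z < x"
        using D'(2) z(1) by (auto simp: initial_part_def)
      have 1: "y \<in> D \<inter> {..<b}" if y: "y \<in> D'" "y < b" for y
      proof -
        have "y \<in> ?s" using i(2)[OF y(1)] y(2) z(2) by linarith
        then show ?thesis using y by simp
      qed
      have 2: "y \<in> D'" if "y \<in> D" "y < b" for y
        by (rule subsetD[OF i(1)]) (use that z(2) in simp)
      show "D' \<inter> {..<b} = D \<inter> {..<b}" using 1 2 by (intro set_eqI) (simp, metis)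
    qed
    \<comment> \<open>The colour is constant on the extensions of \<open>?s\<close>: if true, the
      base clause applies; if false, \<open>forces_witness\<close> would yield an extension with the
      wrong colour.\<close>
    have "g p ?s = c p D"
    proof (cases "c p D")
      case True
      then have "g p ?s" unfolding g_def by (intro forces.base) (simp add: det)
      then show ?thesis using True by simp
    next
      case False
      have "\<not> g p ?s"
      proof
        assume "g p ?s"
        then have "\<exists>D'\<in>infinite_subsets A. initial_part ?s D' \<and> c p D'"
          unfolding g_def using DA by (intro forces_witness[OF A U(4)]) (auto simp: infinite_subsets_iff)
        then obtain D' where "D' \<in> infinite_subsets A" "initial_part ?s D'" "c p D'" by (elim bexE conjE) (rule that)
        then show False using det[of D'] False by simp
      qed
      then show ?thesis using False by simp
    qed
    then show ?thesis using pre by simp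
  qed
  show ?thesis
  proof (rule that)
    show "range x \<in> infinite_subsets A"
      using x(1) xm by (auto simp: infinite_subsets_iff strict_mono_imp_inj_on range_inj_infinite)
    show "\<exists>b. \<forall>D\<in>infinite_subsets (range x). (\<forall>x\<in>D. b \<le> x) \<longrightarrow> c p D = g p {}" for p
      using hom by blast
  qed
qed

section \<open>Types of infinite subsets\<close>

definition second_above :: "nat \<Rightarrow> nat \<Rightarrow> nat set \<Rightarrow> bool" where
  "second_above y e D \<longleftrightarrow> y \<in> D \<and> (\<exists>r<y. r \<in> D \<and> e \<le> r \<and> (\<forall>u<r. e \<le> u \<longrightarrow> u \<notin> D) \<and> (\<forall>u<y. r < u \<longrightarrow> u \<notin> D))"

text \<open>
  The number \<open>y\<close> below which \<open>A\<close> must have been enumerated is read off from \<open>D\<close> itself, so that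
  removing small elements from \<open>D\<close> while keeping the type enforces longer agreement.
\<close>

definition type_at :: "nat set \<Rightarrow> nat \<Rightarrow> nat \<Rightarrow> nat set \<Rightarrow> bool" where
  "type_at A e s D \<longleftrightarrow> (\<exists>y<s. second_above y e D \<and> (\<forall>n<s. n \<in> enum_stage e s D \<longrightarrow> n \<in> A) \<and> (\<forall>n<y. n \<in> A \<longrightarrow> n \<in> enum_stage e s D))"

definition typed :: "nat set \<Rightarrow> nat \<Rightarrow> nat set \<Rightarrow> bool" where
  "typed A s D \<longleftrightarrow> (\<exists>e<s. type_at A e s D)"

definition type_stage :: "nat set \<Rightarrow> nat set \<Rightarrow> nat" where
  "type_stage A D = (LEAST s. typed A s D)"

text \<open>For n = m the last conjunct is trivial, so the instance n = m = 0 says just that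
  \<open>e\<close> is the least index qualifying at stage \<open>s\<close>. In this way the type
  itself is one of the colours.\<close>

definition follows_at :: "nat set \<Rightarrow> nat \<Rightarrow> nat \<Rightarrow> nat \<Rightarrow> nat \<Rightarrow> nat set \<Rightarrow> bool" where
  "follows_at A s e n m D \<longleftrightarrow> type_at A e s D \<and> (\<forall>e'<e. \<not> type_at A e' s D) \<and> (\<forall>t\<le>s. n \<in> enum_stage e t D \<longrightarrow> m \<in> enum_stage e t D)"

definition follows :: "nat set \<Rightarrow> nat \<Rightarrow> nat \<Rightarrow> nat \<Rightarrow> nat set \<Rightarrow> bool" where
  "follows A e n m D = follows_at A (type_stage A D) e n m D"

section \<open>The type depends on a finite part of the set\<close>

lemma second_above_cong:
  assumes "D \<inter> {..<s} = D' \<inter> {..<s}" "y < s" shows "second_above y e D = second_above y e D'"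
proof -
  have d: "u \<in> D \<longleftrightarrow> u \<in> D'" if "u \<le> y" for u
  proof -
    have "u \<in> D \<inter> {..<s} \<longleftrightarrow> u \<in> D' \<inter> {..<s}" unfolding assms(1) ..
    then show ?thesis using that assms(2) by simp
  qed
  have *: "second_above y e D'" if n: "second_above y e D" and "\<And>u. u \<le> y \<Longrightarrow> u \<in> D \<longleftrightarrow> u \<in> D'" for D D'
  proof -
    obtain r where r: "r < y" "r \<in> D" "e \<le> r" "\<forall>u<r. e \<le> u \<longrightarrow> u \<notin> D" "\<forall>u<y. r < u \<longrightarrow> u \<notin> D"
      using n unfolding second_above_def by blast
    have "\<forall>u<r. e \<le> u \<longrightarrow> u \<notin> D'" "\<forall>u<y. r < u \<longrightarrow> u \<notin> D'" using r(1,4,5) that(2) by simp_all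
    moreover have "y \<in> D'" "r \<in> D'" using that(1) r(1,2) that(2)[of y] that(2)[of r] by (simp_all add: second_above_def)
    ultimately show ?thesis unfolding second_above_def using r(1,3) by (intro conjI exI[of _ r])
  qed
  show ?thesis
  proof
    show "second_above y e D'" if "second_above y e D" by (rule *[OF that d])
    show "second_above y e D" if "second_above y e D'" by (rule *[OF that d[symmetric]])
  qed
qed

lemma restrict_mono: assumes "D \<inter> {..<s} = D' \<inter> {..<s}" "t \<le> (s::nat)" shows "D \<inter> {..<t} = D' \<inter> {..<t}"
proof -
  have *: "X \<inter> {..<t} = (X \<inter> {..<s}) \<inter> {..<t}" for X using assms(2) by auto
  show ?thesis unfolding *[of D] *[of D'] assms(1) ..
qed

lemma type_at_cong: assumes "D \<inter> {..<s} = D' \<inter> {..<s}" shows "type_at A e s D = type_at A e s D'"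
  unfolding type_at_def enum_stage_agree[OF assms] by (intro ex_cong1 conj_cong refl second_above_cong[OF assms])

lemma typed_cong: assumes "D \<inter> {..<s} = D' \<inter> {..<s}" shows "typed A s D = typed A s D'"
  unfolding typed_def type_at_cong[OF assms] ..

lemma follows_at_cong: assumes "D \<inter> {..<s} = D' \<inter> {..<s}" shows "follows_at A s e n m D = follows_at A s e n m D'"
proof -
  have "enum_stage e t D = enum_stage e t D'" if "t \<le> s" for t by (rule enum_stage_agree[OF restrict_mono[OF assms that]])
  then show ?thesis unfolding follows_at_def type_at_cong[OF assms] by simp
qed

lemma follows_at_root: "follows_at A s e n m D \<longleftrightarrow> follows_at A s e 0 0 D \<and> (\<forall>t\<le>s. n \<in> enum_stage e t D \<longrightarrow> m \<in> enum_stage e t D)"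
  by (auto simp: follows_at_def)

lemma type_stage_cong:
  assumes "typed A s D" "D \<inter> {..<s} = D' \<inter> {..<s}" shows "type_stage A D' = type_stage A D"
proof -
  let ?s = "type_stage A D"
  have s: "typed A ?s D" "?s \<le> s" unfolding type_stage_def using assms(1) by (rule LeastI, rule Least_le)
  have c: "typed A t D \<longleftrightarrow> typed A t D'" if "t \<le> s" for t by (rule typed_cong[OF restrict_mono[OF assms(2) that]])
  show ?thesis unfolding type_stage_def[of A D']
  proof (rule Least_equality)
    show "typed A ?s D'" using c s by simp
    fix t assume t: "typed A t D'"
    show "?s \<le> t"
    proof (cases "t \<le> s")
      case True
      then have "typed A t D" using c t by simp
      then show ?thesis unfolding type_stage_def by (rule Least_le)
    qed (use s in simp)
  qed
qed

text \<open>The continuity that \<open>homogeneous\<close> asks for: the colour is settled by D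
  below any stage at which D is typed.\<close>

lemma follows_cong:
  assumes "typed A s D" "D \<inter> {..<s} = D' \<inter> {..<s}" shows "follows A e n m D' = follows A e n m D"
proof -
  have "type_stage A D \<le> s" unfolding type_stage_def using assms(1) by (rule Least_le)
  then show ?thesis unfolding follows_def type_stage_cong[OF assms]
    by (intro follows_at_cong restrict_mono[OF assms(2)[symmetric]])
qed

definition least_above :: "nat set \<Rightarrow> nat \<Rightarrow> nat" where "least_above D a = (LEAST z. z \<in> D \<and> a \<le> z)"

lemma least_above_exists: "infinite D \<Longrightarrow> \<exists>z. z \<in> D \<and> (a::nat) \<le> z"
  unfolding infinite_nat_iff_unbounded_le by blast

lemma least_above: assumes "infinite D" shows "least_above D a \<in> D" "a \<le> least_above D a"
  using LeastI_ex[OF least_above_exists[OF assms]] unfolding least_above_def by auto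

lemma least_above_greater: assumes "infinite D" shows "a < least_above D (Suc a)"
  using least_above(2)[OF assms, of "Suc a"] by simp

lemma least_above_le: "z \<in> D \<Longrightarrow> a \<le> z \<Longrightarrow> least_above D a \<le> z"
  unfolding least_above_def by (simp add: Least_le)

lemma second_above_exists: assumes "infinite D" shows "second_above (least_above D (Suc (least_above D e))) e D"
  unfolding second_above_def
proof (intro conjI exI[of _ "least_above D e"] allI impI)
  show "least_above D (Suc (least_above D e)) \<in> D" "least_above D e < least_above D (Suc (least_above D e))" "least_above D e \<in> D" "e \<le> least_above D e"
    by (intro least_above least_above_greater assms)+
  show "u \<notin> D" if "u < least_above D e" "e \<le> u" for u using least_above_le[of u D e] that by auto
  show "u \<notin> D" if "u < least_above D (Suc (least_above D e))" "least_above D e < u" for u using least_above_le[of u D "Suc (least_above D e)"] that by auto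
qed

text \<open>An index enumerating A from D qualifies once the finitely many elements of A below the
  second element of D at or above the index have appeared; the sum of their stages is late
  enough.\<close>

lemma typed_exists:
  assumes "introenumerable A" "D \<in> infinite_subsets A" shows "\<exists>s. typed A s D"
proof -
  have D: "infinite D" using assms(2) by (simp add: infinite_subsets_iff)
  obtain e where e: "A = (\<Union>s. enum_stage e s D)"
    using assms enum_stage_imp[of D A] unfolding introenumerable_def by blast
  let ?y = "least_above D (Suc (least_above D e))"
  have m: "n \<in> A \<longleftrightarrow> (\<exists>s. n \<in> enum_stage e s D)" for n by (subst e) simp
  define g where "g n = (SOME s. n \<in> enum_stage e s D)" for n
  have g: "n \<in> enum_stage e (g n) D" if "n \<in> A" for n
    using that unfolding m g_def by (rule someI_ex)
  let ?s = "Suc (e + ?y + (\<Sum>n<?y. g n))"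
  have "n \<in> enum_stage e ?s D" if "n \<in> A" "n < ?y" for n
  proof -
    have "g n \<le> (\<Sum>n<?y. g n)" using that(2) by (intro member_le_sum) auto
    then have "enum_stage e (g n) D \<subseteq> enum_stage e ?s D" by (intro enum_stage_mono) simp
    then show ?thesis using g[OF that(1)] by blast
  qed
  moreover have "n \<in> A" if "n \<in> enum_stage e ?s D" for n using m that by (intro iffD2[OF m] exI)
  moreover have "?y < ?s" by simp
  ultimately have "type_at A e ?s D" unfolding type_at_def using second_above_exists[OF D, of e]
    by (intro exI[of _ ?y] conjI allI impI)
  moreover have "e < ?s" by simp
  ultimately show ?thesis unfolding typed_def by (intro exI[of _ ?s] exI[of _ e] conjI)
qed

section \<open>Coherent relations and their greedy sets\<close>

text \<open>\<open>H E e n m\<close> stands for the limit value of \<open>follows A e n m (E \<union> D)\<close> for \<open>D\<close> far out.\<close>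

definition agrees :: "nat set \<Rightarrow> (nat set \<Rightarrow> nat \<Rightarrow> nat \<Rightarrow> nat \<Rightarrow> bool) \<Rightarrow> nat \<Rightarrow> nat \<Rightarrow> bool" where
  "agrees A H r x \<longleftrightarrow> (\<forall>E. E \<subseteq> A \<inter> {..r} \<longrightarrow> (\<forall>e\<le>r. \<forall>n\<le>r. \<forall>m\<le>r. H E e n m \<longleftrightarrow> H (insert x E) e n m))"

text \<open>Links \<open>H\<close> to the true colours while speaking of finite sets only. If E is
  typed at a stage s not exceeding some element of E, extensions of E beyond its maximum agree with
  it below s, so the limit colour has to be the colour of E.\<close>

definition coherent :: "nat set \<Rightarrow> (nat set \<Rightarrow> nat \<Rightarrow> nat \<Rightarrow> nat \<Rightarrow> bool) \<Rightarrow> bool" where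
  "coherent A H \<longleftrightarrow> (\<forall>E e n m. finite E \<longrightarrow> (H E e n m \<longrightarrow> E \<subseteq> A) \<and>
     (E \<subseteq> A \<longrightarrow> (\<forall>z\<in>E. \<forall>s\<le>z. typed A s E \<longrightarrow> (H E e n m \<longleftrightarrow> follows A e n m E))))"

section \<open>Greedy sets\<close>

definition admissible where
  "admissible A H c sp F x \<longleftrightarrow> x \<in> A \<and> c < x \<and> (\<forall>r<x. r \<in> F \<longrightarrow> agrees A H r x \<and> sp A H r x)"

text \<open>Numbers are examined in increasing order against the part chosen so far, so that the
  resulting set is determined by \<open>P\<close> and decidable from it.\<close>

primrec greedy_below :: "(nat set \<Rightarrow> nat \<Rightarrow> bool) \<Rightarrow> nat \<Rightarrow> nat set" where
  "greedy_below P 0 = {}"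
| "greedy_below P (Suc x) = greedy_below P x \<union> {y. y = x \<and> P (greedy_below P x) x}"

definition greedy :: "(nat set \<Rightarrow> nat \<Rightarrow> bool) \<Rightarrow> nat set" where
  "greedy P = {x. P (greedy_below P x) x}"

lemma greedy_below_eq: "greedy_below P x = greedy P \<inter> {..<x}"
proof (induction x)
  case (Suc x)
  have "y \<in> greedy_below P (Suc x) \<longleftrightarrow> y \<in> greedy P \<inter> {..<Suc x}" for y
  proof -
    have "x \<in> greedy P \<longleftrightarrow> P (greedy_below P x) x" by (simp add: greedy_def)
    moreover have "y \<in> greedy_below P x \<longleftrightarrow> y \<in> greedy P \<and> y < x" unfolding Suc by simp
    ultimately show ?thesis unfolding greedy_below.simps Un_iff mem_Collect_eq Int_iff lessThan_iff less_Suc_eq by blast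
  qed
  then show ?case by blast
qed simp

lemma greedy_iff: "x \<in> greedy P \<longleftrightarrow> P (greedy P \<inter> {..<x}) x"
  unfolding greedy_below_eq[symmetric] by (simp add: greedy_def)

lemma admissible_restrict:
  "admissible A H c sp (G \<inter> {..<x}) x \<longleftrightarrow> x \<in> A \<and> c < x \<and> (\<forall>r\<in>G. r < x \<longrightarrow> agrees A H r x \<and> sp A H r x)"
  unfolding admissible_def by (intro conj_cong refl) blast

lemma greedy_admissible_iff:
  "x \<in> greedy (admissible A H c sp) \<longleftrightarrow> x \<in> A \<and> c < x \<and>
     (\<forall>r\<in>greedy (admissible A H c sp). r < x \<longrightarrow> agrees A H r x \<and> sp A H r x)"
  by (rule trans[OF greedy_iff]) (rule admissible_restrict)

section \<open>Reading A off from subsets of a greedy set\<close>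

definition after :: "nat set \<Rightarrow> nat \<Rightarrow> nat set \<Rightarrow> nat set" where
  "after E r D = E \<union> {z\<in>D. r < z}"

definition entry_time :: "nat \<Rightarrow> nat \<Rightarrow> nat set \<Rightarrow> nat" where
  "entry_time e n D = (LEAST t. n \<in> enum_stage e t D)"

text \<open>
  \<open>decode_finite\<close> and \<open>decode_infinite\<close> are the reductions of \<open>A\<close> to \<open>D\<close> in the cases where all columns
  \<open>{m. H F e n m}\<close> with \<open>n \<in> A\<close> are finite, respectively where the column of \<open>n0\<close> is infinite and
  enumerates \<open>A\<close> with index \<open>e'\<close>.
\<close>

definition decode_finite :: "nat set \<Rightarrow> nat \<Rightarrow> nat set \<Rightarrow> nat set" where
  "decode_finite F e D = {n. let y = least_above D (Suc (least_above D n)); E = after F y D in n \<in> enum_stage e (entry_time e y E) E}"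

definition column :: "nat set \<Rightarrow> nat \<Rightarrow> nat \<Rightarrow> nat set \<Rightarrow> nat set" where
  "column F e n0 D = {m. let E = after F (least_above D m) D in m \<in> enum_stage e (entry_time e n0 E) E}"

definition decode_infinite :: "nat set \<Rightarrow> nat \<Rightarrow> nat \<Rightarrow> nat \<Rightarrow> nat set \<Rightarrow> nat set" where
  "decode_infinite F e n0 e' D = {n. n \<in> enum_stage e' (least_above D (Suc (least_above D n))) (column F e n0 D)}"

text \<open>The properties shared by all members of the class, including those whose relation does
  not stem from a homogeneous set.\<close>

locale chain =
  fixes A R :: "nat set" and H
  assumes typed: "\<And>D. D \<in> infinite_subsets A \<Longrightarrow> \<exists>s. typed A s D"
    and coh: "coherent A H"
    and R: "R \<in> infinite_subsets A"
    and agr: "\<And>r x. r \<in> R \<Longrightarrow> x \<in> R \<Longrightarrow> r < x \<Longrightarrow> agrees A H r x"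
begin

text \<open>Elements of D are adjoined in increasing order. Each of them agrees with the largest one
  before it, or with r if there is none, and this bound covers the set built so far as well as e, n
  and m.\<close>

lemma chain_const:
  assumes "r \<in> R" "E \<subseteq> A \<inter> {..r}" "e \<le> r" "n \<le> r" "m \<le> r" "D \<subseteq> R \<inter> {r<..}"
  shows "H (E \<union> (D \<inter> {..<z})) e n m = H E e n m"
proof (induction z)
  case (Suc z)
  show ?case
  proof (cases "z \<in> D")
    case True
    let ?F = "insert r (D \<inter> {..<z})"
    have "finite ?F" by simp
    then have M: "Max ?F \<in> ?F" "\<And>x. x \<in> ?F \<Longrightarrow> x \<le> Max ?F" by (rule Max_in, blast, rule Max_ge)
    let ?k = "Max ?F"
    have k: "?k \<in> R" "?k < z" "r \<le> ?k" using M(1) M(2)[of r] assms(1,6) True by (auto simp del: Max_insert)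
    have "E \<union> (D \<inter> {..<z}) \<subseteq> A \<inter> {..?k}"
    proof
      fix x assume "x \<in> E \<union> (D \<inter> {..<z})"
      then show "x \<in> A \<inter> {..?k}"
      proof
        assume "x \<in> E"
        then have "x \<in> A" "x \<le> r" using assms(2) by auto
        then show ?thesis using le_trans[OF _ k(3)] by blast
      next
        assume x: "x \<in> D \<inter> {..<z}"
        then have "x \<in> A" using assms(6) R by (auto simp: infinite_subsets_iff)
        moreover have "x \<le> ?k" using x by (intro M(2)) simp
        ultimately show ?thesis by blast
      qed
    qed
    moreover have "agrees A H ?k z" using agr k assms(6) True by blast
    ultimately have "H (E \<union> (D \<inter> {..<z})) e n m \<longleftrightarrow> H (insert z (E \<union> (D \<inter> {..<z}))) e n m"
      using assms(3-5) k(3) unfolding agrees_def by (meson le_trans)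
    moreover have "insert z (E \<union> (D \<inter> {..<z})) = E \<union> (D \<inter> {..<Suc z})" using True by (auto simp: less_Suc_eq)
    ultimately show ?thesis using Suc by simp
  next
    case False
    then have "D \<inter> {..<Suc z} = D \<inter> {..<z}" by (auto simp: less_Suc_eq)
    then show ?thesis using Suc by simp
  qed
qed simp

text \<open>By continuity a finite part of \<open>E \<union> D\<close> is already typed. There
  coherence equates H with the true colour, and \<open>chain_const\<close> carries the value back to
  E.\<close>

lemma chain_follows:
  assumes "r \<in> R" "E \<subseteq> A \<inter> {..r}" "e \<le> r" "n \<le> r" "m \<le> r" "D \<in> infinite_subsets (R \<inter> {r<..})"
  shows "H E e n m \<longleftrightarrow> follows A e n m (E \<union> D)"
proof -
  have D: "infinite D" "D \<subseteq> R \<inter> {r<..}" using assms(6) by (auto simp: infinite_subsets_iff)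
  then have "E \<union> D \<in> infinite_subsets A" using assms(2) R by (auto simp: infinite_subsets_iff)
  then obtain s where s: "typed A s (E \<union> D)" using typed by blast
  let ?z = "least_above D s"
  let ?E = "E \<union> (D \<inter> {..<Suc ?z})"
  have z: "?z \<in> D" "s \<le> ?z" by (rule least_above[OF D(1)])+
  have r: "r < ?z" using z(1) D(2) by auto
  have i: "(E \<union> D) \<inter> {..<s} = ?E \<inter> {..<s}" using z(2) by auto
  have fin: "finite ?E" using assms(2) finite_subset by auto
  have sub: "?E \<subseteq> A" using assms(2) D(2) R by (auto simp: infinite_subsets_iff)
  have "typed A s ?E" using s typed_cong[OF i] by simp
  then have "H ?E e n m \<longleftrightarrow> follows A e n m ?E"
    using coh fin sub z unfolding coherent_def by (metis (lifting) IntI UnI2 lessThan_iff lessI)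
  then show ?thesis using chain_const[OF assms(1-5) D(2)] follows_cong[OF s i] by simp
qed

text \<open>Computes H from A and D. The sum bounds e, n, m and, since x < 2^x, every element of E,
  so \<open>chain_follows\<close> applies with the first element of D at or above it.\<close>

lemma chain_code:
  assumes D: "D \<in> infinite_subsets R" and E: "finite E"
  shows "H E e n m \<longleftrightarrow> E \<subseteq> A \<and> follows A e n m (after E (least_above D (set_encode E + e + n + m)) D)"
proof (cases "E \<subseteq> A")
  case True
  let ?r = "least_above D (set_encode E + e + n + m)"
  have inf: "infinite D" "D \<subseteq> R" using D by (auto simp: infinite_subsets_iff)
  have r: "?r \<in> D" "set_encode E + e + n + m \<le> ?r" by (rule least_above[OF inf(1)])+
  have "x \<le> set_encode E" if "x \<in> E" for x
  proof -
    have "2 ^ x \<le> set_encode E" unfolding set_encode_def using that E by (intro member_le_sum) auto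
    then show ?thesis using less_exp[of x] by linarith
  qed
  then have "E \<subseteq> A \<inter> {..?r}" using True r(2) by force
  moreover have "{z\<in>D. ?r < z} \<in> infinite_subsets (R \<inter> {?r<..})"
  proof -
    have "D \<subseteq> {..?r} \<union> {z\<in>D. ?r < z}" by auto
    then have "infinite {z\<in>D. ?r < z}" using inf(1) finite_subset by blast
    then show ?thesis using inf(2) by (auto simp: infinite_subsets_iff)
  qed
  ultimately show ?thesis unfolding after_def using True r inf(2) by (subst chain_follows[of ?r]) auto
next
  case False
  moreover have "\<not> H E e n m" using coh E False unfolding coherent_def by blast
  ultimately show ?thesis by simp
qed

end

text \<open>F0 decides the type e0. As F0 has at most one element at or above e0, the second such
  element of \<open>after F0 r D\<close> lies in the tail.\<close>

locale rooted = chain +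
  fixes c :: nat and F0 e0
  assumes c: "\<And>x. x \<in> R \<Longrightarrow> c < x"
    and F0: "F0 \<subseteq> A \<inter> {..c}" and e0: "e0 \<le> c"
    and single: "u \<in> F0 \<Longrightarrow> v \<in> F0 \<Longrightarrow> e0 \<le> u \<Longrightarrow> e0 \<le> v \<Longrightarrow> u = v"
    and root: "H F0 e0 0 0"
begin

context
  fixes r D E
  assumes r: "r \<in> R" and D: "D \<in> infinite_subsets R" and E: "E = after F0 r D"
begin

lemma after_follows: "n \<le> r \<Longrightarrow> m \<le> r \<Longrightarrow> H F0 e0 n m \<longleftrightarrow> follows A e0 n m E"
proof -
  assume "n \<le> r" "m \<le> r"
  moreover have "infinite D" "D \<subseteq> R" using D by (auto simp: infinite_subsets_iff)
  then have "{z\<in>D. r < z} \<in> infinite_subsets (R \<inter> {r<..})"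
  proof -
    have "D \<subseteq> {..r} \<union> {z\<in>D. r < z}" by auto
    then have "infinite {z\<in>D. r < z}" using \<open>infinite D\<close> finite_subset by blast
    then show ?thesis using \<open>D \<subseteq> R\<close> by (auto simp: infinite_subsets_iff)
  qed
  moreover have "F0 \<subseteq> A \<inter> {..r}" "e0 \<le> r" using F0 e0 c[OF r] by auto
  ultimately show ?thesis unfolding E after_def using r by (intro chain_follows) auto
qed

lemma after_H:
  assumes "n \<le> r" "m \<le> r"
  shows "H F0 e0 n m \<longleftrightarrow> (\<forall>t\<le>type_stage A E. n \<in> enum_stage e0 t E \<longrightarrow> m \<in> enum_stage e0 t E)"
  using after_follows[OF assms] after_follows[of 0 0] root follows_at_root[of A "type_stage A E" e0 n m E] by (simp add: follows_def)

lemma after_type_at: "type_at A e0 (type_stage A E) E"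
  using after_follows[of 0 0] root by (simp add: follows_def follows_at_def)

lemma after_sound: "n \<in> enum_stage e0 (type_stage A E) E \<Longrightarrow> n \<in> A"
  using after_type_at enum_stage_less[of n] unfolding type_at_def by blast

text \<open>The second element of E at or above e0 is outside F0 and so exceeds r; by definition of
  the type, all elements of A below it are present at the type stage.\<close>

lemma after_early: assumes "n \<in> A" "n \<le> r" shows "n \<in> enum_stage e0 (type_stage A E) E"
proof -
  obtain y where y: "second_above y e0 E" "\<forall>n<y. n \<in> A \<longrightarrow> n \<in> enum_stage e0 (type_stage A E) E" using after_type_at unfolding type_at_def by blast
  then obtain u where u: "y \<in> E" "u < y" "u \<in> E" "e0 \<le> u" unfolding second_above_def by blast
  have "y \<notin> F0"
  proof
    assume "y \<in> F0"
    then have "u \<in> F0" using u F0 c[OF r] unfolding E after_def by auto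
    then show False using single[of u y] u \<open>y \<in> F0\<close> by simp
  qed
  then have "r < y" using u(1) unfolding E after_def by blast
  then show ?thesis using y(2) assms by simp
qed

lemma after_entry_time:
  assumes "n \<in> A" "n \<le> r"
  shows "n \<in> enum_stage e0 (entry_time e0 n E) E" "entry_time e0 n E \<le> type_stage A E"
  unfolding entry_time_def using after_early[OF assms] by (rule LeastI, rule Least_le)

text \<open>H compares n and m up to the type stage, whose definition refers to A. Since n is
  enumerated by then, comparing at the entry time of n gives the same answer, and this can be
  computed from D alone.\<close>

lemma after_H_entry_time:
  assumes "n \<in> A" "n \<le> r" "m \<le> r"
  shows "H F0 e0 n m \<longleftrightarrow> m \<in> enum_stage e0 (entry_time e0 n E) E"
proof
  assume "H F0 e0 n m"
  then show "m \<in> enum_stage e0 (entry_time e0 n E) E" using after_H[OF assms(2,3)] after_entry_time[OF assms(1,2)] by blast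
next
  assume m: "m \<in> enum_stage e0 (entry_time e0 n E) E"
  have "m \<in> enum_stage e0 t E" if "n \<in> enum_stage e0 t E" for t
  proof -
    have "entry_time e0 n E \<le> t" unfolding entry_time_def using that by (rule Least_le)
    then show ?thesis using enum_stage_mono m by blast
  qed
  then show "H F0 e0 n m" using after_H[OF assms(2,3)] by blast
qed

end

text \<open>Let d < y be the first two elements of D from n on. For n in A, spacing puts y outside
  the column of n, so n enters before y. Conversely y enters by the type stage, up to which only
  elements of A appear. Hence the entry time of y decides whether n is in A.\<close>

lemma decode_finite:
  assumes D: "D \<in> infinite_subsets R"
    and sp: "\<And>r x n. r \<in> R \<Longrightarrow> x \<in> R \<Longrightarrow> r < x \<Longrightarrow> n \<le> r \<Longrightarrow> n \<in> A \<Longrightarrow> \<not> H F0 e0 n x"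
  shows "decode_finite F0 e0 D = A"
proof -
  have "n \<in> decode_finite F0 e0 D \<longleftrightarrow> n \<in> A" for n
  proof -
    let ?d = "least_above D n" and ?y = "least_above D (Suc (least_above D n))"
    let ?E = "after F0 ?y D"
    have inf: "infinite D" "D \<subseteq> R" using D by (auto simp: infinite_subsets_iff)
    have d: "?d \<in> R" "n \<le> ?d" "?y \<in> R" "?d < ?y" using least_above[OF inf(1)] least_above_greater[OF inf(1)] inf(2) by auto
    have yA: "?y \<in> A" using d(3) R by (auto simp: infinite_subsets_iff)
    note ey = after_entry_time[OF d(3) D refl yA order_refl]
    have "n \<in> enum_stage e0 (entry_time e0 ?y ?E) ?E \<longleftrightarrow> n \<in> A"
    proof
      assume "n \<in> enum_stage e0 (entry_time e0 ?y ?E) ?E"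
      then have "n \<in> enum_stage e0 (type_stage A ?E) ?E" using enum_stage_mono[OF ey(2)] by blast
      then show "n \<in> A" by (rule after_sound[OF d(3) D refl])
    next
      assume n: "n \<in> A"
      have ny: "n \<le> ?y" using d by simp
      have "?y \<notin> enum_stage e0 (entry_time e0 n ?E) ?E"
        using sp[OF d(1,3,4,2) n] after_H_entry_time[OF d(3) D refl n ny order_refl] by simp
      then have "\<not> entry_time e0 ?y ?E \<le> entry_time e0 n ?E" using ey(1) enum_stage_mono by blast
      then have "entry_time e0 n ?E \<le> entry_time e0 ?y ?E" by simp
      then show "n \<in> enum_stage e0 (entry_time e0 ?y ?E) ?E" using after_entry_time(1)[OF d(3) D refl n ny] enum_stage_mono by blast
    qed
    then show ?thesis by (simp add: decode_finite_def Let_def)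
  qed
  then show ?thesis by blast
qed

text \<open>To decide m, the tail beyond an element r of D with r \<ge> m is used; n0 \<le> c < r
  takes care of the other argument.\<close>

lemma column:
  assumes D: "D \<in> infinite_subsets R" and n0: "n0 \<in> A" "n0 \<le> c"
  shows "column F0 e0 n0 D = {m. H F0 e0 n0 m}"
proof -
  have "m \<in> column F0 e0 n0 D \<longleftrightarrow> H F0 e0 n0 m" for m
  proof -
    have inf: "infinite D" "D \<subseteq> R" using D by (auto simp: infinite_subsets_iff)
    have d: "least_above D m \<in> R" "m \<le> least_above D m" using least_above[OF inf(1)] inf(2) by auto
    then show ?thesis using after_H_entry_time[OF d(1) D refl n0(1) _ d(2)] n0(2) c[OF d(1)] by (simp add: column_def Let_def)
  qed
  then show ?thesis by blast
qed

text \<open>The column is obtained from D alone. For r < x in R, spacing makes x a stage by which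
  \<open>e'\<close> has enumerated from the column all elements of A up to r.\<close>

lemma decode_infinite:
  assumes D: "D \<in> infinite_subsets R" and n0: "n0 \<in> A" "n0 \<le> c"
    and sub: "\<And>x. enum_stage e' x {m. H F0 e0 n0 m} \<subseteq> A"
    and sp: "\<And>r x n. r \<in> R \<Longrightarrow> x \<in> R \<Longrightarrow> r < x \<Longrightarrow> n \<le> r \<Longrightarrow> n \<in> A \<Longrightarrow> n \<in> enum_stage e' x {m. H F0 e0 n0 m}"
  shows "decode_infinite F0 e0 n0 e' D = A"
proof -
  have inf: "infinite D" "D \<subseteq> R" using D by (auto simp: infinite_subsets_iff)
  have "n \<in> enum_stage e' (least_above D (Suc (least_above D n))) {m. H F0 e0 n0 m}" if "n \<in> A" for n
    by (rule sp[of "least_above D n"]) (use least_above[OF inf(1)] least_above_greater[OF inf(1)] inf(2) that in auto)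
  then show ?thesis unfolding decode_infinite_def column[OF D n0] using sub by blast
qed

text \<open>What is enumerated no later than n is enumerated by the type stage, and up to there only
  elements of A appear.\<close>

lemma section_subset:
  assumes "n \<in> A" "H F0 e0 n m" shows "m \<in> A"
proof -
  have inf: "infinite R" and RR: "R \<in> infinite_subsets R" using R by (auto simp: infinite_subsets_iff)
  let ?r = "least_above R (n + m)"
  have r: "?r \<in> R" "n + m \<le> ?r" by (rule least_above[OF inf])+
  have n: "n \<le> ?r" and m: "m \<le> ?r" using r(2) by auto
  have "m \<in> enum_stage e0 (entry_time e0 n (after F0 ?r R)) (after F0 ?r R)"
    using after_H_entry_time[OF r(1) RR refl assms(1) n m] assms(2) by simp
  then have "m \<in> enum_stage e0 (type_stage A (after F0 ?r R)) (after F0 ?r R)"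
    using enum_stage_mono[OF after_entry_time(2)[OF r(1) RR refl assms(1) n]] by blast
  then show ?thesis by (rule after_sound[OF r(1) RR refl])
qed

end

section \<open>Computability of the construction\<close>

abbreviation closed_cset :: "nat set set \<Rightarrow> (nat set \<Rightarrow> nat set) \<Rightarrow> bool" where
  "closed_cset \<D> S \<equiv> cset \<D> 0 (\<lambda>D xs. S D)"

lemma closed_cset: assumes "closed_cset \<D> S" shows "cset \<D> k (\<lambda>D xs. S D)"
  unfolding cset_def
  by (rule cfun_app1[of _ "\<lambda>D y. of_bool (y \<in> S D)"]) (use assms in \<open>auto simp: cset_def intro!: cfun_nth\<close>)

definition crel :: "nat set set \<Rightarrow> (nat set \<Rightarrow> nat set \<Rightarrow> nat \<Rightarrow> nat \<Rightarrow> nat \<Rightarrow> bool) \<Rightarrow> bool" where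
  "crel \<D> H \<longleftrightarrow> cpred \<D> 4 (\<lambda>D xs. H D (set_decode (xs ! 0)) (xs ! 1) (xs ! 2) (xs ! 3))"

lemma cpred_rel:
  assumes "crel \<D> H" "cfun \<D> k W" "cfun \<D> k E" "cfun \<D> k N" "cfun \<D> k M"
  shows "cpred \<D> k (\<lambda>D xs. H D (set_decode (W D xs)) (E D xs) (N D xs) (M D xs))"
  using cfun_subst[OF assms(1)[unfolded crel_def], of "[W, E, N, M]"] assms(2-5)
  by (auto simp: numeral_2_eq_2 numeral_3_eq_3)

lemma cpred_second_above:
  assumes "cset \<D> k S" "cfun \<D> k Y" "cfun \<D> k E"
  shows "cpred \<D> k (\<lambda>D xs. second_above (Y D xs) (E D xs) (S D xs))"
  unfolding second_above_def by (intro cfun_rules cset_weak cfun_weak cfun_nth assms; simp)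

lemma cpred_type_at:
  assumes "cset \<D> k A" "cset \<D> k S" "cfun \<D> k E" "cfun \<D> k F"
  shows "cpred \<D> k (\<lambda>D xs. type_at (A D xs) (E D xs) (F D xs) (S D xs))"
  unfolding type_at_def by (intro cfun_rules cpred_second_above cset_enum_stage cset_weak cfun_weak cfun_nth assms; simp)

lemma cpred_typed:
  assumes "cset \<D> k A" "cset \<D> k S" "cfun \<D> k F"
  shows "cpred \<D> k (\<lambda>D xs. typed (A D xs) (F D xs) (S D xs))"
  unfolding typed_def by (intro cfun_rules cpred_type_at cset_weak cfun_weak cfun_nth assms; simp)

lemma cpred_follows_at:
  assumes "cset \<D> k A" "cset \<D> k S" "cfun \<D> k F" "cfun \<D> k E" "cfun \<D> k N" "cfun \<D> k M"
  shows "cpred \<D> k (\<lambda>D xs. follows_at (A D xs) (F D xs) (E D xs) (N D xs) (M D xs) (S D xs))"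
  unfolding follows_at_def by (intro cfun_rules cpred_type_at cset_enum_stage cset_weak cfun_weak cfun_nth assms; simp)

lemma cpred_follows:
  assumes "cset \<D> k A" "cset \<D> k S" "cfun \<D> k E" "cfun \<D> k N" "cfun \<D> k M" "cpred \<D> k G"
    and ex: "\<And>D xs. D \<in> \<D> \<Longrightarrow> length xs = k \<Longrightarrow> G D xs \<Longrightarrow> \<exists>s. typed (A D xs) s (S D xs)"
  shows "cpred \<D> k (\<lambda>D xs. G D xs \<and> follows (A D xs) (E D xs) (N D xs) (M D xs) (S D xs))"
proof -
  \<comment> \<open>Where the guard G fails, the search succeeds at once with 0, so it is total; the
    conjunct G then discards the meaningless value.\<close>
  have "cfun \<D> k (\<lambda>D xs. LEAST s. G D xs \<longrightarrow> typed (A D xs) s (S D xs))"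
    using ex by (intro cfun_mu cfun_rules cpred_typed cset_weak cfun_weak cfun_nth assms) auto
  then have "cpred \<D> k (\<lambda>D xs. G D xs \<and> follows_at (A D xs) (LEAST s. G D xs \<longrightarrow> typed (A D xs) s (S D xs)) (E D xs) (N D xs) (M D xs) (S D xs))"
    by (intro cpred_conj cpred_follows_at assms)
  then show ?thesis
    by (rule cfun_cong) (auto simp: follows_def type_stage_def)
qed

section \<open>Finite sets as numbers, and decidability of the greedy sets\<close>

lemma set_decode_less: "x \<in> set_decode w \<Longrightarrow> 2 ^ x \<le> w"
proof (rule ccontr)
  assume "x \<in> set_decode w" "\<not> 2 ^ x \<le> w"
  then show False by (simp add: set_decode_def)
qed

lemma set_decode_subset_iff: "set_decode w \<subseteq> A \<longleftrightarrow> (\<forall>x<w. x \<in> set_decode w \<longrightarrow> x \<in> A)"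
proof -
  have "x < w" if "x \<in> set_decode w" for x using set_decode_less[OF that] less_exp[of x] by linarith
  then show ?thesis by blast
qed

lemma set_decode_ball_iff: "(\<forall>z\<in>set_decode w. P z) \<longleftrightarrow> (\<forall>z<w. z \<in> set_decode w \<longrightarrow> P z)"
  using set_decode_subset_iff[of w "{z. P z}"] by blast

lemma cpred_subset:
  assumes "cset \<D> k A" "cfun \<D> k W" shows "cpred \<D> k (\<lambda>D xs. set_decode (W D xs) \<subseteq> A D xs)"
  unfolding set_decode_subset_iff by (intro cfun_rules cset_weak cfun_weak cfun_nth assms; simp)

lemma set_decode_atMost_iff: "set_decode w \<subseteq> {..r} \<longleftrightarrow> w < 2 ^ Suc r"
proof
  assume s: "set_decode w \<subseteq> {..r}"
  have "w = set_encode (set_decode w)" by simp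
  also have "\<dots> \<le> (\<Sum>i\<le>r. 2 ^ i)" unfolding set_encode_def using s by (intro sum_mono2) auto
  also have "\<dots> < 2 ^ Suc r" by (induction r) auto
  finally show "w < 2 ^ Suc r" .
next
  assume w: "w < 2 ^ Suc r"
  have "x \<le> r" if "x \<in> set_decode w" for x
  proof -
    have "(2::nat) ^ x < 2 ^ Suc r" using set_decode_less[OF that] w by simp
    then have "x < Suc r" by (rule power_less_imp_less_exp[rotated]) simp
    then show ?thesis by simp
  qed
  then show "set_decode w \<subseteq> {..r}" by auto
qed

lemma all_finite_iff: "(\<forall>E. finite E \<longrightarrow> P E) \<longleftrightarrow> (\<forall>w. P (set_decode w))"
proof
  assume "\<forall>w. P (set_decode w)"
  then show "\<forall>E. finite E \<longrightarrow> P E" by (metis set_encode_inverse)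
qed simp

text \<open>Subsets of \<open>{..r}\<close> are those with codes below 2^(r+1), and adjoining x > r
  adds 2^x to the code; agreement is thus a bounded condition.\<close>

lemma agrees_code:
  assumes "r < x"
  shows "agrees A H r x \<longleftrightarrow> (\<forall>w<2 ^ Suc r. set_decode w \<subseteq> A \<longrightarrow> (\<forall>e\<le>r. \<forall>n\<le>r. \<forall>m\<le>r.
    H (set_decode w) e n m \<longleftrightarrow> H (set_decode (2 ^ x + w)) e n m))"
proof -
  have *: "E \<subseteq> A \<inter> {..r} \<longleftrightarrow> finite E \<and> E \<subseteq> {..r} \<and> E \<subseteq> A" for E
    by (auto intro: finite_subset[of _ "{..r}"])
  have "agrees A H r x \<longleftrightarrow> (\<forall>E. finite E \<longrightarrow> E \<subseteq> {..r} \<longrightarrow> E \<subseteq> A \<longrightarrow>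
    (\<forall>e\<le>r. \<forall>n\<le>r. \<forall>m\<le>r. H E e n m \<longleftrightarrow> H (insert x E) e n m))"
    unfolding agrees_def * imp_conjL ..
  also have "\<dots> \<longleftrightarrow> (\<forall>w. w < 2 ^ Suc r \<longrightarrow> set_decode w \<subseteq> A \<longrightarrow> (\<forall>e\<le>r. \<forall>n\<le>r. \<forall>m\<le>r.
    H (set_decode w) e n m \<longleftrightarrow> H (insert x (set_decode w)) e n m))"
    unfolding all_finite_iff set_decode_atMost_iff ..
  also have "insert x (set_decode w) = set_decode (2 ^ x + w)" if "w < 2 ^ Suc r" for w
  proof -
    have "x \<notin> set_decode w" using that assms unfolding set_decode_atMost_iff[symmetric] by auto
    then show ?thesis by (simp add: set_decode_plus_power_2)
  qed
  then have "(\<forall>w. w < 2 ^ Suc r \<longrightarrow> set_decode w \<subseteq> A \<longrightarrow> (\<forall>e\<le>r. \<forall>n\<le>r. \<forall>m\<le>r.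
    H (set_decode w) e n m \<longleftrightarrow> H (insert x (set_decode w)) e n m)) \<longleftrightarrow>
    (\<forall>w. w < 2 ^ Suc r \<longrightarrow> set_decode w \<subseteq> A \<longrightarrow> (\<forall>e\<le>r. \<forall>n\<le>r. \<forall>m\<le>r.
    H (set_decode w) e n m \<longleftrightarrow> H (set_decode (2 ^ x + w)) e n m))"
    by (intro all_cong imp_cong refl) simp
  finally show ?thesis .
qed

text \<open>Primitive recursion on the code of the part chosen so far; accepting m adds
  \<open>2 ^ m\<close>.\<close>

lemma cset_greedy:
  assumes "cpred \<D> 2 (\<lambda>D xs. P D (set_decode (xs ! 0)) (xs ! 1))"
  shows "closed_cset \<D> (\<lambda>D. greedy (P D))"
proof -
  have P: "cpred \<D> k (\<lambda>D xs. P D (set_decode (F D xs)) (G D xs))" if "cfun \<D> k F" "cfun \<D> k G" for k F G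
    using cfun_app2[of \<D> "\<lambda>D w x. of_bool (P D (set_decode w) x)", OF assms that] .
  have fin: "finite (greedy_below P x)" for P x by (induction x) auto
  have gr: "set_encode (greedy_below P (Suc m)) = set_encode (greedy_below P m) + of_bool (P (greedy_below P m) m) * 2 ^ m" for P m
  proof -
    have "m \<notin> greedy_below P m" by (simp add: greedy_below_eq)
    moreover have "greedy_below P (Suc m) = (if P (greedy_below P m) m then insert m (greedy_below P m) else greedy_below P m)" by auto
    ultimately show ?thesis using fin[of P m] by (simp del: greedy_below.simps)
  qed
  have "cfun \<D> 1 (\<lambda>D xs. set_encode (greedy_below (P D) (xs ! 0)))"
  proof (rule cfun_rec'[where h="\<lambda>D n xs. set_encode (greedy_below (P D) n)" and F="\<lambda>_ _. 0"
        and G="\<lambda>D m r xs. r + of_bool (P D (set_decode r) m) * 2 ^ m"])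
    show "cfun \<D> (Suc (Suc 1)) (\<lambda>D ys. ys ! 1 + of_bool (P D (set_decode (ys ! 1)) (ys ! 0)) * 2 ^ (ys ! 0))"
      by (intro cfun_add cfun_mult cfun_pow2 P cfun_nth) auto
    show "set_encode (greedy_below (P D) (Suc m)) = set_encode (greedy_below (P D) m) +
      of_bool (P D (set_decode (set_encode (greedy_below (P D) m))) m) * 2 ^ m" for D m
      unfolding gr using fin by (simp add: set_encode_inverse)
  qed (auto intro!: cfun_0 cfun_nth)
  then have "cpred \<D> 1 (\<lambda>D xs. P D (set_decode (set_encode (greedy_below (P D) (xs ! 0)))) (xs ! 0))"
    by (intro P cfun_nth) auto
  then show ?thesis unfolding cset_def greedy_def using fin by (simp add: set_encode_inverse)
qed

lemma cset_greedy_admissible: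
  assumes A: "closed_cset \<D> A" and H: "crel \<D> H"
    and sp: "cpred \<D> 2 (\<lambda>D xs. sp (A D) (H D) (xs ! 0) (xs ! 1))"
  shows "closed_cset \<D> (\<lambda>D. greedy (admissible (A D) (H D) c sp))"
proof (rule cset_greedy)
  have sp': "cpred \<D> k (\<lambda>D xs. sp (A D) (H D) (F D xs) (G D xs))" if "cfun \<D> k F" "cfun \<D> k G" for k F G
    using cfun_app2[of \<D> "\<lambda>D r x. of_bool (sp (A D) (H D) r x)", OF sp that] .
  have admissible: "admissible A H c sp F x \<longleftrightarrow> x \<in> A \<and> c < x \<and> (\<forall>r<x. r \<in> F \<longrightarrow>
    (\<forall>w<2 ^ Suc r. set_decode w \<subseteq> A \<longrightarrow> (\<forall>e\<le>r. \<forall>n\<le>r. \<forall>m\<le>r.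
      H (set_decode w) e n m \<longleftrightarrow> H (set_decode (2 ^ x + w)) e n m)) \<and> sp A H r x)" for A H F x
    unfolding admissible_def using agrees_code by (simp cong: conj_cong imp_cong)
  show "cpred \<D> 2 (\<lambda>D xs. admissible (A D) (H D) c sp (set_decode (xs ! 0)) (xs ! 1))"
    unfolding admissible
    by (intro cfun_rules sp' cpred_rel[OF H] cpred_subset closed_cset[OF A] cset_weak cfun_weak cfun_nth; simp)
qed

section \<open>Computability of the decoding procedures\<close>

lemma cset_after:
  assumes "cset \<D> k E" "cset \<D> k S" "cfun \<D> k F"
  shows "cset \<D> k (\<lambda>D xs. after (E D xs) (F D xs) (S D xs))"
  unfolding after_def cset_def Un_iff mem_Collect_eq
  by (intro cfun_rules cset_weak cfun_weak cfun_nth assms; simp)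

lemma cfun_least_above:
  assumes "cset \<D> k S" "cfun \<D> k F" "\<And>D xs. D \<in> \<D> \<Longrightarrow> length xs = k \<Longrightarrow> infinite (S D xs)"
  shows "cfun \<D> k (\<lambda>D xs. least_above (S D xs) (F D xs))"
  unfolding least_above_def using least_above_exists[OF assms(3)]
  by (intro cfun_mu cfun_rules cset_weak cfun_weak cfun_nth assms) auto

lemma cfun_entry_time:
  assumes "cset \<D> k S" "cfun \<D> k E" "cfun \<D> k N"
    and "\<And>D xs. D \<in> \<D> \<Longrightarrow> length xs = k \<Longrightarrow> \<exists>t. N D xs \<in> enum_stage (E D xs) t (S D xs)"
  shows "cfun \<D> k (\<lambda>D xs. entry_time (E D xs) (N D xs) (S D xs))"
  unfolding entry_time_def using assms(4)
  by (intro cfun_mu cfun_rules cset_enum_stage cset_weak cfun_weak cfun_nth assms) auto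

lemma cset_finite: "finite F \<Longrightarrow> cset \<D> k (\<lambda>D xs. F)"
  using cset_set_decode[OF cfun_const[of \<D> k "set_encode F"]] by (simp add: set_encode_inverse)

context
  fixes \<D> :: "nat set set" and F0 :: "nat set" and e0 :: nat
  assumes inf: "\<And>D. D \<in> \<D> \<Longrightarrow> infinite D" and F0: "finite F0"
begin

lemma cfun_least_above_oracle: "cfun \<D> k F \<Longrightarrow> cfun \<D> k (\<lambda>D xs. least_above D (F D xs))"
  by (rule cfun_least_above[OF cset_oracle]) (use inf in auto)

lemma cset_decode_finite:
  assumes "\<And>D n. D \<in> \<D> \<Longrightarrow> n \<in> D \<Longrightarrow> \<exists>t. n \<in> enum_stage e0 t (after F0 n D)"
  shows "closed_cset \<D> (decode_finite F0 e0)"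
  unfolding decode_finite_def Let_def using assms least_above(1)[OF inf]
  by (intro csetI cpred_mem cset_enum_stage cset_after cfun_entry_time cset_finite F0 cset_oracle cfun_least_above_oracle cfun_Suc cfun_nth cfun_const) auto

lemma cset_column:
  assumes "\<And>D r. D \<in> \<D> \<Longrightarrow> r \<in> D \<Longrightarrow> \<exists>t. n0 \<in> enum_stage e0 t (after F0 r D)"
  shows "closed_cset \<D> (column F0 e0 n0)"
  unfolding column_def Let_def using assms least_above(1)[OF inf]
  by (intro csetI cpred_mem cset_enum_stage cset_after cfun_entry_time cset_finite F0 cset_oracle cfun_least_above_oracle cfun_Suc cfun_nth cfun_const) auto

lemma cset_decode_infinite:
  assumes "\<And>D r. D \<in> \<D> \<Longrightarrow> r \<in> D \<Longrightarrow> \<exists>t. n0 \<in> enum_stage e0 t (after F0 r D)"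
  shows "closed_cset \<D> (decode_infinite F0 e0 n0 e')"
  unfolding decode_infinite_def
  by (intro csetI cpred_mem cset_enum_stage closed_cset[OF cset_column] assms cset_oracle cfun_least_above_oracle cfun_Suc cfun_nth cfun_const) auto

end

section \<open>Coherence as a universal condition\<close>

definition follows_typed :: "nat set \<Rightarrow> nat \<Rightarrow> nat \<Rightarrow> nat \<Rightarrow> nat \<Rightarrow> nat set \<Rightarrow> bool" where
  "follows_typed A s e n m D \<longleftrightarrow> typed A s D \<and> follows A e n m D"

text \<open>The conjunct \<open>typed A s D\<close> guards the search for the type stage. In
  \<open>coherent\<close> it is a premise already, so it can be inserted there, and the matrix of
  coherence becomes decidable for every oracle.\<close>

lemma cpred_follows_typed:
  assumes "cset \<D> k A" "cset \<D> k S" "cfun \<D> k F" "cfun \<D> k E" "cfun \<D> k N" "cfun \<D> k M"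
  shows "cpred \<D> k (\<lambda>D xs. follows_typed (A D xs) (F D xs) (E D xs) (N D xs) (M D xs) (S D xs))"
  unfolding follows_typed_def by (intro cpred_follows cpred_typed assms) blast

text \<open>Merges four number quantifiers into one, which turns coherence into a single universal
  quantifier over a decidable matrix.\<close>

lemma all_bounded_iff: "(\<forall>w e n m. P w e n m) \<longleftrightarrow> (\<forall>b::nat. \<forall>w<b. \<forall>e<b. \<forall>n<b. \<forall>m<b. P w e n m)"
proof (intro iffI allI)
  fix w e n m assume "\<forall>b::nat. \<forall>w<b. \<forall>e<b. \<forall>n<b. \<forall>m<b. P w e n m"
  from this[THEN spec[of _ "Suc (w + e + n + m)"]] show "P w e n m" by simp
qed simp

lemma coherent_iff:
  "coherent A H \<longleftrightarrow> (\<forall>b. \<forall>w<b. \<forall>e<b. \<forall>n<b. \<forall>m<b.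
     (H (set_decode w) e n m \<longrightarrow> set_decode w \<subseteq> A) \<and>
     (set_decode w \<subseteq> A \<longrightarrow> (\<forall>z<w. z \<in> set_decode w \<longrightarrow> (\<forall>s\<le>z. typed A s (set_decode w) \<longrightarrow>
       (H (set_decode w) e n m \<longleftrightarrow> follows_typed A s e n m (set_decode w))))))"
  (is "_ \<longleftrightarrow> (\<forall>b. \<forall>w<b. \<forall>e<b. \<forall>n<b. \<forall>m<b. ?P w e n m)")
proof -
  have "coherent A H \<longleftrightarrow> (\<forall>E. finite E \<longrightarrow> (\<forall>e n m. (H E e n m \<longrightarrow> E \<subseteq> A) \<and>
     (E \<subseteq> A \<longrightarrow> (\<forall>z\<in>E. \<forall>s\<le>z. typed A s E \<longrightarrow> (H E e n m \<longleftrightarrow> follows A e n m E)))))"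
    unfolding coherent_def by blast
  also have "\<dots> \<longleftrightarrow> (\<forall>w e n m. ?P w e n m)"
    unfolding all_finite_iff set_decode_ball_iff follows_typed_def by (simp cong: imp_cong)
  also have "\<dots> \<longleftrightarrow> (\<forall>b. \<forall>w<b. \<forall>e<b. \<forall>n<b. \<forall>m<b. ?P w e n m)"
    by (rule all_bounded_iff)
  finally show ?thesis .
qed

lemma cpred_coherent:
  assumes A: "closed_cset \<D> A" and H: "crel \<D> H"
  shows "\<exists>P. cpred \<D> 1 (\<lambda>D xs. P D (xs ! 0)) \<and> (\<forall>D. coherent (A D) (H D) \<longleftrightarrow> (\<forall>x. P D x))"
proof -
  have *: "cpred \<D> 1 (\<lambda>D xs. \<forall>w<xs ! 0. \<forall>e<xs ! 0. \<forall>n<xs ! 0. \<forall>m<xs ! 0.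
     (H D (set_decode w) e n m \<longrightarrow> set_decode w \<subseteq> A D) \<and>
     (set_decode w \<subseteq> A D \<longrightarrow> (\<forall>z<w. z \<in> set_decode w \<longrightarrow> (\<forall>s\<le>z. typed (A D) s (set_decode w) \<longrightarrow>
       (H D (set_decode w) e n m \<longleftrightarrow> follows_typed (A D) s e n m (set_decode w))))))"
    by (intro cfun_rules cpred_rel[OF H] cpred_follows_typed cpred_typed cpred_subset cset_set_decode closed_cset[OF A]
        cset_weak cfun_weak cfun_nth; simp)
  show ?thesis
    by (intro exI conjI allI) (rule *, rule coherent_iff)
qed

section \<open>The class of greedy sets\<close>

text \<open>The function variable supplies both C and the coding of sequences. The formula says that
  f is a coder, that R is infinite, and, by the graphs of two programs with oracle
  \<open>join A C\<close> at the output 1 for truth, that R is the set given by G and that Q always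
  holds.\<close>

lemma Sigma11_join:
  assumes G: "cpred UNIV 1 (\<lambda>J xs. G J (xs ! 0))" and Q: "cpred UNIV 1 (\<lambda>J xs. Q J (xs ! 0))"
  shows "Sigma11_class A {R. \<exists>C. infinite R \<and> (\<forall>x. x \<in> R \<longleftrightarrow> G (join A C) x) \<and> (\<forall>x. Q (join A C) x)}"
proof -
  obtain \<gamma> where g: "\<And>J xs. length xs = 1 \<Longrightarrow> run J \<gamma> xs = Some (of_bool (G J (xs ! 0)))"
    using G unfolding cfun_def by blast
  obtain \<theta> where q: "\<And>J xs. length xs = 1 \<Longrightarrow> run J \<theta> xs = Some (of_bool (Q J (xs ! 0)))"
    using Q unfolding cfun_def by blast
  let ?c = "FAll 0 (FAll 1 (FAll 2 (Ex 3 (Conj (Eq (entry_term (TVar 3) (TVar 1)) (TVar 2))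
    (FAll 4 (FImp (FLt (TVar 4) (TVar 1) 5) (Eq (entry_term (TVar 3) (TVar 4)) (entry_term (TVar 0) (TVar 4)))))))))"
  let ?i = "FAll 0 (Ex 1 (Conj (FLt (TVar 0) (TVar 1) 2) (InR (TVar 1))))"
  let ?g = "graph_form \<gamma> [TVar 0] (TSuc TZero) (Suc 0)"
  let ?r = "FAll 0 (Conj (FImp (InR (TVar 0)) ?g) (FImp ?g (InR (TVar 0))))"
  let ?q = "FAll 0 (graph_form \<theta> [TVar 0] (TSuc TZero) (Suc 0))"
  let ?\<phi> = "Conj ?c (Conj ?i (Conj ?r ?q))"
  have c: "sat R f A ?c e \<longleftrightarrow> coder f" for R f e
    by (simp add: coder_def)
  have i: "sat R f A ?i e \<longleftrightarrow> infinite R" for R f e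
    by (simp add: infinite_nat_iff_unbounded)
  have gs: "sat R f A ?g e \<longleftrightarrow> G (join A (fset f)) (e 0)" if "coder f" for R f e
    using that by (simp add: sat_graph_form g)
  have qs: "sat R f A (graph_form \<theta> [TVar 0] (TSuc TZero) (Suc 0)) e \<longleftrightarrow> Q (join A (fset f)) (e 0)" if "coder f" for R f e
    using that by (simp add: sat_graph_form q)
  have phi: "sat R f A ?\<phi> e \<longleftrightarrow> coder f \<and> infinite R \<and> (\<forall>x. x \<in> R \<longleftrightarrow> G (join A (fset f)) x) \<and> (\<forall>x. Q (join A (fset f)) x)"
    for R f e
  proof (cases "coder f")
    case True
    have "sat R f A ?r e \<longleftrightarrow> (\<forall>x. (x \<in> R \<longrightarrow> G (join A (fset f)) x) \<and> (G (join A (fset f)) x \<longrightarrow> x \<in> R))"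
      by (simp add: gs[OF True])
    also have "\<dots> \<longleftrightarrow> (\<forall>x. x \<in> R \<longleftrightarrow> G (join A (fset f)) x)"
      by (intro arg_cong[of _ _ All] ext) (rule iff_conv_conj_imp[symmetric])
    finally have "sat R f A ?r e \<longleftrightarrow> (\<forall>x. x \<in> R \<longleftrightarrow> G (join A (fset f)) x)" .
    moreover have "sat R f A ?q e \<longleftrightarrow> (\<forall>x. Q (join A (fset f)) x)"
      by (simp add: qs[OF True])
    ultimately show ?thesis unfolding sat.simps(5) c i using True by blast
  next
    case False
    then show ?thesis unfolding sat.simps(5) c by blast
  qed
  show ?thesis unfolding Sigma11_class_def
  proof (intro exI[of _ ?\<phi>] set_eqI)
    fix R
    show "R \<in> {R. \<exists>C. infinite R \<and> (\<forall>x. x \<in> R \<longleftrightarrow> G (join A C) x) \<and> (\<forall>x. Q (join A C) x)} \<longleftrightarrow> R \<in> {R. \<exists>f. sat R f A ?\<phi> (\<lambda>_. 0)}"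
      unfolding mem_Collect_eq phi using coder_exists by metis
  qed
qed

text \<open>Makes the relation a set of numbers that can be quantified in the class; finiteness is
  required because \<open>set_encode\<close> is faithful on finite sets only.\<close>

definition code_rel :: "nat set \<Rightarrow> nat set \<Rightarrow> nat \<Rightarrow> nat \<Rightarrow> nat \<Rightarrow> bool" where
  "code_rel C E e n m \<longleftrightarrow> finite E \<and> prod_encode (set_encode E, prod_encode (e, prod_encode (n, m))) \<in> C"

lemma crel_code: assumes "closed_cset \<D> C" shows "crel \<D> (\<lambda>D. code_rel (C D))"
proof -
  have "cpred \<D> 4 (\<lambda>D xs. prod_encode (xs ! 0, prod_encode (xs ! 1, prod_encode (xs ! 2, xs ! 3))) \<in> C D)"
    by (intro cpred_mem closed_cset[OF assms] cfun_pair cfun_nth) simp_all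
  then show ?thesis unfolding crel_def code_rel_def by simp
qed

definition good where
  "good A c sp chk H R \<longleftrightarrow> infinite R \<and> R = greedy (admissible A H c sp) \<and> coherent A H \<and> (\<forall>x. chk A H x)"

lemma good_subset: assumes "good A c sp chk H R" shows "R \<in> infinite_subsets A"
  using assms unfolding good_def infinite_subsets_iff by (metis greedy_admissible_iff subsetI)

lemma good_chain:
  assumes typed: "\<And>D. D \<in> infinite_subsets A \<Longrightarrow> \<exists>s. typed A s D" and g: "good A c sp chk H R"
  shows "chain A R H"
proof
  show "R \<in> infinite_subsets A" by (rule good_subset[OF g])
  show "coherent A H" using g by (simp add: good_def)
  have R: "R = greedy (admissible A H c sp)" using g by (simp add: good_def)
  show "agrees A H r x" if "r \<in> R" "x \<in> R" "r < x" for r x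
    using greedy_admissible_iff[of x A H c sp] that unfolding R[symmetric] by blast
qed (rule typed)

text \<open>Reduces everything to deciding A from D, the premise \<open>dec\<close>. From A and D
  one recovers the relation by \<open>chain_code\<close>, and then R as its greedy set. The premise
  on \<open>sp\<close> covers arbitrary classes of oracles, since it is used with
  \<open>join A C\<close> for definability and with D for \<open>\<Theta>\<close>.\<close>

theorem Sigma11_class_of_reduction:
  fixes sp :: "nat set \<Rightarrow> (nat set \<Rightarrow> nat \<Rightarrow> nat \<Rightarrow> nat \<Rightarrow> bool) \<Rightarrow> nat \<Rightarrow> nat \<Rightarrow> bool"
    and chk :: "nat set \<Rightarrow> (nat set \<Rightarrow> nat \<Rightarrow> nat \<Rightarrow> nat \<Rightarrow> bool) \<Rightarrow> nat \<Rightarrow> bool"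
  assumes typed: "\<And>D. D \<in> infinite_subsets A \<Longrightarrow> \<exists>s. typed A s D"
    and sp: "\<And>\<D> A H. closed_cset \<D> A \<Longrightarrow> crel \<D> H \<Longrightarrow> cpred \<D> 2 (\<lambda>D xs. sp (A D) (H D) (xs ! 0) (xs ! 1))"
    and chk: "\<And>\<D> A H. closed_cset \<D> A \<Longrightarrow> crel \<D> H \<Longrightarrow> cpred \<D> 1 (\<lambda>D xs. chk (A D) (H D) (xs ! 0))"
    and dec: "closed_cset {D. \<exists>C R. good A c sp chk (code_rel C) R \<and> D \<in> infinite_subsets R} (\<lambda>D. A)"
    and nonempty: "good A c sp chk (code_rel C0) R0"
  shows "\<exists>K \<Psi> \<Theta>. Sigma11_class A K \<and> K \<noteq> {} \<and> K \<subseteq> infinite_subsets A \<and>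
      (\<forall>R \<in> K. \<forall>D \<in> infinite_subsets R. computes \<Psi> D A \<and> computes \<Theta> D R)"
proof -
  let ?K = "{R. \<exists>C. good A c sp chk (code_rel C) R}"
  let ?\<D> = "{D. \<exists>C R. good A c sp chk (code_rel C) R \<and> D \<in> infinite_subsets R}"
  define lo where "lo J = {w. 2 * w \<in> J}" for J :: "nat set"
  define hi where "hi J = {w. Suc (2 * w) \<in> J}" for J :: "nat set"
  have lohi: "lo (join A C) = A" "hi (join A C) = C" for C
    by (auto simp: lo_def hi_def join_def; presburger)+
  have lo: "closed_cset UNIV lo" and hi: "closed_cset UNIV hi"
    unfolding lo_def hi_def by (intro csetI cfun_oracle cfun_rules cfun_nth; simp)+
  note rel = crel_code[OF hi]
  have 1: "closed_cset UNIV (\<lambda>J. greedy (admissible (lo J) (code_rel (hi J)) c sp))"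
    by (rule cset_greedy_admissible[OF lo rel sp[OF lo rel]])
  obtain P where P: "cpred UNIV 1 (\<lambda>J xs. P J (xs ! 0))"
    "\<And>J. coherent (lo J) (code_rel (hi J)) \<longleftrightarrow> (\<forall>x. P J x)" using cpred_coherent[OF lo rel] by blast
  have "Sigma11_class A {R. \<exists>C. infinite R \<and> (\<forall>x. x \<in> R \<longleftrightarrow> x \<in> greedy (admissible (lo (join A C)) (code_rel (hi (join A C))) c sp)) \<and>
    (\<forall>x. P (join A C) x \<and> chk (lo (join A C)) (code_rel (hi (join A C))) x)}"
  proof (rule Sigma11_join)
    show "cpred UNIV 1 (\<lambda>J xs. xs ! 0 \<in> greedy (admissible (lo J) (code_rel (hi J)) c sp))"
      by (intro cpred_mem closed_cset[OF 1] cfun_nth) simp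
    show "cpred UNIV 1 (\<lambda>J xs. P J (xs ! 0) \<and> chk (lo J) (code_rel (hi J)) (xs ! 0))"
      by (intro cpred_conj P(1) chk[OF lo rel])
  qed
  moreover have "(infinite R \<and> (\<forall>x. x \<in> R \<longleftrightarrow> x \<in> greedy (admissible (lo (join A C)) (code_rel (hi (join A C))) c sp)) \<and>
    (\<forall>x. P (join A C) x \<and> chk (lo (join A C)) (code_rel (hi (join A C))) x)) \<longleftrightarrow> good A c sp chk (code_rel C) R" for R C
    unfolding good_def all_conj_distrib P(2)[symmetric] lohi set_eq_iff by blast
  ultimately have S: "Sigma11_class A ?K" by simp
  note sub = good_subset
  have ch: "chain A R H" if g: "good A c sp chk H R" for R H by (rule good_chain[OF _ g]) (rule typed)
  \<comment> \<open>The right-hand side of \<open>chain_code\<close>: it no longer mentions C and is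
    computable from D once A is.\<close>
  define HD where "HD D E e n m \<longleftrightarrow> finite E \<and> E \<subseteq> A \<and> follows A e n m (after E (least_above D (set_encode E + e + n + m)) D)" for D E e n m
  have inf: "infinite D" "D \<subseteq> A" if DD: "D \<in> ?\<D>" for D
  proof -
    obtain C R where "good A c sp chk (code_rel C) R" "D \<in> infinite_subsets R" using DD by blast
    then show "infinite D" "D \<subseteq> A" using good_subset[of A c sp chk "code_rel C" R] by (auto simp: infinite_subsets_iff)
  qed
  have HD: "HD D = code_rel C" if g: "good A c sp chk (code_rel C) R" and D: "D \<in> infinite_subsets R" for C R D
  proof (intro ext)
    fix E e n m
    show "HD D E e n m = code_rel C E e n m"
      using chain.chain_code[OF ch[OF g] D, of E e n m] by (auto simp: HD_def code_rel_def)
  qed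
  have "crel ?\<D> HD"
  proof -
    have "cpred ?\<D> 4 (\<lambda>D xs. set_decode (xs ! 0) \<subseteq> A \<and> follows A (xs ! 1) (xs ! 2) (xs ! 3)
       (after (set_decode (xs ! 0)) (least_above D (xs ! 0 + xs ! 1 + xs ! 2 + xs ! 3)) D))"
    proof (intro cpred_follows)
      fix D and xs :: "nat list" assume D: "D \<in> ?\<D>" and s: "set_decode (xs ! 0) \<subseteq> A"
      let ?r = "least_above D (xs ! 0 + xs ! 1 + xs ! 2 + xs ! 3)"
      have "D \<subseteq> {..?r} \<union> {z\<in>D. ?r < z}" by auto
      then have "infinite {z\<in>D. ?r < z}" using inf(1)[OF D] finite_subset by blast
      then have "after (set_decode (xs ! 0)) ?r D \<in> infinite_subsets A"
        using inf(2)[OF D] s by (auto simp: after_def infinite_subsets_iff)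
      then show "\<exists>s. typed A s (after (set_decode (xs ! 0)) ?r D)" by (rule typed)
    next
      show "cset ?\<D> 4 (\<lambda>D xs. after (set_decode (xs ! 0)) (least_above D (xs ! 0 + xs ! 1 + xs ! 2 + xs ! 3)) D)"
        by (intro cset_after cset_set_decode cset_oracle cfun_least_above cfun_add cfun_nth inf; simp)
    qed (intro closed_cset[OF dec] cpred_subset cfun_nth; simp)+
    then show ?thesis unfolding crel_def HD_def by simp
  qed
  then have T: "closed_cset ?\<D> (\<lambda>D. greedy (admissible A (HD D) c sp))"
    by (intro cset_greedy_admissible[OF dec] sp[OF dec])
  obtain \<Psi> where psi: "\<And>D xs. D \<in> ?\<D> \<Longrightarrow> length xs = 1 \<Longrightarrow> run D \<Psi> xs = Some (of_bool (xs ! 0 \<in> A))"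
    using dec unfolding cset_def cfun_def by auto
  obtain \<Theta> where th: "\<And>D xs. D \<in> ?\<D> \<Longrightarrow> length xs = 1 \<Longrightarrow> run D \<Theta> xs = Some (of_bool (xs ! 0 \<in> greedy (admissible A (HD D) c sp)))"
    using T unfolding cset_def cfun_def by auto
  show ?thesis
  proof (rule exI[of _ ?K], rule exI[of _ \<Psi>], rule exI[of _ \<Theta>], intro conjI ballI)
    show "?K \<noteq> {}" using nonempty by blast
    show "?K \<subseteq> infinite_subsets A" using sub by blast
    fix R D assume R: "R \<in> ?K" and D: "D \<in> infinite_subsets R"
    then obtain C where g: "good A c sp chk (code_rel C) R" by blast
    then have DD: "D \<in> ?\<D>" using D by blast
    show "computes \<Psi> D A" unfolding computes_def using psi[OF DD] by simp
    have "R = greedy (admissible A (code_rel C) c sp)" using g by (simp add: good_def)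
    then show "computes \<Theta> D R" unfolding computes_def using th[OF DD] HD[OF g D] by simp
  qed (rule S)
qed

section \<open>Existence\<close>

text \<open>If the greedy set were finite, every far enough element of X would be accepted over it,
  so a further element would have been taken.\<close>

lemma greedy_infinite:
  assumes X: "infinite X" and P: "\<And>F. finite F \<Longrightarrow> F \<subseteq> greedy P \<Longrightarrow> \<exists>b. \<forall>x\<in>X. b \<le> x \<longrightarrow> P F x"
  shows "infinite (greedy P)"
proof
  assume fin: "finite (greedy P)"
  then obtain b where b: "\<forall>x\<in>X. b \<le> x \<longrightarrow> P (greedy P) x" using P by blast
  obtain k where k: "\<forall>x\<in>greedy P. x < k" using fin finite_nat_set_iff_bounded by blast
  obtain x where x: "x \<in> X" "b + k \<le> x" using least_above_exists[OF X] by blast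
  have g: "greedy P \<inter> {..<x} = greedy P" using k x(2) by fastforce
  have "P (greedy P) x" using b x by simp
  then have "x \<in> greedy P" unfolding greedy_iff[of x P] g .
  then show False using k x(2) by fastforce
qed

lemma sparse_subset:
  fixes B :: "nat \<Rightarrow> nat"
  assumes "infinite X"
  shows "\<exists>D\<in>infinite_subsets X. \<forall>r\<in>D. \<forall>x\<in>D. r < x \<longrightarrow> B r \<le> x"
proof -
  define P where "P F x \<longleftrightarrow> x \<in> X \<and> (\<forall>r\<in>F. B r \<le> x)" for F x
  have "\<exists>b. \<forall>x\<in>X. b \<le> x \<longrightarrow> P F x" if "finite F" for F
  proof -
    have "B r \<le> (\<Sum>r\<in>F. B r)" if "r \<in> F" for r using that \<open>finite F\<close> by (intro member_le_sum) auto
    then show ?thesis unfolding P_def by (meson le_trans)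
  qed
  then have "infinite (greedy P)" by (intro greedy_infinite[OF assms])
  moreover have "greedy P \<subseteq> X" by (auto simp: greedy_def P_def)
  moreover have "B r \<le> x" if "r \<in> greedy P" "x \<in> greedy P" "r < x" for r x
    using greedy_iff[of x P] that unfolding P_def[of _ x] by blast
  ultimately show ?thesis by (intro bexI[of _ "greedy P"]) (auto simp: infinite_subsets_iff)
qed

lemma infinite_above: "infinite X \<Longrightarrow> infinite {x\<in>X. b \<le> (x::nat)}"
proof
  assume X: "infinite X" and f: "finite {x\<in>X. b \<le> x}"
  have "X \<subseteq> {..b} \<union> {x\<in>X. b \<le> x}" by auto
  then show False using X f by (meson finite_UnI finite_atMost finite_subset)
qed

text \<open>There is one colouring for each code of \<open>(E, e, n, m)\<close>, constantly false if
  E is not contained in A; C consists of the codes whose limit colour is true.\<close>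

lemma homogeneous_relation:
  assumes A: "infinite A" and typed: "\<And>D. D \<in> infinite_subsets A \<Longrightarrow> \<exists>s. typed A s D"
  obtains X C where "X \<in> infinite_subsets A"
    "\<And>E e n m. code_rel C E e n m \<Longrightarrow> E \<subseteq> A"
    "\<And>E e n m. finite E \<Longrightarrow> E \<subseteq> A \<Longrightarrow> \<exists>b. \<forall>D\<in>infinite_subsets X. (\<forall>x\<in>D. b \<le> x) \<longrightarrow>
       (code_rel C E e n m \<longleftrightarrow> follows A e n m (E \<union> D))"
proof -
  define above where "above E D = {x\<in>D. \<forall>y\<in>E. y < x}" for E D :: "nat set"
  define k where "k E e n m D \<longleftrightarrow> E \<subseteq> A \<and> follows A e n m (E \<union> above E D)" for E e n m D
  define c where "c p = (let (w, q) = prod_decode p; (e, r) = prod_decode q; (n, m) = prod_decode r in k (set_decode w) e n m)" for p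
  have cp: "c (prod_encode (set_encode E, prod_encode (e, prod_encode (n, m)))) = k E e n m" if "finite E" for E e n m
    using that by (simp add: c_def)
  have cont: "\<exists>b. \<forall>D'\<in>infinite_subsets A. D' \<inter> {..<b} = D \<inter> {..<b} \<longrightarrow> k E e n m D' = k E e n m D"
    if D: "D \<in> infinite_subsets A" and E: "finite E" for E e n m D
  proof (cases "E \<subseteq> A")
    case True
    obtain b where b: "\<forall>y\<in>E. y < b" using E finite_nat_set_iff_bounded by blast
    have "D \<subseteq> {..b} \<union> above E D" using b by (fastforce simp: above_def)
    then have "infinite (above E D)" using D finite_subset by (auto simp: infinite_subsets_iff)
    moreover have "above E D \<subseteq> A" using D by (auto simp: infinite_subsets_iff above_def)
    ultimately obtain s where s: "typed A s (E \<union> above E D)"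
      using typed[of "E \<union> above E D"] True by (auto simp: infinite_subsets_iff)
    have "k E e n m D' = k E e n m D" if d: "D' \<inter> {..<s} = D \<inter> {..<s}" for D'
    proof -
      have *: "(E \<union> above E X) \<inter> {..<s} = (E \<union> above E (X \<inter> {..<s})) \<inter> {..<s}" for X by (auto simp: above_def)
      have "(E \<union> above E D) \<inter> {..<s} = (E \<union> above E D') \<inter> {..<s}" unfolding *[of D] *[of D'] d ..
      from follows_cong[OF s this] show ?thesis by (simp add: k_def)
    qed
    then show ?thesis by blast
  qed (simp add: k_def)
  have cont': "\<exists>b. \<forall>D'\<in>infinite_subsets A. D' \<inter> {..<b} = D \<inter> {..<b} \<longrightarrow> c p D' = c p D"
    if D: "D \<in> infinite_subsets A" for p D
    unfolding c_def Let_def split_beta by (rule cont[OF D]) simp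
  show ?thesis
  proof (rule homogeneous[OF A cont'])
    fix X col assume X: "X \<in> infinite_subsets A"
      and hom: "\<And>p. \<exists>b. \<forall>D\<in>infinite_subsets X. (\<forall>x\<in>D. b \<le> x) \<longrightarrow> c p D = col p"
    have H: "\<exists>b. \<forall>D\<in>infinite_subsets X. (\<forall>x\<in>D. b \<le> x) \<longrightarrow>
       (code_rel {p. col p} E e n m \<longleftrightarrow> E \<subseteq> A \<and> follows A e n m (E \<union> D))" if E: "finite E" for E e n m
    proof -
      obtain b where b: "\<forall>D\<in>infinite_subsets X. (\<forall>x\<in>D. b \<le> x) \<longrightarrow>
        c (prod_encode (set_encode E, prod_encode (e, prod_encode (n, m)))) D =
        col (prod_encode (set_encode E, prod_encode (e, prod_encode (n, m))))" using hom by blast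
      obtain b' where b': "\<forall>y\<in>E. y < b'" using E finite_nat_set_iff_bounded by blast
      have "code_rel {p. col p} E e n m \<longleftrightarrow> E \<subseteq> A \<and> follows A e n m (E \<union> D)"
        if D: "D \<in> infinite_subsets X" "\<forall>x\<in>D. b + b' \<le> x" for D
      proof -
        have "above E D = D" using D(2) b' by (fastforce simp: above_def)
        moreover have "\<forall>x\<in>D. b \<le> x" using D(2) by auto
        ultimately show ?thesis using b[rule_format, OF D(1)] E unfolding cp[OF E] by (simp add: code_rel_def k_def)
      qed
      then show ?thesis by blast
    qed
    show thesis
    proof (rule that[OF X, of "{p. col p}"])
      fix E e n m
      show "E \<subseteq> A" if h: "code_rel {p. col p} E e n m"
      proof -
        have "finite E" using h by (simp add: code_rel_def)
        from H[OF this, of e n m] obtain b where b: "\<forall>D\<in>infinite_subsets X. (\<forall>x\<in>D. b \<le> x) \<longrightarrow>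
          (code_rel {p. col p} E e n m \<longleftrightarrow> E \<subseteq> A \<and> follows A e n m (E \<union> D))" by (elim exE) (rule that)
        have D: "{x\<in>X. b \<le> x} \<in> infinite_subsets X" using X infinite_above by (auto simp: infinite_subsets_iff)
        have "\<forall>x\<in>{x\<in>X. b \<le> x}. b \<le> x" by simp
        from mp[OF bspec[OF b D] this] have "code_rel {p. col p} E e n m \<longleftrightarrow> E \<subseteq> A \<and> follows A e n m (E \<union> {x\<in>X. b \<le> x})" .
        then show ?thesis using h by (rule conjunct1[OF iffD1])
      qed
      show "\<exists>b. \<forall>D\<in>infinite_subsets X. (\<forall>x\<in>D. b \<le> x) \<longrightarrow>
       (code_rel {p. col p} E e n m \<longleftrightarrow> follows A e n m (E \<union> D))" if "finite E" "E \<subseteq> A"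
        using H[OF that(1), of e n m] that(2) by simp
    qed
  qed
qed

text \<open>\<open>B r\<close> is a common bound for the finitely many questions with
  \<open>E \<subseteq> A \<inter> {..r}\<close> and e, n, m up to r.\<close>

locale generic =
  fixes A X :: "nat set" and H B
  assumes introenumerable: "introenumerable A"
    and X: "X \<in> infinite_subsets A"
    and HA: "\<And>E e n m. H E e n m \<Longrightarrow> E \<subseteq> A"
    and B: "\<And>E r e n m D. E \<subseteq> A \<inter> {..r} \<Longrightarrow> e \<le> r \<Longrightarrow> n \<le> r \<Longrightarrow> m \<le> r \<Longrightarrow> D \<in> infinite_subsets X \<Longrightarrow> \<forall>x\<in>D. B r \<le> x \<Longrightarrow>
      H E e n m \<longleftrightarrow> follows A e n m (E \<union> D)"
begin

lemma typed: "D \<in> infinite_subsets A \<Longrightarrow> \<exists>s. typed A s D"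
  by (rule typed_exists[OF introenumerable])

lemma tail: "{x\<in>X. b \<le> x} \<in> infinite_subsets X"
  using X infinite_above by (auto simp: infinite_subsets_iff)

text \<open>Adjoining far elements of X does not change E below the stage at which it is typed, so
  the limit colour is the colour of E itself.\<close>

lemma coherent: "coherent A H"
proof -
  have "H E e n m \<longleftrightarrow> follows A e n m E" if E: "finite E" "E \<subseteq> A" and z: "z \<in> E" "s \<le> z" "typed A s E" for E e n m z s
  proof -
    obtain b where b: "\<forall>y\<in>E. y < b" using E(1) finite_nat_set_iff_bounded by blast
    let ?r = "b + e + n + m"
    let ?D = "{x\<in>X. B ?r + b \<le> x}"
    have "E \<subseteq> A \<inter> {..?r}" using E(2) b by force
    moreover have "\<forall>x\<in>?D. B ?r \<le> x" by simp
    ultimately have "H E e n m \<longleftrightarrow> follows A e n m (E \<union> ?D)" using tail by (intro B) auto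
    moreover have "E \<inter> {..<s} = (E \<union> ?D) \<inter> {..<s}" using z(2) b z(1) by fastforce
    from follows_cong[OF z(3) this, of e n m] have "follows A e n m (E \<union> ?D) = follows A e n m E" .
    ultimately show ?thesis by (rule trans)
  qed
  then show ?thesis unfolding coherent_def by (intro allI impI conjI ballI HA) auto
qed

text \<open>Both values are the colour of one and the same set, namely E with x and a tail of X: it
  extends E by elements beyond \<open>B r\<close>, and \<open>insert x E\<close> by elements beyond
  \<open>B x\<close>.\<close>

lemma agrees_eventually:
  assumes x: "x \<in> X" "B r + Suc r \<le> x" shows "agrees A H r x"
  unfolding agrees_def
proof (intro allI impI)
  fix E e n m assume E: "E \<subseteq> A \<inter> {..r}" and le: "e \<le> r" "n \<le> r" "m \<le> r"
  let ?D = "{z\<in>X. B x + x \<le> z}"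
  have xA: "x \<in> A" using x X by (auto simp: infinite_subsets_iff)
  have "H E e n m \<longleftrightarrow> follows A e n m (E \<union> insert x ?D)"
  proof (rule B[OF E le])
    show "insert x ?D \<in> infinite_subsets X" using x tail[of "B x + x"] by (auto simp: infinite_subsets_iff)
    show "\<forall>y\<in>insert x ?D. B r \<le> y" using x(2) by auto
  qed
  also have "E \<union> insert x ?D = insert x E \<union> ?D" by blast
  also have "follows A e n m (insert x E \<union> ?D) \<longleftrightarrow> H (insert x E) e n m"
  proof (rule B[symmetric])
    show "insert x E \<subseteq> A \<inter> {..x}" using E x xA by auto
    show "?D \<in> infinite_subsets X" by (rule tail)
  qed (use le x in auto)
  finally show "H E e n m \<longleftrightarrow> H (insert x E) e n m" .
qed

lemma infinite_greedy:
  fixes sp :: "nat set \<Rightarrow> (nat set \<Rightarrow> nat \<Rightarrow> nat \<Rightarrow> nat \<Rightarrow> bool) \<Rightarrow> nat \<Rightarrow> nat \<Rightarrow> bool"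
  assumes "\<And>r. \<exists>b. \<forall>x\<ge>b. sp A H r x"
  shows "infinite (greedy (admissible A H c sp))"
proof (rule greedy_infinite)
  show "infinite X" using X by (simp add: infinite_subsets_iff)
  fix F :: "nat set" assume F: "finite F"
  obtain b where b: "\<And>r x. b r \<le> x \<Longrightarrow> sp A H r x" using assms by metis
  let ?s = "\<Sum>r\<in>F. b r + B r + Suc r"
  have "admissible A H c sp F x" if x: "x \<in> X" "Suc c + ?s \<le> x" for x
    unfolding admissible_def
  proof (intro conjI allI impI)
    show "x \<in> A" "c < x" using x X by (auto simp: infinite_subsets_iff)
    fix r assume "r \<in> F"
    then have "b r + B r + Suc r \<le> ?s" using F by (intro member_le_sum) auto
    then have "b r \<le> x" "B r + Suc r \<le> x" using x(2) by linarith+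
    then show "agrees A H r x" "sp A H r x" using agrees_eventually x(1) b by auto
  qed
  then show "\<exists>b. \<forall>x\<in>X. b \<le> x \<longrightarrow> admissible A H c sp F x" by blast
qed

text \<open>Take D in X so sparse that the part of D after any r in D lies beyond
  \<open>B r\<close>. With e0 the type of D, F0 is cut off at the first element at or above e0,
  which gives the uniqueness clause. The value of H at F0 is then the colour of D itself.\<close>

lemma root_exists:
  obtains d F0 e0 where "F0 \<subseteq> A \<inter> {..d}" "e0 \<le> d"
    "\<And>u v. u \<in> F0 \<Longrightarrow> v \<in> F0 \<Longrightarrow> e0 \<le> u \<Longrightarrow> e0 \<le> v \<Longrightarrow> u = v" "H F0 e0 0 0"
proof -
  have "infinite X" using X by (simp add: infinite_subsets_iff)
  obtain D where D: "D \<in> infinite_subsets X" "\<forall>r\<in>D. \<forall>x\<in>D. r < x \<longrightarrow> B r \<le> x"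
    using sparse_subset[OF \<open>infinite X\<close>, of B] by (elim bexE) (rule that)
  have DA: "D \<in> infinite_subsets A" and inf: "infinite D" "D \<subseteq> X" using D(1) X by (auto simp: infinite_subsets_iff)
  let ?s = "type_stage A D"
  have "typed A ?s D" unfolding type_stage_def by (rule LeastI_ex[OF typed[OF DA]])
  then have ex: "\<exists>e. type_at A e ?s D" unfolding typed_def by blast
  define e0 where "e0 = (LEAST e. type_at A e ?s D)"
  have "type_at A e0 ?s D" unfolding e0_def by (rule LeastI_ex[OF ex])
  moreover have "\<not> type_at A e ?s D" if "e < e0" for e using that unfolding e0_def by (rule not_less_Least)
  ultimately have k: "follows A e0 0 0 D" by (simp add: follows_def follows_at_def)
  let ?d = "least_above D e0"
  let ?F = "D \<inter> {..?d}" and ?D = "{x\<in>D. Suc ?d \<le> x}"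
  have d: "?d \<in> D" "e0 \<le> ?d" by (rule least_above[OF inf(1)])+
  show ?thesis
  proof (rule that[of ?F ?d e0])
    show F: "?F \<subseteq> A \<inter> {..?d}" using DA by (auto simp: infinite_subsets_iff)
    show "e0 \<le> ?d" by (rule d)
    show "u = v" if "u \<in> ?F" "v \<in> ?F" "e0 \<le> u" "e0 \<le> v" for u v
      using that least_above_le[of u D e0] least_above_le[of v D e0] by auto
    have "H ?F e0 0 0 \<longleftrightarrow> follows A e0 0 0 (?F \<union> ?D)"
    proof (rule B[OF F d(2)])
      show "?D \<in> infinite_subsets X" using inf infinite_above[OF inf(1)] by (auto simp: infinite_subsets_iff)
      show "\<forall>x\<in>?D. B ?d \<le> x" using D(2) d(1) by auto
    qed simp_all
    moreover have "?F \<union> ?D = D" by auto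
    ultimately show "H ?F e0 0 0" using k by simp
  qed
qed

end

lemma generic_exists:
  assumes "introenumerable A"
  obtains X C B where "generic A X (code_rel C) B"
proof -
  have A: "infinite A" using assms by (simp add: introenumerable_def)
  show ?thesis
  proof (rule homogeneous_relation[OF A typed_exists[OF assms]])
    fix X C assume X: "X \<in> infinite_subsets A" and HA: "\<And>E e n m. code_rel C E e n m \<Longrightarrow> E \<subseteq> A"
      and hom: "\<And>E e n m. finite E \<Longrightarrow> E \<subseteq> A \<Longrightarrow> \<exists>b. \<forall>D\<in>infinite_subsets X. (\<forall>x\<in>D. b \<le> x) \<longrightarrow>
       (code_rel C E e n m \<longleftrightarrow> follows A e n m (E \<union> D))"
    let ?P = "\<lambda>(E, e, n, m) b. \<forall>D\<in>infinite_subsets X. (\<forall>x\<in>D. b \<le> x) \<longrightarrow>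
       (code_rel C E e n m \<longleftrightarrow> follows A e n m (E \<union> D))"
    have mono: "?P i b'" if "?P i b" "b \<le> b'" for i b b'
      using that by (cases i) (auto intro: le_trans)
    have ex: "\<forall>r. \<exists>b. \<forall>i\<in>Pow (A \<inter> {..r}) \<times> {..r} \<times> {..r} \<times> {..r}. ?P i b"
    proof
      fix r :: nat
      let ?I = "Pow (A \<inter> {..r}) \<times> {..r} \<times> {..r} \<times> {..r}"
      have "\<forall>i\<in>?I. \<exists>b. ?P i b"
      proof
        fix i assume "i \<in> ?I"
        then obtain E e n m where i: "i = (E, e, n, m)" "E \<subseteq> A \<inter> {..r}" by (cases i) auto
        then have "finite E" "E \<subseteq> A" using finite_subset[of E "{..r}"] by auto
        from hom[OF this] show "\<exists>b. ?P i b" unfolding i(1) by simp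
      qed
      from bchoice[OF this] obtain b where b: "\<forall>i\<in>?I. ?P i (b i)" by (elim exE) (rule that)
      have "?P i (\<Sum>i\<in>?I. b i)" if i: "i \<in> ?I" for i
      proof (rule mono)
        show "?P i (b i)" using b i by (rule bspec)
        show "b i \<le> (\<Sum>i\<in>?I. b i)" using i by (intro member_le_sum) auto
      qed
      then show "\<exists>b. \<forall>i\<in>?I. ?P i b" by (intro exI ballI)
    qed
    from choice[OF ex] obtain B where B: "\<forall>r. \<forall>i\<in>Pow (A \<inter> {..r}) \<times> {..r} \<times> {..r} \<times> {..r}. ?P i (B r)"
      by (elim exE) (rule that)
    have "generic A X (code_rel C) B"
    proof
      show "code_rel C E e n m \<longleftrightarrow> follows A e n m (E \<union> D)"
        if "E \<subseteq> A \<inter> {..r}" "e \<le> r" "n \<le> r" "m \<le> r" "D \<in> infinite_subsets X" "\<forall>x\<in>D. B r \<le> x" for E r e n m D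
        using B[rule_format, of "(E, e, n, m)" r] that by auto
    qed (rule assms, rule X, rule HA)
    then show thesis by (rule that)
  qed
qed

section \<open>The theorem: all columns finite, or one column infinite\<close>

lemma cset_cong: "cset \<D> k S \<Longrightarrow> (\<And>D xs. D \<in> \<D> \<Longrightarrow> length xs = k \<Longrightarrow> S D xs = T D xs) \<Longrightarrow> cset \<D> k T"
  unfolding cset_def by (erule cfun_cong) simp

theorem theorem1p1:
  fixes A :: "nat set"
  assumes "infinite A" and "introenumerable A"
  shows "(\<exists>R \<in> infinite_subsets A. uniformly_introreducible R) \<and>
    (\<exists>K \<Psi> \<Theta>. Sigma11_class A K \<and> K \<noteq> {} \<and> K \<subseteq> infinite_subsets A \<and>
      (\<forall>R \<in> K. \<forall>D \<in> infinite_subsets R. computes \<Psi> D A \<and> computes \<Theta> D R))"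
proof -
  obtain X C0 B where "generic A X (code_rel C0) B" by (rule generic_exists[OF assms(2)])
  then interpret generic A X "code_rel C0" B .
  obtain d F0 e0 where root: "F0 \<subseteq> A \<inter> {..d}" "e0 \<le> d"
    "\<And>u v. u \<in> F0 \<Longrightarrow> v \<in> F0 \<Longrightarrow> e0 \<le> u \<Longrightarrow> e0 \<le> v \<Longrightarrow> u = v" "code_rel C0 F0 e0 0 0"
    by (rule root_exists) (rule that)
  have F0: "finite F0" using root(1) finite_subset by blast
  have F0w: "set_decode (set_encode F0) = F0" using F0 by (simp add: set_encode_inverse)
  have cH: "cpred \<D> k (\<lambda>D xs. H D F0 e0 (N D xs) (M D xs))"
    if "crel \<D> H" "cfun \<D> k N" "cfun \<D> k M" for \<D> k H N M
    using cpred_rel[OF that(1) cfun_const[of \<D> k "set_encode F0"] cfun_const[of \<D> k e0] that(2,3)] F0w by simp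
  \<comment> \<open>F0 and e0 come from C0, but the class contains other relations too; that e0 is
    the type after F0 is therefore imposed on each of them through \<open>chk\<close>.\<close>
  have rooted: "rooted A R H c F0 e0" if "good A c sp chk H R" "d \<le> c" "H F0 e0 0 0" for R H c sp chk
  proof -
    interpret chain A R H by (rule good_chain[OF _ that(1)]) (rule typed)
    show ?thesis
    proof
      show "c < x" if "x \<in> R" for x
        using \<open>good A c sp chk H R\<close> that greedy_admissible_iff[of x A H c sp] by (simp add: good_def)
      show "F0 \<subseteq> A \<inter> {..c}" "e0 \<le> c" using root(1,2) that(2) by auto
    qed (rule root(3) that(3); assumption)+
  qed
  have "\<exists>K \<Psi> \<Theta>. Sigma11_class A K \<and> K \<noteq> {} \<and> K \<subseteq> infinite_subsets A \<and>
      (\<forall>R \<in> K. \<forall>D \<in> infinite_subsets R. computes \<Psi> D A \<and> computes \<Theta> D R)"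
  proof (cases "\<forall>n\<in>A. finite {m. code_rel C0 F0 e0 n m}")
    case True
    \<comment> \<open>A new element avoids the columns of all n \<le> r in A. For C0 this excludes
      finitely many numbers for each r, which keeps the greedy set infinite; for other members of
      the class the spacing holds by construction.\<close>
    define sp where "sp A H r x \<longleftrightarrow> (\<forall>n\<le>r. n \<in> A \<longrightarrow> \<not> H F0 e0 n x)"
      for A :: "nat set" and H :: "nat set \<Rightarrow> nat \<Rightarrow> nat \<Rightarrow> nat \<Rightarrow> bool" and r x
    define chk where "chk A H x \<longleftrightarrow> H F0 e0 0 0"
      for A :: "nat set" and H :: "nat set \<Rightarrow> nat \<Rightarrow> nat \<Rightarrow> nat \<Rightarrow> bool" and x :: nat
    let ?\<D> = "{D. \<exists>C R. good A d sp chk (code_rel C) R \<and> D \<in> infinite_subsets R}"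
    have ro: "rooted A R (code_rel C) d F0 e0" if g: "good A d sp chk (code_rel C) R" for C R
    proof (rule rooted[OF g order_refl])
      show "code_rel C F0 e0 0 0" using g by (simp add: good_def chk_def)
    qed
    show ?thesis
    proof (rule Sigma11_class_of_reduction[OF typed, where sp=sp and chk=chk and c=d])
      fix \<D> A H assume A: "closed_cset \<D> A" and H: "crel \<D> H"
      show "cpred \<D> 2 (\<lambda>D xs. sp (A D) (H D) (xs ! 0) (xs ! 1))"
        unfolding sp_def by (intro cfun_rules cH[OF H] closed_cset[OF A] cfun_weak cfun_nth; simp)
      show "cpred \<D> 1 (\<lambda>D xs. chk (A D) (H D) (xs ! 0))"
        unfolding chk_def by (intro cH[OF H] cfun_const)
    next
      have "closed_cset ?\<D> (decode_finite F0 e0)"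
      proof (rule cset_decode_finite[OF _ F0])
        fix D assume "D \<in> ?\<D>"
        then obtain C R where g: "good A d sp chk (code_rel C) R" and D: "D \<in> infinite_subsets R" by blast
        show "infinite D" using D by (simp add: infinite_subsets_iff)
        interpret rooted A R "code_rel C" d F0 e0 by (rule ro[OF g])
        fix n assume "n \<in> D"
        then have n: "n \<in> R" "n \<in> A" using D R by (auto simp: infinite_subsets_iff)
        show "\<exists>t. n \<in> enum_stage e0 t (after F0 n D)"
          using after_entry_time(1)[OF n(1) D refl n(2) order_refl] by blast
      qed
      then show "closed_cset ?\<D> (\<lambda>D. A)"
      proof (rule cset_cong)
        fix D assume "D \<in> ?\<D>"
        then obtain C R where g: "good A d sp chk (code_rel C) R" and D: "D \<in> infinite_subsets R" by blast
        interpret rooted A R "code_rel C" d F0 e0 by (rule ro[OF g])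
        have RR: "R = greedy (admissible A (code_rel C) d sp)" using g by (simp add: good_def)
        show "decode_finite F0 e0 D = A"
        proof (rule decode_finite[OF D])
          show "\<not> code_rel C F0 e0 n x" if "r \<in> R" "x \<in> R" "r < x" "n \<le> r" "n \<in> A" for r x n
            using greedy_admissible_iff[of x A "code_rel C" d sp] that unfolding RR[symmetric] sp_def by blast
        qed
      qed
      show "good A d sp chk (code_rel C0) (greedy (admissible A (code_rel C0) d sp))"
        unfolding good_def
      proof (intro conjI refl coherent infinite_greedy allI)
        show "chk A (code_rel C0) x" for x using root(4) by (simp add: chk_def)
        fix r
        have "finite (\<Union>n\<in>A \<inter> {..r}. {m. code_rel C0 F0 e0 n m})" using True by auto
        then obtain b where "\<forall>m\<in>(\<Union>n\<in>A \<inter> {..r}. {m. code_rel C0 F0 e0 n m}). m < b" using finite_nat_set_iff_bounded by blast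
        then show "\<exists>b. \<forall>x\<ge>b. sp A (code_rel C0) r x" unfolding sp_def by (intro exI[of _ b]) fastforce
      qed
    qed
  next
    case False
    then obtain n0 where n0: "n0 \<in> A" "infinite {m. code_rel C0 F0 e0 n0 m}" by blast
    let ?S = "\<lambda>H. {m. H F0 e0 n0 m}"
    have "?S (code_rel C0) \<subseteq> A"
    proof -
      \<comment> \<open>A greedy set without spacing, built to make \<open>section_subset\<close>
        available for \<open>code_rel C0\<close>.\<close>
      define sp where "sp A H r x \<longleftrightarrow> True"
        for A :: "nat set" and H :: "nat set \<Rightarrow> nat \<Rightarrow> nat \<Rightarrow> nat \<Rightarrow> bool" and r x :: nat
      have "good A d sp (\<lambda>A H x. True) (code_rel C0) (greedy (admissible A (code_rel C0) d sp))"
        unfolding good_def by (intro conjI refl coherent infinite_greedy allI) (auto simp: sp_def)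
      then interpret rooted A "greedy (admissible A (code_rel C0) d sp)" "code_rel C0" d F0 e0
        by (rule rooted) (use root(4) in auto)
      show ?thesis using section_subset[OF n0(1)] by blast
    qed
    then have "?S (code_rel C0) \<in> infinite_subsets A" using n0(2) by (simp add: infinite_subsets_iff)
    then have "ce_in (?S (code_rel C0)) A" using assms(2) unfolding introenumerable_def by blast
    then obtain e' where e': "A = (\<Union>s. enum_stage e' s (?S (code_rel C0)))" using enum_stage_imp by blast
    have eA: "n \<in> A \<longleftrightarrow> (\<exists>s. n \<in> enum_stage e' s (?S (code_rel C0)))" for n by (subst e') simp
    \<comment> \<open>Spacing now bounds enumeration: x must be a stage by which all elements of A
      up to r have been enumerated from the column.\<close>
    define sp where "sp A H r x \<longleftrightarrow> (\<forall>n\<le>r. n \<in> A \<longrightarrow> n \<in> enum_stage e' x (?S H))"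
      for A :: "nat set" and H :: "nat set \<Rightarrow> nat \<Rightarrow> nat \<Rightarrow> nat \<Rightarrow> bool" and r x
    \<comment> \<open>From the column of another relation, \<open>e'\<close> might enumerate numbers
      outside A; the second conjunct is a universal condition that excludes this. The bound n < x
      loses nothing, by \<open>enum_stage_less\<close>.\<close>
    define chk where "chk A H x \<longleftrightarrow> H F0 e0 0 0 \<and> (\<forall>n<x. n \<in> enum_stage e' x (?S H) \<longrightarrow> n \<in> A)"
      for A :: "nat set" and H :: "nat set \<Rightarrow> nat \<Rightarrow> nat \<Rightarrow> nat \<Rightarrow> bool" and x :: nat
    \<comment> \<open>Places n0 below every element of R, as \<open>column\<close> requires.\<close>
    let ?c = "d + n0"
    let ?\<D> = "{D. \<exists>C R. good A ?c sp chk (code_rel C) R \<and> D \<in> infinite_subsets R}"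
    have ro: "rooted A R (code_rel C) ?c F0 e0" if g: "good A ?c sp chk (code_rel C) R" for C R
    proof (rule rooted[OF g])
      show "code_rel C F0 e0 0 0" using g by (simp add: good_def chk_def)
    qed simp
    show ?thesis
    proof (rule Sigma11_class_of_reduction[OF typed, where sp=sp and chk=chk and c="?c"])
      fix \<D> A H assume A: "closed_cset \<D> A" and H: "crel \<D> H"
      have S: "closed_cset \<D> (\<lambda>D. ?S (H D))"
        by (intro csetI cH[OF H] cfun_const cfun_nth) simp
      show "cpred \<D> 2 (\<lambda>D xs. sp (A D) (H D) (xs ! 0) (xs ! 1))"
        unfolding sp_def by (intro cfun_rules cset_enum_stage closed_cset[OF S] closed_cset[OF A] cset_weak cfun_weak cfun_nth; simp)
      show "cpred \<D> 1 (\<lambda>D xs. chk (A D) (H D) (xs ! 0))"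
        unfolding chk_def by (intro cfun_rules cH[OF H] cset_enum_stage closed_cset[OF S] closed_cset[OF A] cset_weak cfun_weak cfun_nth; simp)
    next
      have "closed_cset ?\<D> (decode_infinite F0 e0 n0 e')"
      proof (rule cset_decode_infinite[OF _ F0])
        fix D assume "D \<in> ?\<D>"
        then obtain C R where g: "good A ?c sp chk (code_rel C) R" and D: "D \<in> infinite_subsets R" by blast
        show "infinite D" using D by (simp add: infinite_subsets_iff)
        interpret rooted A R "code_rel C" ?c F0 e0 by (rule ro[OF g])
        fix r assume "r \<in> D"
        then have r: "r \<in> R" using D by (auto simp: infinite_subsets_iff)
        then have "n0 \<le> r" using c[OF r] by simp
        then show "\<exists>t. n0 \<in> enum_stage e0 t (after F0 r D)"
          using after_entry_time(1)[OF r D refl n0(1)] by blast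
      qed
      then show "closed_cset ?\<D> (\<lambda>D. A)"
      proof (rule cset_cong)
        fix D assume "D \<in> ?\<D>"
        then obtain C R where g: "good A ?c sp chk (code_rel C) R" and D: "D \<in> infinite_subsets R" by blast
        interpret rooted A R "code_rel C" ?c F0 e0 by (rule ro[OF g])
        have RR: "R = greedy (admissible A (code_rel C) ?c sp)" using g by (simp add: good_def)
        show "decode_infinite F0 e0 n0 e' D = A"
        proof (rule decode_infinite[OF D n0(1)])
          show "enum_stage e' x (?S (code_rel C)) \<subseteq> A" for x
            using g enum_stage_less[of _ e' x] unfolding good_def chk_def by blast
          show "n \<in> enum_stage e' x (?S (code_rel C))" if "r \<in> R" "x \<in> R" "r < x" "n \<le> r" "n \<in> A" for r x n
            using greedy_admissible_iff[of x A "code_rel C" ?c sp] that unfolding RR[symmetric] sp_def by blast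
        qed simp
      qed
      show "good A ?c sp chk (code_rel C0) (greedy (admissible A (code_rel C0) ?c sp))"
        unfolding good_def
      proof (intro conjI refl coherent infinite_greedy allI)
        show "chk A (code_rel C0) x" for x using root(4) eA unfolding chk_def by blast
        fix r
        define g where "g n = (SOME s. n \<in> enum_stage e' s (?S (code_rel C0)))" for n
        have g: "n \<in> enum_stage e' (g n) (?S (code_rel C0))" if "n \<in> A" for n
          using that unfolding eA g_def by (rule someI_ex)
        show "\<exists>b. \<forall>x\<ge>b. sp A (code_rel C0) r x" unfolding sp_def
        proof (intro exI[of _ "\<Sum>n\<le>r. g n"] allI impI)
          fix x n assume x: "(\<Sum>n\<le>r. g n) \<le> x" and n: "n \<le> r" "n \<in> A"
          have "g n \<le> (\<Sum>n\<le>r. g n)" using n(1) by (intro member_le_sum) auto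
          then show "n \<in> enum_stage e' x (?S (code_rel C0))" using g[OF n(2)] enum_stage_mono[of "g n" x e'] x by auto
        qed
      qed
    qed
  qed
  then obtain K \<Psi> \<Theta> where K: "Sigma11_class A K" "K \<noteq> {}" "K \<subseteq> infinite_subsets A"
    "\<forall>R \<in> K. \<forall>D \<in> infinite_subsets R. computes \<Psi> D A \<and> computes \<Theta> D R" by blast
  obtain R where R: "R \<in> K" using K(2) by blast
  then have "R \<in> infinite_subsets A" using K(3) by blast
  moreover have "uniformly_introreducible R"
    using K(4) R calculation unfolding uniformly_introreducible_def infinite_subsets_iff[of R A] by blast
  ultimately show ?thesis using K by blast
qed

end
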